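(* Let $\Phi$ be a quantum thick morphism from $M_1$ to $M_2$ with quantum generating function $S_\hbar(x,q)=S^0_\hbar(x)+\varphi^i_\hbar(x)q_i+S^{ij}_\hbar(x)q_iq_j+\cdots$ in local coordinates $x,y$ on $M_1,M_2$. Let $x=x(x')$, $y=y(y')$ be an invertible change of local coordinates with conjugate momenta $p',q'$, and let $y'=y'(y)$, with components $y^{\alpha'}(y)$, be the inverse change of coordinates. Let $S'_\hbar(x',q')$ be the generating function in the new coordinates, i.e. $$e^{\frac i\hbar S'_\hbar(x',q')}=\int dy\,\frac{dq}{(2\pi\hbar)^d}\;e^{\frac i\hbar\left(S_\hbar(x(x'),q)+y^{\alpha'}(y)q_{\alpha'}-y^\alpha q_\alpha\right)},\qquad d=\dim M_2.$$ Then $S'_\hbar(x',q')$ has the expansion as a formal power series in $q'$ $$S'_\hbar(x',q')=\sum_{\gamma\in[\Gamma^\circ]}\frac{q'_{\alpha_\gamma}}{|\mathrm{sym}(\gamma)|}\left(\frac\hbar i\right)^{b_\gamma}\langle S_\hbar,y';\gamma\rangle^{\alpha_\gamma}(x').$$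
   Context: Manifolds are ordinary (non-super). A quantum generating function is a formal power series in the target momenta $q$ whose coefficients are smooth in $x$ and formal power series in $\hbar$, symmetric in their indices; a quantum thick morphism is a collection of such functions in each coordinate system. Repeated indices are summed. $S_\hbar^{a_1\dots a_m}(x)$ is the coefficient of $q_{a_1}\cdots q_{a_m}$ ($S^i_\hbar=\varphi^i_\hbar$; no indices: $S^0_\hbar$); $\varphi_\hbar(x)=(\varphi^i_\hbar(x))$; $q_{\alpha'}$ are the components of $q'$. The integral is formal: $e^{\frac i\hbar S_\hbar^+}$, where $S_\hbar^+$ is the part of $S_\hbar(x(x'),q)$ of order $\ge2$ in $q$, is expanded in powers of $q$ and each term is evaluated by Fourier inversion, $\int dy\frac{dq}{(2\pi\hbar)^d}e^{\frac i\hbar(c^\alpha-y^\alpha)q_\alpha}q_{a_1}\cdots q_{a_m}f(y)=(\hbar/i)^m\partial_{a_1}\cdots\partial_{a_m}f(c)$ with $c=\varphi_\hbar(x(x'))$; functions at $\varphi_\hbar$ are Taylor expanded in $\hbar$ about the $\hbar^0$ term. $S'_\hbar$ is the formal logarithm. Equalities are of formal series in $q'$ and $\hbar$, compared degree by degree, where $S_\hbar^{a_1\dots a_m}$ with $m\ge2$ has degree $m$. A bipartite graph is $\gamma=(B_\gamma,W_\gamma,E_\gamma)$ with black vertices $B_\gamma=\{1,\dots,n\}$, white vertices $W_\gamma=\{-1,\dots,-m\}$ and a finite multiset $E_\gamma$ of elements of $B_\gamma\times W_\gamma$ (edges; parallel edges are allowed but not distinguished). $|\gamma|$ is the number of vertices,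 $b_\gamma:=|E_\gamma|-|\gamma|+1$. An isomorphism is a pair of permutations of the black and white vertices preserving edge multiplicities; $\mathrm{sym}(\gamma)$ is the automorphism group (permutations of parallel edges not counted). $\Gamma^\circ$ is the set of nonempty connected bipartite graphs whose leaves (vertices attached to exactly one edge) are all white, including the one-vertex graphs $\bullet$ and $\circ$; $[\Gamma^\circ]$ is its set of isomorphism classes. To $\gamma$ is attached the multi-index $\alpha_\gamma=\prod_{w\in W_\gamma}a_w$ of dummy labels, and $q'_{\alpha_\gamma}=\prod_w q'_{a_w}$. For a vertex $v$ let $e^v_1,\dots,e^v_{m_v}$ be the edges attached to it, used as dummy summation indices, and for black $v$ let $k^v_i$ be the number of white vertices with which $v$ shares exactly $i$ edges. Define $$\langle S_\hbar,y';\gamma\rangle^{\alpha_\gamma}(x'):=\Big(\prod_{v\in B_\gamma}\frac{m_v!}{(1!)^{k^v_1}(2!)^{k^v_2}\cdots(m_v!)^{k^v_{m_v}}}S_\hbar^{e^v_1\dots e^v_{m_v}}(x(x'))\Big)\Big(\prod_{w\in W_\gamma}\frac{\partial}{\partial y^{e^w_1}}\cdots\frac{\partial}{\partial y^{e^w_{m_w}}}y^{a'_w}\big(\varphi_\hbar(x(x'))\big)\Big),$$ where $y^{a'_w}$ is the $a_w$-th component of $y'(y)$. In the formula all labels $a_w$ are summed over. *)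

theory Defs
  imports
    "HOL-Analysis.Analysis"
    "HOL-Computational_Algebra.Formal_Laurent_Series"
    "HOL-Combinatorics.Permutations"
begin

section \<open>Smooth functions and changes of coordinates\<close>

definition partial :: "'d::finite \<Rightarrow> (real ^ 'd \<Rightarrow> 'b::real_normed_vector) \<Rightarrow> real ^ 'd \<Rightarrow> 'b" where
  "partial a f y = frechet_derivative f (at y) (axis a 1)"

fun partials :: "'d::finite list \<Rightarrow> (real ^ 'd \<Rightarrow> 'b::real_normed_vector) \<Rightarrow> real ^ 'd \<Rightarrow> 'b" where
  "partials [] f = f"
| "partials (a # as) f = partial a (partials as f)"

text \<open>On an open set this is \<open>C\<^sup>\<infinity>\<close>: differentiability of all iterated partial derivatives
  makes all of them continuous.\<close>

definition smooth_on :: "(real ^ 'd::finite) set \<Rightarrow> (real ^ 'd \<Rightarrow> 'b::real_normed_vector) \<Rightarrow> bool" where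
  "smooth_on U f \<longleftrightarrow> (\<forall>as. partials as f differentiable_on U)"

definition coordinate_change ::
  "(real ^ 'd::finite) set \<Rightarrow> (real ^ 'd) set \<Rightarrow> (real ^ 'd \<Rightarrow> real ^ 'd) \<Rightarrow> (real ^ 'd \<Rightarrow> real ^ 'd) \<Rightarrow> bool"
where
  "coordinate_change A B f g \<longleftrightarrow>
     open A \<and> open B \<and> f ` A \<subseteq> B \<and> g ` B \<subseteq> A \<and>
     (\<forall>u\<in>A. g (f u) = u) \<and> (\<forall>v\<in>B. f (g v) = v) \<and> smooth_on A f \<and> smooth_on B g"

section \<open>Quantum generating functions\<close>

text \<open>A generating function is given by its tensor coefficients:
  \<open>S [a\<^sub>1, \<dots>, a\<^sub>m] x\<close> is the coefficient of the index tuple \<open>(a\<^sub>1, \<dots>, a\<^sub>m)\<close> in the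
  sum over all tuples, a formal power series in \<open>\<hbar>\<close>.  Coefficients are complex because the
  factors of \<open>\<i>\<close> in the transformation law do not preserve real ones; but the classical part of
  \<open>\<phi>\<^sub>\<hbar>\<close> is a genuine map of coordinate domains, so it is real with values in \<open>V\<close>.\<close>

type_synonym ('n, 'd) gen_fun = "'d list \<Rightarrow> real ^ 'n \<Rightarrow> complex fps"

definition quantum_generating_function ::
  "(real ^ 'n::finite) set \<Rightarrow> (real ^ 'd::finite) set \<Rightarrow> ('n, 'd) gen_fun \<Rightarrow> bool"
where
  "quantum_generating_function U V S \<longleftrightarrow>
     (\<forall>as bs. mset as = mset bs \<longrightarrow> (\<forall>x\<in>U. S as x = S bs x)) \<and>
     (\<forall>as k. smooth_on U (\<lambda>x. fps_nth (S as x) k)) \<and>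
     (\<forall>x\<in>U. \<exists>y\<in>V. \<forall>a. fps_nth (S [a] x) 0 = of_real (y $ a))"

section \<open>The formal integral\<close>

text \<open>The variable of \<open>complex fps\<close> and \<open>complex fls\<close> is \<open>\<hbar>\<close>; negative powers occur only in
  intermediate terms.\<close>

definition hbar_over_i :: "complex fls" where
  "hbar_over_i = fls_const (1 / \<i>) * fls_X"

definition i_over_hbar :: "complex fls" where
  "i_over_hbar = fls_const \<i> * fls_X_inv"

text \<open>\<open>g(c)\<close> for \<open>c = c\<^sub>0 + \<hbar> c\<^sub>1 + \<dots>\<close>, Taylor expanded about the point \<open>c\<^sub>0\<close>.  As \<open>c - c\<^sub>0\<close> is
  divisible by \<open>\<hbar>\<close>, Taylor terms of order above \<open>n\<close> do not contribute to \<open>\<hbar>\<^sup>n\<close>.\<close>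

definition formal_eval :: "(real ^ 'd::finite \<Rightarrow> real) \<Rightarrow> ('d \<Rightarrow> complex fps) \<Rightarrow> complex fps" where
  "formal_eval g c = Abs_fps (\<lambda>n. \<Sum>k\<le>n. \<Sum>as | length as = k.
     of_real (partials as g (\<chi> a. Re (fps_nth (c a) 0))) / fact k *
     fps_nth (\<Prod>a\<leftarrow>as. c a - fps_const (fps_nth (c a) 0)) n)"

text \<open>The value \<open>(\<hbar>/\<i>)\<^sup>m \<partial>\<^sub>a\<^sub>1 \<dots> \<partial>\<^sub>a\<^sub>m g(c)\<close> assigned to
  \<open>\<integral> dy dq/(2\<pi>\<hbar>)\<^sup>d e\<^bsup>(\<i>/\<hbar>)(c - y)q\<^esup> q\<^sub>a\<^sub>1 \<dots> q\<^sub>a\<^sub>m g(y)\<close>.\<close>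

definition fourier_inversion ::
  "'d::finite list \<Rightarrow> (real ^ 'd \<Rightarrow> real) \<Rightarrow> ('d \<Rightarrow> complex fps) \<Rightarrow> complex fls" where
  "fourier_inversion as g c = hbar_over_i ^ length as * fps_to_fls (formal_eval (partials as g) c)"

text \<open>Coefficient of the monomial \<open>q'\<^sup>M\<close> in \<open>(y\<^sup>\<alpha>' q\<^sub>\<alpha>')\<^sup>n\<close>, \<open>n = |M|\<close>.\<close>

definition linear_power_coeff ::
  "(real ^ 'd::finite \<Rightarrow> real ^ 'd) \<Rightarrow> 'd multiset \<Rightarrow> real ^ 'd \<Rightarrow> real" where
  "linear_power_coeff Y' M y = (\<Sum>bs | mset bs = M. \<Prod>b\<leftarrow>bs. Y' y $ b)"

text \<open>Coefficient of \<open>q'\<^sup>M\<close> in the formal integral with the factor \<open>e\<^bsup>(\<i>/\<hbar>) S\<^sup>0\<^esup>\<close> removed (it depends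
  on \<open>x\<close> only, and is not a Laurent series in \<open>\<hbar>\<close>).  Both \<open>e\<^bsup>(\<i>/\<hbar>) S\<^sup>+\<^esup>\<close> and
  \<open>e\<^bsup>(\<i>/\<hbar>) y\<^sup>\<alpha>' q\<^sub>\<alpha>'\<^esup>\<close> are expanded; \<open>L\<close> lists the index tuples of the factors of \<open>S\<^sup>+\<close>,
  and the variable of the outer \<open>fps\<close> records the degree in which series are compared:
  \<open>S\<^bsup>a\<^sub>1\<dots>a\<^sub>m\<^esup>\<close> with \<open>m \<ge> 2\<close> has degree \<open>m\<close>.\<close>

definition thick_integral ::
  "('n::finite, 'd::finite) gen_fun \<Rightarrow> (real ^ 'd \<Rightarrow> real ^ 'd) \<Rightarrow> real ^ 'n \<Rightarrow>
   'd multiset \<Rightarrow> complex fls fps"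
where
  "thick_integral S Y' x M = Abs_fps (\<lambda>N.
     \<Sum>L | (\<forall>as\<in>set L. 2 \<le> length as) \<and> length (concat L) = N.
       i_over_hbar ^ length L / fact (length L) * fps_to_fls (\<Prod>as\<leftarrow>L. S as x) *
       (i_over_hbar ^ size M / fact (size M) *
        fourier_inversion (concat L) (linear_power_coeff Y' M) (\<lambda>a. S [a] x)))"

lemma finite_index_tuples:
  "finite {L :: 'd::finite list list. (\<forall>as\<in>set L. 2 \<le> length as) \<and> length (concat L) = N}"
proof (rule finite_subset)
  let ?A = "{as :: 'd list. set as \<subseteq> UNIV \<and> length as \<le> N}"
  show "{L :: 'd list list. (\<forall>as\<in>set L. 2 \<le> length as) \<and> length (concat L) = N}
      \<subseteq> {L. set L \<subseteq> ?A \<and> length L \<le> N}"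
  proof safe
    fix L :: "'d list list" assume L: "\<forall>as\<in>set L. 2 \<le> length as" "N = length (concat L)"
    have "length L \<le> length (concat L)" using L(1) by (induction L) auto
    then show "length L \<le> length (concat L)" .
    fix as assume "as \<in> set L"
    then show "length as \<le> length (concat L)"
      by (simp add: length_concat member_le_sum_list)
  qed simp
  have "finite ?A" by (rule finite_lists_length_le) simp
  then show "finite {L. set L \<subseteq> ?A \<and> length L \<le> N}" by (rule finite_lists_length_le)
qed

section \<open>Formal power series in several variables and the formal logarithm\<close>

text \<open>A formal power series in variables indexed by \<open>'d\<close> is its coefficient function on monomials,
  which are multisets of variables.\<close>

definition series_one :: "'d multiset \<Rightarrow> 'c::comm_ring_1" where
  "series_one M = (if M = {#} then 1 else 0)"

definition series_mult ::
  "('d multiset \<Rightarrow> 'c::comm_ring_1) \<Rightarrow> ('d multiset \<Rightarrow> 'c) \<Rightarrow> 'd multiset \<Rightarrow> 'c" where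
  "series_mult F G M = (\<Sum>A | A \<subseteq># M. F A * G (M - A))"

text \<open>\<open>log Z = \<Sum>\<^sub>k (-1)\<^bsup>k+1\<^esup> (Z - 1)\<^sup>k / k\<close> for \<open>Z\<close> with constant term \<open>1\<close>: then the
  \<open>k\<close>-th power starts in degree \<open>k\<close>, so the coefficient at \<open>M\<close> only involves \<open>k \<le> |M|\<close>.\<close>

definition formal_log :: "('d multiset \<Rightarrow> complex fls fps) \<Rightarrow> 'd multiset \<Rightarrow> complex fls fps" where
  "formal_log Z M = (\<Sum>k = 1..size M.
     fps_const ((-1) ^ (k + 1) / of_nat k) *
     (series_mult (\<lambda>A. Z A - series_one A) ^^ k) series_one M)"

text \<open>Coefficient of \<open>q'\<^sup>M\<close> in \<open>S'\<^sub>\<hbar> = S\<^sup>0 + (\<hbar>/\<i>) log Z\<close>, where \<open>e\<^bsup>(\<i>/\<hbar>) S\<^sup>0\<^esup> Z\<close> is the integral.\<close>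

definition transformed_gen_fun ::
  "('n::finite, 'd::finite) gen_fun \<Rightarrow> (real ^ 'd \<Rightarrow> real ^ 'd) \<Rightarrow> real ^ 'n \<Rightarrow>
   'd multiset \<Rightarrow> complex fls fps"
where
  "transformed_gen_fun S Y' x M =
     fps_const (fps_to_fls (S [] x)) * series_one M +
     fps_const hbar_over_i * formal_log (thick_integral S Y' x) M"

section \<open>Bipartite graphs\<close>

datatype bigraph = Bigraph (nblack: nat) (nwhite: nat) (edges: "(int \<times> int) multiset")

definition black :: "bigraph \<Rightarrow> int set" where
  "black \<gamma> = {1..int (nblack \<gamma>)}"

definition white :: "bigraph \<Rightarrow> int set" where
  "white \<gamma> = {- int (nwhite \<gamma>)..-1}"

definition vertices :: "bigraph \<Rightarrow> int set" where
  "vertices \<gamma> = black \<gamma> \<union> white \<gamma>"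

definition wf_bigraph :: "bigraph \<Rightarrow> bool" where
  "wf_bigraph \<gamma> \<longleftrightarrow> set_mset (edges \<gamma>) \<subseteq> black \<gamma> \<times> white \<gamma>"

definition vdegree :: "bigraph \<Rightarrow> int \<Rightarrow> nat" where
  "vdegree \<gamma> v = size {#e \<in># edges \<gamma>. fst e = v \<or> snd e = v#}"

definition connected_bigraph :: "bigraph \<Rightarrow> bool" where
  "connected_bigraph \<gamma> \<longleftrightarrow> vertices \<gamma> \<noteq> {} \<and>
     (\<forall>u\<in>vertices \<gamma>. \<forall>v\<in>vertices \<gamma>.
        (u, v) \<in> (set_mset (edges \<gamma>) \<union> (set_mset (edges \<gamma>))\<inverse>)\<^sup>*)"

definition Gamma_circ :: "bigraph set" where
  "Gamma_circ = {\<gamma>. wf_bigraph \<gamma> \<and> connected_bigraph \<gamma> \<and>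
     (\<forall>v\<in>vertices \<gamma>. vdegree \<gamma> v = 1 \<longrightarrow> v \<in> white \<gamma>)}"

definition isos :: "bigraph \<Rightarrow> bigraph \<Rightarrow> ((int \<Rightarrow> int) \<times> (int \<Rightarrow> int)) set" where
  "isos \<gamma> \<delta> = {(\<sigma>, \<tau>).
     nblack \<gamma> = nblack \<delta> \<and> nwhite \<gamma> = nwhite \<delta> \<and>
     \<sigma> permutes black \<gamma> \<and> \<tau> permutes white \<gamma> \<and>
     (\<forall>b\<in>black \<gamma>. \<forall>w\<in>white \<gamma>. count (edges \<delta>) (\<sigma> b, \<tau> w) = count (edges \<gamma>) (b, w))}"

definition sym_group :: "bigraph \<Rightarrow> ((int \<Rightarrow> int) \<times> (int \<Rightarrow> int)) set" where
  "sym_group \<gamma> = isos \<gamma> \<gamma>"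

definition Gamma_circ_classes :: "bigraph set set" where
  "Gamma_circ_classes = Gamma_circ // {(\<gamma>, \<delta>) \<in> Gamma_circ \<times> Gamma_circ. isos \<gamma> \<delta> \<noteq> {}}"

definition class_rep :: "bigraph set \<Rightarrow> bigraph" where
  "class_rep C = (SOME \<gamma>. \<gamma> \<in> C)"

definition betti :: "bigraph \<Rightarrow> int" where
  "betti \<gamma> = int (size (edges \<gamma>)) - int (card (vertices \<gamma>)) + 1"

lemma isos_refl: "isos \<gamma> \<gamma> \<noteq> {}"
proof -
  have "(id, id) \<in> isos \<gamma> \<gamma>" by (simp add: isos_def permutes_id)
  then show ?thesis by blast
qed

lemma class_rep_in_Gamma_circ:
  assumes "C \<in> Gamma_circ_classes"
  shows "class_rep C \<in> C" and "class_rep C \<in> Gamma_circ"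
proof -
  obtain \<gamma> where \<gamma>: "\<gamma> \<in> Gamma_circ"
    and C: "C = {(\<gamma>, \<delta>) \<in> Gamma_circ \<times> Gamma_circ. isos \<gamma> \<delta> \<noteq> {}} `` {\<gamma>}"
    using assms by (auto simp: Gamma_circ_classes_def quotient_def)
  have "\<gamma> \<in> C" using \<gamma> isos_refl[of \<gamma>] by (simp add: C)
  then show "class_rep C \<in> C" unfolding class_rep_def by (rule someI)
  then show "class_rep C \<in> Gamma_circ" by (auto simp: C)
qed

lemma finite_Gamma_circ_edges: "finite {\<gamma> \<in> Gamma_circ. size (edges \<gamma>) = N}"
proof (rule finite_subset)
  let ?R = "{- int (2 * N + 1)..int (2 * N + 1)}"
  let ?E = "{E. size E = N \<and> set_mset E \<subseteq> ?R \<times> ?R}"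
  show "{\<gamma> \<in> Gamma_circ. size (edges \<gamma>) = N}
      \<subseteq> (\<lambda>(n, m, E). Bigraph n m E) ` ({..2 * N + 1} \<times> {..2 * N + 1} \<times> ?E)"
  proof
    fix \<gamma> assume "\<gamma> \<in> {\<gamma> \<in> Gamma_circ. size (edges \<gamma>) = N}"
    then have wf: "set_mset (edges \<gamma>) \<subseteq> black \<gamma> \<times> white \<gamma>" and con: "connected_bigraph \<gamma>"
      and N: "size (edges \<gamma>) = N"
      by (auto simp: Gamma_circ_def wf_bigraph_def)
    let ?E' = "set_mset (edges \<gamma>)"
    have ends: "v \<in> fst ` ?E' \<union> snd ` ?E'"
      if uv: "u \<in> vertices \<gamma>" "v \<in> vertices \<gamma>" "u \<noteq> v" for u v
    proof -
      have "(u, v) \<in> (?E' \<union> ?E'\<inverse>)\<^sup>*" using con uv by (auto simp: connected_bigraph_def)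
      then obtain z where "(z, v) \<in> ?E' \<union> ?E'\<inverse>" using uv(3) by (metis rtranclE)
      then show ?thesis by (force simp: image_iff)
    qed
    obtain r where r: "r \<in> vertices \<gamma>" using con by (auto simp: connected_bigraph_def)
    have "vertices \<gamma> \<subseteq> insert r (fst ` ?E' \<union> snd ` ?E')" using ends[OF r] by blast
    then have "card (vertices \<gamma>) \<le> card (insert r (fst ` ?E' \<union> snd ` ?E'))"
      by (intro card_mono) auto
    also have "\<dots> \<le> Suc (card (fst ` ?E') + card (snd ` ?E'))"
      using card_Un_le[of "fst ` ?E'" "snd ` ?E'"] by (auto simp: card_insert_if)
    also have "\<dots> \<le> Suc (card ?E' + card ?E')"
      by (intro Suc_leI le_imp_less_Suc add_mono card_image_le) auto
    also have "card ?E' \<le> N"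
      using N by (metis mset_set_set_mset_msubset size_mset_mono size_mset_set)
    finally have card: "card (vertices \<gamma>) \<le> 2 * N + 1" using \<open>card ?E' \<le> N\<close> by linarith
    have "nblack \<gamma> \<le> card (vertices \<gamma>)" "nwhite \<gamma> \<le> card (vertices \<gamma>)"
    proof -
      have "card (black \<gamma>) \<le> card (vertices \<gamma>)" "card (white \<gamma>) \<le> card (vertices \<gamma>)"
        by (rule card_mono; simp add: vertices_def black_def white_def)+
      then show "nblack \<gamma> \<le> card (vertices \<gamma>)" "nwhite \<gamma> \<le> card (vertices \<gamma>)"
        by (simp_all add: black_def white_def)
    qed
    then have b: "nblack \<gamma> \<le> 2 * N + 1" "nwhite \<gamma> \<le> 2 * N + 1" using card by linarith+
    have "set_mset (edges \<gamma>) \<subseteq> ?R \<times> ?R"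
      using wf b by (fastforce simp: black_def white_def)
    then show "\<gamma> \<in> (\<lambda>(n, m, E). Bigraph n m E) ` ({..2 * N + 1} \<times> {..2 * N + 1} \<times> ?E)"
      using b N by (intro image_eqI[of _ _ "(nblack \<gamma>, nwhite \<gamma>, edges \<gamma>)"]) auto
  qed
  have "?E \<subseteq> mset ` {xs. set xs \<subseteq> ?R \<times> ?R \<and> length xs = N}"
  proof
    fix E assume "E \<in> ?E"
    moreover obtain xs where "E = mset xs" by (metis ex_mset)
    ultimately show "E \<in> mset ` {xs. set xs \<subseteq> ?R \<times> ?R \<and> length xs = N}" by auto
  qed
  then have "finite ?E"
    by (rule finite_subset) (intro finite_imageI finite_lists_length_eq finite_cartesian_product, auto)
  then show "finite ((\<lambda>(n, m, E). Bigraph n m E) ` ({..2 * N + 1} \<times> {..2 * N + 1} \<times> ?E))"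
    by (intro finite_imageI finite_cartesian_product) auto
qed

lemma isos_sym: "isos \<gamma> \<delta> \<noteq> {} \<Longrightarrow> isos \<delta> \<gamma> \<noteq> {}"
proof -
  assume "isos \<gamma> \<delta> \<noteq> {}"
  then obtain \<sigma> \<tau> where *: "nblack \<gamma> = nblack \<delta>" "nwhite \<gamma> = nwhite \<delta>"
      "\<sigma> permutes black \<gamma>" "\<tau> permutes white \<gamma>"
      "\<forall>b\<in>black \<gamma>. \<forall>w\<in>white \<gamma>. count (edges \<delta>) (\<sigma> b, \<tau> w) = count (edges \<gamma>) (b, w)"
    by (auto simp: isos_def)
  have bw: "black \<delta> = black \<gamma>" "white \<delta> = white \<gamma>" using * by (simp_all add: black_def white_def)
  have "count (edges \<gamma>) (inv \<sigma> b, inv \<tau> w) = count (edges \<delta>) (b, w)"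
    if "b \<in> black \<gamma>" "w \<in> white \<gamma>" for b w
  proof -
    have "inv \<sigma> b \<in> black \<gamma>" "inv \<tau> w \<in> white \<gamma>"
      using that permutes_in_image[OF permutes_inv] *(3,4) by metis+
    then show ?thesis using *(5) permutes_inverses(1)[OF *(3)] permutes_inverses(1)[OF *(4)] by metis
  qed
  then have "(inv \<sigma>, inv \<tau>) \<in> isos \<delta> \<gamma>"
    using * bw by (simp add: isos_def permutes_inv)
  then show ?thesis by blast
qed

lemma isos_trans: "isos \<gamma> \<delta> \<noteq> {} \<Longrightarrow> isos \<delta> \<epsilon> \<noteq> {} \<Longrightarrow> isos \<gamma> \<epsilon> \<noteq> {}"
proof -
  assume "isos \<gamma> \<delta> \<noteq> {}" "isos \<delta> \<epsilon> \<noteq> {}"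
  then obtain \<sigma> \<tau> \<sigma>' \<tau>' where *: "(\<sigma>, \<tau>) \<in> isos \<gamma> \<delta>" "(\<sigma>', \<tau>') \<in> isos \<delta> \<epsilon>" by auto
  then have bw: "black \<delta> = black \<gamma>" "white \<delta> = white \<gamma>" by (simp_all add: isos_def black_def white_def)
  have "(\<sigma>' \<circ> \<sigma>, \<tau>' \<circ> \<tau>) \<in> isos \<gamma> \<epsilon>"
    using * bw by (auto simp: isos_def permutes_compose permutes_in_image)
  then show ?thesis by blast
qed

lemma equiv_isos: "equiv Gamma_circ {(\<gamma>, \<delta>) \<in> Gamma_circ \<times> Gamma_circ. isos \<gamma> \<delta> \<noteq> {}}"
proof (rule equivI)
  let ?r = "{(\<gamma>, \<delta>) \<in> Gamma_circ \<times> Gamma_circ. isos \<gamma> \<delta> \<noteq> {}}"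
  show "?r \<subseteq> Gamma_circ \<times> Gamma_circ" by blast
  show "refl_on Gamma_circ ?r" by (simp add: refl_on_def isos_refl)
  show "sym ?r" unfolding sym_def by (simp add: isos_sym)
  show "trans ?r" using isos_trans by (intro transI) (simp, metis)
qed

lemma finite_classes_edges: "finite {C \<in> Gamma_circ_classes. size (edges (class_rep C)) = N}"
proof (rule inj_on_finite[OF _ _ finite_Gamma_circ_edges])
  show "class_rep ` {C \<in> Gamma_circ_classes. size (edges (class_rep C)) = N}
      \<subseteq> {\<gamma> \<in> Gamma_circ. size (edges \<gamma>) = N}"
    using class_rep_in_Gamma_circ(2) by auto
  show "inj_on class_rep {C \<in> Gamma_circ_classes. size (edges (class_rep C)) = N}"
  proof (rule inj_onI)
    fix C D assume "C \<in> {C \<in> Gamma_circ_classes. size (edges (class_rep C)) = N}"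
      "D \<in> {C \<in> Gamma_circ_classes. size (edges (class_rep C)) = N}" and eq: "class_rep C = class_rep D"
    then have CD: "C \<in> Gamma_circ_classes" "D \<in> Gamma_circ_classes" by auto
    then have "C \<inter> D \<noteq> {}" using class_rep_in_Gamma_circ(1) eq by fastforce
    then show "C = D" using quotient_disj[OF equiv_isos] CD unfolding Gamma_circ_classes_def by blast
  qed
qed

section \<open>The contribution of a graph\<close>

text \<open>The edges are numbered; \<open>l\<close> is the list of their dummy indices.\<close>

definition edge_list :: "bigraph \<Rightarrow> (int \<times> int) list" where
  "edge_list \<gamma> = (SOME es. mset es = edges \<gamma>)"

definition labels_at :: "bigraph \<Rightarrow> 'd list \<Rightarrow> int \<Rightarrow> 'd list" where
  "labels_at \<gamma> l v = map snd (filter (\<lambda>(e, a). fst e = v \<or> snd e = v) (zip (edge_list \<gamma>) l))"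

definition black_factor :: "bigraph \<Rightarrow> int \<Rightarrow> complex" where
  "black_factor \<gamma> v =
     fact (vdegree \<gamma> v) /
     (\<Prod>i = 1..vdegree \<gamma> v. fact i ^ card {w \<in> white \<gamma>. count (edges \<gamma>) (v, w) = i})"

definition graph_bracket ::
  "('n::finite, 'd::finite) gen_fun \<Rightarrow> (real ^ 'd \<Rightarrow> real ^ 'd) \<Rightarrow> bigraph \<Rightarrow> (int \<Rightarrow> 'd) \<Rightarrow>
   real ^ 'n \<Rightarrow> complex fps"
where
  "graph_bracket S Y' \<gamma> a x = (\<Sum>l | length l = size (edges \<gamma>).
     (\<Prod>v\<in>black \<gamma>. fps_const (black_factor \<gamma> v) * S (labels_at \<gamma> l v) x) *
     (\<Prod>w\<in>white \<gamma>. formal_eval (partials (labels_at \<gamma> l w) (\<lambda>y. Y' y $ a w)) (\<lambda>b. S [b] x)))"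

definition white_labelings :: "bigraph \<Rightarrow> (int \<Rightarrow> 'd) set" where
  "white_labelings \<gamma> = white \<gamma> \<rightarrow>\<^sub>E UNIV"

definition label_monomial :: "bigraph \<Rightarrow> (int \<Rightarrow> 'd) \<Rightarrow> 'd multiset" where
  "label_monomial \<gamma> a = image_mset a (mset_set (white \<gamma>))"

end

theory Submission
  imports Defs
begin

text \<open>
  Applying the Leibniz rule to \<open>\<partial>\<^bsub>L\<^esub> (y'\<^bsub>b\<^sub>1\<^esub> \<dots> y'\<^bsub>b\<^sub>m\<^esub>)\<close>, where \<open>L\<close> lists the indices of all factors of \<open>S\<^sup>+\<close>,
  attaches each index to one of the factors \<open>y'\<close>.  Reading the factors of \<open>S\<^sup>+\<close> as black and the factors \<open>y'\<close>
  as white vertices, the integral becomes the sum over all bipartite multigraphs with numbered vertices and black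
  valencies at least 2, weighted by \<open>1/(n! m!)\<close>; a multigraph arises from as many attachments as there are
  orderings of its half-edges at the black vertices, which gives the factor \<open>m\<^sub>v!/\<Prod> (i!)\<^bsup>k\<^sub>i\<^esup>\<close>.
  The weight is multiplicative over disjoint unions, and splitting off the component of a marked white vertex
  gives \<open>q\<partial>\<^sub>q Z = Z \<cdot> q\<partial>\<^sub>q C\<close>, with \<open>C\<close> the sum over connected graphs; hence \<open>C = log Z\<close>.
  Finally the \<open>n! m!\<close> renumberings of a graph \<open>\<gamma>\<close> produce \<open>n! m!/|sym(\<gamma>)|\<close> numbered graphs.
\<close>

section \<open>Series in several variables and the logarithmic derivative\<close>

text \<open>The differential equation replaces a partition of a graph into all its components: it
  splits off one component at a time, and a series with constant term 1 can be cancelled degree by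
  degree, so the connected series is never exponentiated. A white vertex is the right one to mark
  because \<open>size M\<close> is both the degree in \<open>q'\<close> and the number of white
  vertices. Every component has one, since black vertices coming from \<open>S\<^sup>+\<close> have
  edges. Only the one-vertex black graph escapes; it carries \<open>S\<^sup>0\<close>, which is
  taken out of the integral beforehand, and is matched separately.

  For a graph to have a weight at all, a vertex may see only the multiset of its edge indices. For
  black vertices this is the symmetry of the coefficients, for white ones that of partial
  derivatives. For the weight to be multiplicative, Taylor evaluation at the formal point must be a
  ring homomorphism. The counting is done over a field of characteristic 0, later complex Laurent
  series in \<open>\<hbar>\<close>. The outer series variable counts edges; for a fixed number of
  edges and a fixed monomial only finitely many numbered graphs occur.\<close>

lemma finite_submultisets: "finite {A. A \<subseteq># (M :: 'a multiset)}"
proof -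
  have "{A. A \<subseteq># M} \<subseteq> mset ` {xs. set xs \<subseteq> set_mset M \<and> length xs \<le> size M}"
  proof
    fix A assume "A \<in> {A. A \<subseteq># M}"
    moreover obtain xs where "A = mset xs" by (metis ex_mset)
    ultimately show "A \<in> mset ` {xs. set xs \<subseteq> set_mset M \<and> length xs \<le> size M}"
      using set_mset_mono size_mset_mono by fastforce
  qed
  then show ?thesis
    by (rule finite_subset) (intro finite_imageI finite_lists_length_le, simp)
qed

lemma series_mult_commute: "series_mult F G = series_mult G F"
proof
  fix M
  show "series_mult F G M = series_mult G F M"
    unfolding series_mult_def
    by (rule sum.reindex_bij_witness[of _ "\<lambda>A. M - A" "\<lambda>A. M - A"])
       (auto simp: multiset_diff_union_assoc mult.commute subset_mset.diff_diff_right)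
qed

text \<open>Both sides sum over ordered splittings of \<open>M\<close> into three parts; a chain
  \<open>B \<subseteq># A\<close> is traded for the pair \<open>(B, A - B)\<close>.\<close>

lemma series_mult_assoc:
  "series_mult (series_mult F G) H = series_mult F (series_mult G H)"
proof
  fix M :: "'a multiset"
  have add_subset: "B + C \<subseteq># M" if "B \<subseteq># M" "C \<subseteq># M - B" for B C
    using that by (metis mset_subset_eq_mono_add_left_cancel subset_mset.add_diff_inverse)
  have diff_mono: "A - B \<subseteq># M - B" if "A \<subseteq># M" for A B
    using that by (auto simp: subseteq_mset_def intro: diff_le_mono)
  have trans: "A \<subseteq># M \<Longrightarrow> B \<subseteq># A \<Longrightarrow> B \<subseteq># M" for A B
    by (rule subset_mset.order_trans)
  have "series_mult (series_mult F G) H M =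
      (\<Sum>(A, B) \<in> Sigma {A. A \<subseteq># M} (\<lambda>A. {B. B \<subseteq># A}). F B * G (A - B) * H (M - A))"
    by (simp add: series_mult_def sum_distrib_right sum.Sigma finite_submultisets)
  also have "\<dots> = (\<Sum>(B, C) \<in> Sigma {B. B \<subseteq># M} (\<lambda>B. {C. C \<subseteq># M - B}).
      F B * G C * H (M - B - C))"
  proof (rule sum.reindex_bij_witness[of _ "\<lambda>(B, C). (B + C, B)" "\<lambda>(A, B). (B, A - B)"], goal_cases)
    case (2 p)
    then show ?case using trans diff_mono by auto
  next
    case (4 p)
    then show ?case using add_subset by auto
  next
    case (5 p)
    then have "M - snd p - (fst p - snd p) = M - fst p"
      by (metis (no_types, lifting) SigmaE diff_diff_add fst_conv mem_Collect_eq snd_conv subset_mset.add_diff_inverse)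
    then show ?case by (simp add: case_prod_beta)
  qed (auto simp: subset_mset.add_diff_inverse)
  also have "\<dots> = series_mult F (series_mult G H) M"
    by (simp add: series_mult_def sum_distrib_left sum.Sigma finite_submultisets mult.assoc)
  finally show "series_mult (series_mult F G) H M = series_mult F (series_mult G H) M" .
qed

lemma series_mult_one: "series_mult series_one F = F"
proof
  fix M
  have "series_mult series_one F M = (\<Sum>A\<in>{{#}}. series_one A * F (M - A))"
    unfolding series_mult_def
    by (rule sum.mono_neutral_right) (auto simp: finite_submultisets series_one_def)
  then show "series_mult series_one F M = F M" by (simp add: series_one_def)
qed

lemma series_mult_cong:
  assumes "\<And>A. A \<subseteq># M \<Longrightarrow> F A = F' A" "\<And>A. A \<subseteq># M \<Longrightarrow> G A = G' A"
  shows "series_mult F G M = series_mult F' G' M"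
  unfolding series_mult_def using assms by (intro sum.cong) auto

lemma series_mult_add:
  "series_mult F (\<lambda>M. G M + H M) M = series_mult F G M + series_mult F H M"
  by (simp add: series_mult_def distrib_left sum.distrib)

lemma series_mult_add_left:
  "series_mult (\<lambda>M. G M + H M) F M = series_mult G F M + series_mult H F M"
  by (simp add: series_mult_def distrib_right sum.distrib)

lemma series_mult_scale:
  "series_mult F (\<lambda>M. c * G M) M = c * series_mult F G M"
  by (simp add: series_mult_def sum_distrib_left mult_ac)

text \<open>The Euler operator
  \<open>\<Sum>\<^sub>a q\<^sub>a \<partial>/\<partial>q\<^sub>a\<close>. One operator treats all
  variables at once, and over coefficients of characteristic 0 it loses only the constant
  term.\<close>

definition euler :: "('d multiset \<Rightarrow> 'c::comm_ring_1) \<Rightarrow> 'd multiset \<Rightarrow> 'c" where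
  "euler F M = of_nat (size M) * F M"

text \<open>Sizes add up along \<open>M = A + (M - A)\<close>, which makes \<open>euler\<close> a
  derivation.\<close>

lemma euler_mult:
  "euler (series_mult F G) M = series_mult (euler F) G M + series_mult F (euler G) M"
proof -
  have "of_nat (size M) * (F A * G (M - A)) = euler F A * G (M - A) + F A * euler G (M - A)"
    if "A \<subseteq># M" for A
  proof -
    have "size M = size A + size (M - A)" using that by (metis size_union subset_mset.add_diff_inverse)
    then show ?thesis by (simp add: euler_def algebra_simps)
  qed
  then show ?thesis
    by (simp add: euler_def series_mult_def sum_distrib_left flip: sum.distrib)
qed

abbreviation series_power :: "('d multiset \<Rightarrow> 'c::comm_ring_1) \<Rightarrow> nat \<Rightarrow> 'd multiset \<Rightarrow> 'c" where
  "series_power W k \<equiv> (series_mult W ^^ k) series_one"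

text \<open>The product rule and induction. Read from right to left, each product of a power of
  \<open>W\<close> with \<open>euler W\<close> is an Euler derivative up to a nonzero integer; this
  is how the tails of the logarithmic series are shown to vanish.\<close>

lemma euler_power:
  "euler (series_power W (Suc k)) M = of_nat (Suc k) * series_mult (series_power W k) (euler W) M"
proof (induction k arbitrary: M)
  case 0
  have "series_mult W series_one = W" by (metis series_mult_one series_mult_commute)
  then show ?case by (simp add: series_mult_one)
next
  case (Suc k)
  have "euler (series_power W (Suc (Suc k))) M =
      series_mult (euler W) (series_power W (Suc k)) M + series_mult W (euler (series_power W (Suc k))) M"
    by (simp only: funpow.simps o_def euler_mult)
  also have "series_mult W (euler (series_power W (Suc k))) M =
      of_nat (Suc k) * series_mult (series_power W (Suc k)) (euler W) M"
  proof -
    have "euler (series_power W (Suc k)) = (\<lambda>M. of_nat (Suc k) * series_mult (series_power W k) (euler W) M)"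
      by (rule ext) (rule Suc.IH)
    then show ?thesis by (simp only: series_mult_scale funpow.simps o_def series_mult_assoc)
  qed
  finally show ?case by (simp add: series_mult_commute[of "euler W"] algebra_simps)
qed

text \<open>Each factor \<open>W\<close> uses up at least one variable of the monomial.\<close>

lemma series_power_eq_0:
  assumes "W {#} = 0" "size M < k"
  shows "series_power W k M = 0"
  using assms(2)
proof (induction k arbitrary: M)
  case (Suc k)
  have "W A * series_power W k (M - A) = 0" if "A \<subseteq># M" for A
  proof (cases "A = {#}")
    case False
    then have "size (M - A) < size M" using that
      by (metis size_Diff_submset diff_less nonempty_has_size size_mset_mono order_less_le_trans)
    then show ?thesis using Suc by simp
  qed (simp add: assms)
  then have "(\<Sum>A | A \<subseteq># M. W A * series_power W k (M - A)) = 0" by simp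
  then show ?case unfolding funpow.simps o_def series_mult_def[of W "series_power W k"] .
qed (simp add: series_one_def)

text \<open>Multiplication by \<open>Z\<close> is unitriangular for the degree: the summand
  \<open>A = {#}\<close> returns the coefficient at \<open>M\<close>, all others involve smaller
  monomials.\<close>

lemma series_mult_cancel:
  fixes F G Z :: "'d multiset \<Rightarrow> 'c::comm_ring_1"
  assumes "Z {#} = 1" "\<And>M. series_mult Z F M = series_mult Z G M"
  shows "F M = G M"
proof (induction "size M" arbitrary: M rule: less_induct)
  case less
  have split: "series_mult Z H M = H M + (\<Sum>A\<in>{A. A \<subseteq># M} - {{#}}. Z A * H (M - A))" for H
    unfolding series_mult_def by (subst sum.remove[of _ "{#}"]) (auto simp: finite_submultisets assms)
  have "F (M - A) = G (M - A)" if "A \<in> {A. A \<subseteq># M} - {{#}}" for A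
  proof (rule less)
    show "size (M - A) < size M" using that
      by (metis DiffE mem_Collect_eq singletonI size_Diff_submset diff_less nonempty_has_size size_mset_mono order_less_le_trans)
  qed
  then have "(\<Sum>A\<in>{A. A \<subseteq># M} - {{#}}. Z A * F (M - A)) = (\<Sum>A\<in>{A. A \<subseteq># M} - {{#}}. Z A * G (M - A))"
    by (intro sum.cong) auto
  then show ?case using assms(2)[of M] split by simp
qed

text \<open>Both \<open>formal_log Z\<close> and \<open>C\<close> have the logarithmic derivative
  \<open>euler Z / Z\<close>. Cancelling \<open>Z\<close> leaves equal Euler derivatives, hence
  equal coefficients in positive degree; at \<open>{#}\<close> the sum defining the logarithm is
  empty and \<open>C\<close> vanishes by assumption.\<close>

lemma formal_log_unique:
  fixes Z C :: "'d multiset \<Rightarrow> complex fls fps"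
  assumes Z: "Z {#} = 1" and C: "C {#} = 0"
    and ode: "\<And>M. euler Z M = series_mult Z (euler C) M"
  shows "formal_log Z M = C M"
proof -
  define W where "W = (\<lambda>A. Z A - series_one A)"
  have W0: "W {#} = 0" by (simp add: W_def Z series_one_def)
  have eW: "euler W = euler Z" by (auto simp: fun_eq_iff euler_def W_def series_one_def)
  have ZW: "Z = (\<lambda>A. series_one A + W A)" by (simp add: W_def)
  \<comment> \<open>Partial sums of \<open>(1 + W)\<^sup>-\<^sup>1 euler W\<close>. The bound
    \<open>K\<close> is kept apart from the monomial, because multiplication by \<open>Z\<close>
    mixes coefficients at monomials of different sizes, for which the logarithm is cut off at
    different places.\<close>
  define Q where "Q K = (\<lambda>A. \<Sum>j<K. (-1) ^ j * series_mult (series_power W j) (euler W) A)" for K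
  have eL: "euler (formal_log Z) A = Q K A" if "size A \<le> K" for A K
  proof -
    have "euler (formal_log Z) A =
        (\<Sum>k = 1..size A. fps_const ((-1) ^ (k + 1) / of_nat k) * euler (series_power W k) A)"
      by (simp add: euler_def formal_log_def W_def sum_distrib_left mult_ac)
    also have "\<dots> = (\<Sum>j<size A. fps_const ((-1) ^ (Suc j + 1) / of_nat (Suc j)) * euler (series_power W (Suc j)) A)"
      unfolding One_nat_def by (rule sum.atLeast1_atMost_eq)
    also have "\<dots> = (\<Sum>j<size A. (-1) ^ j * series_mult (series_power W j) (euler W) A)"
    proof (rule sum.cong[OF refl])
      fix j
      have "fps_const ((-1) ^ (Suc j + 1) / of_nat (Suc j)) * (of_nat (Suc j) :: complex fls fps) = (-1) ^ j"
      proof -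
        have "fps_const ((-1) ^ (Suc j + 1) / of_nat (Suc j)) * (of_nat (Suc j) :: complex fls fps) =
            fps_const ((-1) ^ (Suc j + 1) / of_nat (Suc j) * of_nat (Suc j))"
          by (metis fps_const_mult fps_of_nat)
        also have "(-1) ^ (Suc j + 1) / of_nat (Suc j) * of_nat (Suc j) = ((-1) ^ j :: complex fls)"
          by (simp del: of_nat_Suc)
        also have "fps_const ((-1) ^ j :: complex fls) = (-1) ^ j"
          by (metis fps_const_neg fps_const_1_eq_1 fps_const_power)
        finally show ?thesis .
      qed
      then show "fps_const ((-1) ^ (Suc j + 1) / of_nat (Suc j)) * euler (series_power W (Suc j)) A =
          (-1) ^ j * series_mult (series_power W j) (euler W) A"
        unfolding euler_power by (metis mult.assoc)
    qed
    also have "\<dots> = Q K A"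
      unfolding Q_def
    proof (rule sum.mono_neutral_left)
      show "\<forall>j\<in>{..<K} - {..<size A}. (-1) ^ j * series_mult (series_power W j) (euler W) A = 0"
      proof
        \<comment> \<open>\<open>Suc j\<close> times this product is the Euler derivative of the
          power \<open>Suc j\<close> of \<open>W\<close>, which has no coefficient at
          \<open>A\<close> once \<open>j \<ge> size A\<close>.\<close>
        fix j assume "j \<in> {..<K} - {..<size A}"
        then have "series_power W (Suc j) A = 0" by (intro series_power_eq_0 W0) auto
        then have "of_nat (Suc j) * series_mult (series_power W j) (euler W) A = 0"
          by (metis euler_power euler_def mult_zero_right)
        then have "series_mult (series_power W j) (euler W) A = 0"
          by (metis mult_eq_0_iff of_nat_neq_0)
        then show "(-1) ^ j * series_mult (series_power W j) (euler W) A = 0" by simp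
      qed
    qed (use that in auto)
    finally show ?thesis .
  qed
  \<comment> \<open>A telescoping geometric sum: \<open>Z = 1 + W\<close> against
    \<open>\<Sum>j<K. (-W)\<^sup>j\<close>.\<close>
  have Q: "series_mult Z (Q K) A = euler W A - (-1) ^ K * series_mult (series_power W K) (euler W) A" for K A
  proof (induction K)
    case 0
    then show ?case by (simp add: Q_def series_mult_one series_mult_def)
  next
    case (Suc K)
    have "series_mult Z (Q (Suc K)) A = series_mult Z (Q K) A +
        (-1) ^ K * series_mult Z (series_mult (series_power W K) (euler W)) A"
      by (simp add: Q_def series_mult_add series_mult_scale)
    also have "series_mult Z (series_mult (series_power W K) (euler W)) A =
        series_mult (series_power W K) (euler W) A + series_mult (series_power W (Suc K)) (euler W) A"
      by (subst ZW) (simp add: series_mult_add_left series_mult_one series_mult_assoc)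
    finally show ?case by (simp add: Suc algebra_simps)
  qed
  have "series_mult Z (euler (formal_log Z)) A = series_mult Z (euler C) A" for A
  proof -
    have "series_mult Z (euler (formal_log Z)) A = series_mult Z (Q (size A)) A"
      by (intro series_mult_cong refl eL size_mset_mono)
    also have "series_mult (series_power W (size A)) (euler W) A = 0"
      using series_power_eq_0[where W = W and M = A and k = "Suc (size A)"] W0 euler_power[where W = W and k = "size A" and M = A]
      by (metis euler_def lessI mult_eq_0_iff mult_zero_right of_nat_neq_0)
    then have "series_mult Z (Q (size A)) A = euler W A" by (simp add: Q)
    finally show ?thesis by (simp add: eW ode)
  qed
  then have "euler (formal_log Z) M = euler C M" by (rule series_mult_cancel[where Z = Z, OF Z])
  then show ?thesis
    by (cases "M = {#}") (auto simp: euler_def formal_log_def C)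
qed

section \<open>Iterated partial derivatives\<close>

lemma partial_eq: "(f has_derivative f') (at y) \<Longrightarrow> partial a f y = f' (axis a 1)"
  unfolding partial_def using frechet_derivative_at by metis

text \<open>Functions that agree near \<open>y\<close> have the same derivatives there, so the
  choice hidden in \<open>frechet_derivative\<close> picks the same one. Formulas for iterated
  derivatives hold only on \<open>V\<close>, and this is what lets the next derivative be applied to
  them.\<close>

lemma partial_cong:
  assumes "open V" "y \<in> V" "\<And>y. y \<in> V \<Longrightarrow> f y = g y"
  shows "partial a f y = partial a g y"
proof -
  have "(f has_derivative f') (at y) \<longleftrightarrow> (g has_derivative f') (at y)" for f'
    using has_derivative_transform_within_open[OF _ assms(1,2)] assms(3) by metis
  then show ?thesis by (simp add: partial_def frechet_derivative_def)
qed

lemma partials_cong: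
  assumes "open V" "y \<in> V" "\<And>y. y \<in> V \<Longrightarrow> f y = g y"
  shows "partials as f y = partials as g y"
  using assms(2)
proof (induction as arbitrary: y)
  case (Cons a as)
  then show ?case by (auto intro: partial_cong[OF assms(1)])
qed (simp add: assms)

lemma partials_append: "partials (as @ bs) f = partials as (partials bs f)"
  by (induction as) auto

lemma partials_const: "partials as (\<lambda>_. c) = (\<lambda>_. if as = [] then c else 0)"
proof (induction as)
  case (Cons a as)
  have "partial a (\<lambda>_. k) = (\<lambda>_. 0)" for k :: 'b
    by (rule ext) (rule partial_eq[OF has_derivative_const])
  then show ?case by (simp add: Cons)
qed auto

lemma smooth_on_partials: "smooth_on V f \<Longrightarrow> smooth_on V (partials bs f)"
  unfolding smooth_on_def by (metis partials_append)

lemma smooth_on_partial: "smooth_on V f \<Longrightarrow> smooth_on V (partial a f)"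
  using smooth_on_partials[of V f "[a]"] by simp

lemma smooth_on_differentiable:
  "smooth_on V f \<Longrightarrow> open V \<Longrightarrow> y \<in> V \<Longrightarrow> partials as f differentiable (at y)"
  unfolding smooth_on_def using differentiable_on_eq_differentiable_at by blast

lemma smooth_on_has_derivative:
  "smooth_on V f \<Longrightarrow> open V \<Longrightarrow> y \<in> V \<Longrightarrow>
   (partials as f has_derivative frechet_derivative (partials as f) (at y)) (at y)"
  by (metis smooth_on_differentiable frechet_derivative_works)

text \<open>Smoothness is read off from a formula for all iterated derivatives at once. So for sums,
  products and components that formula comes first, and closure of smooth functions under these
  operations is its corollary.\<close>

lemma smooth_onI:
  assumes "open V" "\<And>as y. y \<in> V \<Longrightarrow> partials as f y = F as y"
    "\<And>as y. y \<in> V \<Longrightarrow> F as differentiable (at y)"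
  shows "smooth_on V f"
  unfolding smooth_on_def
proof
  fix as
  have "partials as f differentiable (at y)" if y: "y \<in> V" for y
  proof -
    obtain D where "(F as has_derivative D) (at y)" using assms(3)[OF y] unfolding differentiable_def by blast
    then have "(partials as f has_derivative D) (at y)"
      by (rule has_derivative_transform_within_open[OF _ assms(1) y]) (simp add: assms(2))
    then show ?thesis by (rule differentiableI)
  qed
  then show "partials as f differentiable_on V"
    by (simp add: differentiable_on_eq_differentiable_at[OF assms(1)])
qed

lemma differentiable_compose_sum:
  assumes "\<And>i. i \<in> I \<Longrightarrow> f i differentiable (at y)"
  shows "(\<lambda>y. \<Sum>i\<in>I. f i y) differentiable (at y)"
proof -
  have "(f i has_derivative frechet_derivative (f i) (at y)) (at y)" if "i \<in> I" for i
    using assms[OF that] frechet_derivative_works by blast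
  then show ?thesis by (rule differentiableI[OF has_derivative_sum])
qed

lemma differentiable_compose_prod:
  fixes f :: "'i \<Rightarrow> 'a::real_normed_vector \<Rightarrow> real"
  assumes "\<And>i. i \<in> I \<Longrightarrow> f i differentiable (at y)"
  shows "(\<lambda>y. \<Prod>i\<in>I. f i y) differentiable (at y)"
proof -
  have "(f i has_derivative frechet_derivative (f i) (at y)) (at y)" if "i \<in> I" for i
    using assms[OF that] frechet_derivative_works by blast
  then show ?thesis by (rule differentiableI[OF has_derivative_prod])
qed

lemma partials_sum:
  assumes "open V" "\<And>i. i \<in> I \<Longrightarrow> smooth_on V (g i)" "y \<in> V"
  shows "partials as (\<lambda>y. \<Sum>i\<in>I. g i y) y = (\<Sum>i\<in>I. partials as (g i) y)"
  using assms(3)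
proof (induction as arbitrary: y)
  case (Cons a as)
  have "partials (a # as) (\<lambda>y. \<Sum>i\<in>I. g i y) y = partial a (\<lambda>y. \<Sum>i\<in>I. partials as (g i) y) y"
    using Cons by (auto intro: partial_cong[OF assms(1)])
  also have "\<dots> = (\<Sum>i\<in>I. partial a (partials as (g i)) y)"
    unfolding partial_def[of a "partials as (g _)"]
    by (intro partial_eq has_derivative_sum smooth_on_has_derivative[OF assms(2) assms(1)] Cons.prems)
  finally show ?case by simp
qed simp

lemma smooth_on_sum:
  assumes "open V" "\<And>i. i \<in> I \<Longrightarrow> smooth_on V (g i)"
  shows "smooth_on V (\<lambda>y. \<Sum>i\<in>I. g i y)"
proof (rule smooth_onI[OF assms(1) partials_sum[OF assms]])
  fix as y assume "y \<in> V"
  then show "(\<lambda>y. \<Sum>i\<in>I. partials as (g i) y) differentiable at y"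
    by (intro differentiable_compose_sum smooth_on_differentiable[OF assms(2,1)])
qed

text \<open>In the Leibniz rule \<open>ws\<close> sends the derivative \<open>as ! i\<close> to the
  factor \<open>ws ! i\<close>; \<open>labels_for\<close> collects what the factor \<open>w\<close>
  receives, in the original order. It also serves to read off the indices at a black vertex.\<close>

definition labels_for :: "'w list \<Rightarrow> 'd list \<Rightarrow> 'w \<Rightarrow> 'd list" where
  "labels_for ws as w = map snd (filter (\<lambda>p. fst p = w) (zip ws as))"

lemma sum_lists_Cons:
  assumes "finite W"
  shows "(\<Sum>ws | length ws = Suc n \<and> set ws \<subseteq> W. h ws) =
    (\<Sum>ws | length ws = n \<and> set ws \<subseteq> W. \<Sum>w\<in>W. h (w # ws))"
proof -
  have "(\<Sum>ws | length ws = n \<and> set ws \<subseteq> W. \<Sum>w\<in>W. h (w # ws)) =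
      (\<Sum>(ws, w) \<in> {ws. length ws = n \<and> set ws \<subseteq> W} \<times> W. h (w # ws))"
    by (rule sum.cartesian_product)
  also have "\<dots> = (\<Sum>ws | length ws = Suc n \<and> set ws \<subseteq> W. h ws)"
    by (rule sum.reindex_bij_witness[of _ "\<lambda>ws. (tl ws, hd ws)" "\<lambda>(ws, w). w # ws"])
       (auto simp: length_Suc_conv)
  finally show ?thesis ..
qed

text \<open>Every derivative chooses its factor independently, so summing over assignments leaves no
  multinomial coefficients. They come back when assignments with the same multigraph are
  counted.\<close>

lemma partials_prod:
  fixes g :: "'w \<Rightarrow> real ^ 'd::finite \<Rightarrow> real"
  assumes "open V" "finite W" "\<And>w. w \<in> W \<Longrightarrow> smooth_on V (g w)" "y \<in> V"
  shows "partials as (\<lambda>y. \<Prod>w\<in>W. g w y) y =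
    (\<Sum>ws | length ws = length as \<and> set ws \<subseteq> W. \<Prod>w\<in>W. partials (labels_for ws as w) (g w) y)"
  using assms(4)
proof (induction as arbitrary: y)
  case Nil
  have "{ws. length ws = length ([] :: 'd list) \<and> set ws \<subseteq> W} = {[]}" by auto
  then show ?case by (simp add: labels_for_def)
next
  case (Cons a as)
  let ?L = "{ws. length ws = length as \<and> set ws \<subseteq> W}"
  have "partials (a # as) (\<lambda>y. \<Prod>w\<in>W. g w y) y =
      partial a (\<lambda>y. \<Sum>ws\<in>?L. \<Prod>w\<in>W. partials (labels_for ws as w) (g w) y) y"
    using Cons by (auto intro: partial_cong[OF assms(1)])
  also have "\<dots> = (\<Sum>ws\<in>?L. \<Sum>i\<in>W. partial a (partials (labels_for ws as i) (g i)) y *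
      (\<Prod>j\<in>W - {i}. partials (labels_for ws as j) (g j) y))"
    unfolding partial_def[of a "partials _ _"]
    by (intro partial_eq has_derivative_sum has_derivative_prod
        smooth_on_has_derivative[OF assms(3) assms(1)] Cons.prems)
  \<comment> \<open>Differentiating the factor \<open>i\<close> prefixes \<open>i\<close> to the
    assignment; only the list of \<open>i\<close> grows.\<close>
  also have "\<dots> = (\<Sum>ws\<in>?L. \<Sum>i\<in>W. \<Prod>w\<in>W. partials (labels_for (i # ws) (a # as) w) (g w) y)"
  proof (intro sum.cong refl)
    fix ws i assume "i \<in> W"
    then show "partial a (partials (labels_for ws as i) (g i)) y *
        (\<Prod>j\<in>W - {i}. partials (labels_for ws as j) (g j) y) =
        (\<Prod>w\<in>W. partials (labels_for (i # ws) (a # as) w) (g w) y)"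
      by (subst prod.remove[OF assms(2), of i]) (auto simp: labels_for_def intro!: prod.cong split: if_splits)
  qed
  finally show ?case by (simp only: list.size(4) add_0_right add_Suc_right sum_lists_Cons[OF assms(2)])
qed

lemma smooth_on_prod:
  fixes g :: "'w \<Rightarrow> real ^ 'd::finite \<Rightarrow> real"
  assumes "open V" "finite W" "\<And>w. w \<in> W \<Longrightarrow> smooth_on V (g w)"
  shows "smooth_on V (\<lambda>y. \<Prod>w\<in>W. g w y)"
proof (rule smooth_onI[OF assms(1) partials_prod[OF assms]])
  fix as y assume "y \<in> V"
  then show "(\<lambda>y. \<Sum>ws | length ws = length as \<and> set ws \<subseteq> W.
      \<Prod>w\<in>W. partials (labels_for ws as w) (g w) y) differentiable at y"
    by (intro differentiable_compose_sum differentiable_compose_prod smooth_on_differentiable[OF assms(3,1)])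
qed

lemma smooth_on_mult:
  fixes f g :: "real ^ 'd::finite \<Rightarrow> real"
  assumes "open V" "smooth_on V f" "smooth_on V g"
  shows "smooth_on V (\<lambda>y. f y * g y)"
  using smooth_on_prod[of V "UNIV :: bool set" "\<lambda>b. if b then f else g"] assms
  by (simp add: UNIV_bool mult.commute)

lemma partial_mult:
  fixes f g :: "real ^ 'd::finite \<Rightarrow> real"
  assumes "open V" "smooth_on V f" "smooth_on V g" "y \<in> V"
  shows "partial a (\<lambda>y. f y * g y) y = partial a f y * g y + f y * partial a g y"
proof -
  have "((\<lambda>y. f y * g y) has_derivative (\<lambda>h. f y * frechet_derivative g (at y) h + frechet_derivative f (at y) h * g y)) (at y)"
    using smooth_on_has_derivative[OF assms(2,1,4), of "[]"] smooth_on_has_derivative[OF assms(3,1,4), of "[]"]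
    by (auto intro: has_derivative_mult)
  from partial_eq[OF this] show ?thesis by (simp add: partial_def)
qed

lemma partials_component:
  fixes F :: "real ^ 'd::finite \<Rightarrow> real ^ 'e::finite"
  assumes "open V" "smooth_on V F" "y \<in> V"
  shows "partials as (\<lambda>y. F y $ b) y = partials as F y $ b"
  using assms(3)
proof (induction as arbitrary: y)
  case (Cons a as)
  have "partials (a # as) (\<lambda>y. F y $ b) y = partial a (\<lambda>y. partials as F y $ b) y"
    using Cons by (auto intro: partial_cong[OF assms(1)])
  also have "\<dots> = partial a (partials as F) y $ b"
    unfolding partial_def[of a "partials as F"]
    by (intro partial_eq bounded_linear.has_derivative[OF bounded_linear_vec_nth]
       smooth_on_has_derivative[OF assms(2) assms(1)] Cons.prems)
  finally show ?case by simp
qed simp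

lemma smooth_on_component:
  fixes F :: "real ^ 'd::finite \<Rightarrow> real ^ 'e::finite"
  assumes "open V" "smooth_on V F"
  shows "smooth_on V (\<lambda>y. F y $ b)"
proof (rule smooth_onI[OF assms(1) partials_component[OF assms]])
  fix as y assume "y \<in> V"
  then show "(\<lambda>y. partials as F y $ b) differentiable at y"
    using bounded_linear.has_derivative[OF bounded_linear_vec_nth smooth_on_has_derivative[OF assms(2,1)]]
    by (auto intro: differentiableI)
qed

section \<open>Symmetry of partial derivatives\<close>

lemma DERIV_along_axis:
  fixes f :: "real ^ 'd::finite \<Rightarrow> real"
  assumes "f differentiable (at (p + t *\<^sub>R axis a 1))"
  shows "((\<lambda>t. f (p + t *\<^sub>R axis a 1)) has_real_derivative partial a f (p + t *\<^sub>R axis a 1)) (at t)"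
proof -
  let ?D = "frechet_derivative f (at (p + t *\<^sub>R axis a 1))"
  have D: "(f has_derivative ?D) (at (p + t *\<^sub>R axis a 1))"
    using assms frechet_derivative_works by blast
  have "((\<lambda>t. p + t *\<^sub>R axis a 1) has_derivative (\<lambda>s. s *\<^sub>R axis a 1)) (at t)"
    by (auto intro!: derivative_eq_intros)
  from has_derivative_compose[OF this D]
  have "((\<lambda>t. f (p + t *\<^sub>R axis a 1)) has_derivative (\<lambda>s. ?D (s *\<^sub>R axis a 1))) (at t)" .
  moreover have "?D (s *\<^sub>R axis a 1) = partial a f (p + t *\<^sub>R axis a 1) * s" for s
    using linear_scale[OF has_derivative_linear[OF D]] by (simp add: partial_def)
  ultimately show ?thesis by (simp add: has_field_derivative_def)
qed

text \<open>The mean value theorem in direction \<open>a\<close> for the difference of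
  \<open>f\<close> across the step in direction \<open>b\<close>, then in direction \<open>b\<close>
  for \<open>partial a f\<close>. Two axis steps of length at most \<open>h\<close> stay within
  distance \<open>2 * h\<close>. The second difference is symmetric in \<open>a\<close> and
  \<open>b\<close>.\<close>

lemma second_difference_mvt:
  fixes f :: "real ^ 'd::finite \<Rightarrow> real"
  assumes "open V" "smooth_on V f" "cball y (2 * h) \<subseteq> V" "h > 0"
  shows "\<exists>z \<in> cball y (2 * h). f (y + h *\<^sub>R axis a 1 + h *\<^sub>R axis b 1) - f (y + h *\<^sub>R axis a 1)
      - f (y + h *\<^sub>R axis b 1) + f y = h\<^sup>2 * partial b (partial a f) z"
proof -
  let ?p = "\<lambda>t s. y + t *\<^sub>R axis a 1 + s *\<^sub>R axis b (1 :: real)"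
  have in_ball: "?p t s \<in> cball y (2 * h)" if "0 \<le> t" "t \<le> h" "0 \<le> s" "s \<le> h" for t s
  proof -
    have "dist (?p t s) y = norm (t *\<^sub>R axis a 1 + s *\<^sub>R axis b (1::real))"
      by (simp add: dist_norm add.assoc)
    also have "\<dots> \<le> norm (t *\<^sub>R axis a (1::real)) + norm (s *\<^sub>R axis b (1::real))" by (rule norm_triangle_ineq)
    also have "\<dots> \<le> 2 * h" using that by (simp add: norm_axis_1)
    finally show ?thesis by (simp add: dist_commute)
  qed
  have swap: "?p t s = (y + s *\<^sub>R axis b 1) + t *\<^sub>R axis a 1" for t s by (simp add: algebra_simps)
  have f_diff: "f differentiable (at (?p t s))" if "0 \<le> t" "t \<le> h" "0 \<le> s" "s \<le> h" for t s
    using smooth_on_differentiable[OF assms(2,1), of _ "[]"] in_ball[OF that] assms(3) by auto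
  have fa_diff: "partial a f differentiable (at (?p t s))" if "0 \<le> t" "t \<le> h" "0 \<le> s" "s \<le> h" for t s
    using smooth_on_differentiable[OF assms(2,1), of _ "[a]"] in_ball[OF that] assms(3) by auto
  define g where "g t = f (?p t h) - f (?p t 0)" for t
  have "(g has_real_derivative partial a f (?p t h) - partial a f (?p t 0)) (at t)" if "0 \<le> t" "t \<le> h" for t
    unfolding g_def using that assms(4) f_diff[of t h] f_diff[of t 0] unfolding swap
    by (intro DERIV_diff DERIV_along_axis) auto
  from MVT2[OF assms(4) this] obtain t where t: "0 < t" "t < h"
    and gt: "g h - g 0 = h * (partial a f (?p t h) - partial a f (?p t 0))" by auto
  have "((\<lambda>s. partial a f (?p t s)) has_real_derivative partial b (partial a f) (?p t s)) (at s)"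
    if "0 \<le> s" "s \<le> h" for s
    using that t fa_diff[of t s] by (intro DERIV_along_axis) auto
  from MVT2[OF assms(4) this] obtain s where s: "0 < s" "s < h"
    and gs: "partial a f (?p t h) - partial a f (?p t 0) = h * partial b (partial a f) (?p t s)" by auto
  show ?thesis
  proof
    show "?p t s \<in> cball y (2 * h)" using in_ball t s by simp
    show "f (y + h *\<^sub>R axis a 1 + h *\<^sub>R axis b 1) - f (y + h *\<^sub>R axis a 1)
      - f (y + h *\<^sub>R axis b 1) + f y = h\<^sup>2 * partial b (partial a f) (?p t s)"
      using gt gs by (simp add: g_def power2_eq_square)
  qed
qed

text \<open>Both mixed derivatives represent the same second difference at points near
  \<open>y\<close>, and both are continuous, being differentiable by smoothness.\<close>

lemma partial_commute:
  fixes f :: "real ^ 'd::finite \<Rightarrow> real"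
  assumes "open V" "smooth_on V f" "y \<in> V"
  shows "partial a (partial b f) y = partial b (partial a f) y"
proof (rule ccontr)
  let ?P = "partial a (partial b f)" and ?Q = "partial b (partial a f)"
  assume ne: "?P y \<noteq> ?Q y"
  \<comment> \<open>Half the gap: two values less than \<open>e\<close> away from
    \<open>?P y\<close> and \<open>?Q y\<close> cannot coincide.\<close>
  define e where "e = \<bar>?P y - ?Q y\<bar> / 2"
  have e: "e > 0" using ne by (simp add: e_def)
  have "isCont ?P y" "isCont ?Q y"
    using smooth_on_differentiable[OF assms(2,1,3), of "[a, b]"] smooth_on_differentiable[OF assms(2,1,3), of "[b, a]"]
    by (auto dest: differentiable_imp_continuous_within)
  then obtain d1 d2 where d: "d1 > 0" "d2 > 0"
    "\<And>z. dist z y < d1 \<Longrightarrow> dist (?P z) (?P y) < e" "\<And>z. dist z y < d2 \<Longrightarrow> dist (?Q z) (?Q y) < e"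
    using e unfolding continuous_at_eps_delta by metis
  obtain r where r: "r > 0" "cball y r \<subseteq> V" using assms open_contains_cball by metis
  \<comment> \<open>Dividing by 3 puts \<open>2 * h\<close> strictly below \<open>d1\<close> and
    \<open>d2\<close>.\<close>
  define h where "h = min r (min d1 d2) / 3"
  have h: "h > 0" "2 * h < d1" "2 * h < d2" "2 * h \<le> r" using r d by (auto simp: h_def)
  have sub: "cball y (2 * h) \<subseteq> V" using r h by (metis subset_cball order_trans)
  obtain z1 where z1: "z1 \<in> cball y (2 * h)" "f (y + h *\<^sub>R axis a 1 + h *\<^sub>R axis b 1) - f (y + h *\<^sub>R axis a 1)
      - f (y + h *\<^sub>R axis b 1) + f y = h\<^sup>2 * ?Q z1"
    using second_difference_mvt[OF assms(1,2) sub h(1)] by blast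
  obtain z2 where z2: "z2 \<in> cball y (2 * h)" "f (y + h *\<^sub>R axis b 1 + h *\<^sub>R axis a 1) - f (y + h *\<^sub>R axis b 1)
      - f (y + h *\<^sub>R axis a 1) + f y = h\<^sup>2 * ?P z2"
    using second_difference_mvt[OF assms(1,2) sub h(1)] by blast
  have "h\<^sup>2 * ?Q z1 = h\<^sup>2 * ?P z2"
    using z1(2) z2(2) by (simp add: algebra_simps)
  then have "?Q z1 = ?P z2" using h by simp
  moreover have "dist (?Q z1) (?Q y) < e" using z1(1) h by (intro d(4)) (auto simp: dist_commute)
  moreover have "dist (?P z2) (?P y) < e" using z2(1) h by (intro d(3)) (auto simp: dist_commute)
  ultimately show False unfolding e_def dist_real_def by (smt (verit) field_sum_of_halves)
qed

lemma partials_move_front: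
  fixes f :: "real ^ 'd::finite \<Rightarrow> real"
  assumes "open V" "smooth_on V f" "y \<in> V"
  shows "partials (xs @ a # ys) f y = partials (a # xs @ ys) f y"
  using assms(3)
proof (induction xs arbitrary: y)
  case (Cons x xs)
  have "partials ((x # xs) @ a # ys) f y = partial x (partial a (partials (xs @ ys) f)) y"
    using Cons by (auto intro: partial_cong[OF assms(1)])
  also have "\<dots> = partial a (partial x (partials (xs @ ys) f)) y"
    by (rule partial_commute[OF assms(1) smooth_on_partials[OF assms(2)] Cons.prems])
  finally show ?case by simp
qed simp

text \<open>A white vertex receives an unordered collection of edge indices; this makes its factor
  depend on their multiset only.\<close>

lemma partials_perm:
  fixes f :: "real ^ 'd::finite \<Rightarrow> real"
  assumes "open V" "smooth_on V f" "y \<in> V" "mset as = mset bs"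
  shows "partials as f y = partials bs f y"
  using assms(3,4)
proof (induction as arbitrary: bs y)
  case (Cons a as)
  then have "a \<in> set bs" by (metis list.set_intros(1) set_mset_mset)
  then obtain us vs where bs: "bs = us @ a # vs" by (meson split_list)
  then have "mset as = mset (us @ vs)" using Cons.prems by simp
  then have "partials (a # as) f y = partials (a # us @ vs) f y"
    using Cons by (auto intro: partial_cong[OF assms(1)])
  then show ?case using partials_move_front[OF assms(1,2)] bs Cons.prems by metis
qed simp

section \<open>Taylor expansion in the formal parameter\<close>

definition formal_shift :: "('d \<Rightarrow> complex fps) \<Rightarrow> 'd \<Rightarrow> complex fps" where
  "formal_shift c a = c a - fps_const (fps_nth (c a) 0)"

definition base_point :: "('d::finite \<Rightarrow> complex fps) \<Rightarrow> real ^ 'd" where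
  "base_point c = (\<chi> a. Re (fps_nth (c a) 0))"

text \<open>The outer variable counts the order of the Taylor term: the derivative in it turns
  multiplicativity of the expansion into the product rule for a single partial derivative.\<close>

definition taylor_series :: "(real ^ 'd::finite \<Rightarrow> real) \<Rightarrow> ('d \<Rightarrow> complex fps) \<Rightarrow> complex fps fps" where
  "taylor_series g c = Abs_fps (\<lambda>k. fps_const (1 / fact k) *
     (\<Sum>as | length as = k. fps_const (of_real (partials as g (base_point c))) *
       (\<Prod>a\<leftarrow>as. formal_shift c a)))"

text \<open>Each factor is divisible by \<open>\<hbar>\<close>. This makes every sum over Taylor
  orders finite in a given power of \<open>\<hbar>\<close>.\<close>

lemma prod_list_formal_shift_nth:
  "n < length as \<Longrightarrow> fps_nth (\<Prod>a\<leftarrow>as. formal_shift c a) n = 0"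
proof (induction as arbitrary: n)
  case (Cons a as)
  have "fps_nth (formal_shift c a) i * fps_nth (\<Prod>a\<leftarrow>as. formal_shift c a) (n - i) = 0" if "i \<le> n" for i
    using that Cons by (cases i) (auto simp: formal_shift_def)
  then show ?case by (auto simp: fps_mult_nth intro: sum.neutral)
qed simp

lemma taylor_series_nth_nth_eq_0:
  "n < k \<Longrightarrow> fps_nth (fps_nth (taylor_series g c) k) n = 0"
  by (simp add: taylor_series_def fps_sum_nth prod_list_formal_shift_nth)

text \<open>Evaluation sets the outer variable of the Taylor series to 1; orders
  \<open>k > n\<close> would contribute zero to \<open>\<hbar>\<^sup>n\<close>.\<close>

lemma formal_eval_nth:
  "fps_nth (formal_eval g c) n = (\<Sum>k\<le>n. fps_nth (fps_nth (taylor_series g c) k) n)"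
  by (simp add: formal_eval_def taylor_series_def fps_sum_nth formal_shift_def base_point_def
      sum_distrib_left mult_ac)

lemma taylor_series_cong:
  assumes "open V" "base_point c \<in> V" "\<And>y. y \<in> V \<Longrightarrow> f y = g y"
  shows "taylor_series f c = taylor_series g c"
  unfolding taylor_series_def using partials_cong[OF assms] by simp

lemma taylor_series_sum:
  assumes "open V" "base_point c \<in> V" "\<And>i. i \<in> I \<Longrightarrow> smooth_on V (g i)"
  shows "taylor_series (\<lambda>y. \<Sum>i\<in>I. g i y) c = (\<Sum>i\<in>I. taylor_series (g i) c)"
proof (rule fps_ext)
  fix k
  have const: "fps_const (complex_of_real (\<Sum>i\<in>I. h i)) = (\<Sum>i\<in>I. fps_const (complex_of_real (h i)))" for h
    by (induction I rule: infinite_finite_induct) (auto simp flip: fps_const_add)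
  have "partials as (\<lambda>y. \<Sum>i\<in>I. g i y) (base_point c) = (\<Sum>i\<in>I. partials as (g i) (base_point c))" for as
    by (rule partials_sum[OF assms(1,3,2)])
  then show "fps_nth (taylor_series (\<lambda>y. \<Sum>i\<in>I. g i y) c) k = fps_nth (\<Sum>i\<in>I. taylor_series (g i) c) k"
    unfolding taylor_series_def fps_sum_nth fps_nth_Abs_fps
    by (simp add: const sum_distrib_left sum_distrib_right del: of_real_sum) (rule sum.swap)
qed

text \<open>The last index is split off because \<open>partials\<close> applies the last entry of
  its list first: \<open>partials (as @ [a]) g\<close> is
  \<open>partials as (partial a g)\<close>.\<close>

lemma sum_lists_snoc:
  "(\<Sum>as | length as = Suc n. h as) = (\<Sum>a\<in>(UNIV :: 'a::finite set). \<Sum>as | length as = n. h (as @ [a]))"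
proof -
  have "(\<Sum>a\<in>UNIV. \<Sum>as | length as = n. h (as @ [a])) =
      (\<Sum>(a, as) \<in> UNIV \<times> {as. length as = n}. h (as @ [a]))"
    by (rule sum.cartesian_product)
  also have "\<dots> = (\<Sum>as | length as = Suc n. h as)"
    by (rule sum.reindex_bij_witness[of _ "\<lambda>as. (last as, butlast as)" "\<lambda>(a, as). as @ [a]"])
       (auto, metis append_butlast_last_id length_0_conv nat.distinct(1))
  finally show ?thesis ..
qed

text \<open>The chain rule for \<open>g(c\<^sub>0 + t (c - c\<^sub>0))\<close> in the outer variable
  \<open>t\<close>; the factor \<open>k + 1\<close> from the derivative is absorbed by the
  factorial.\<close>

lemma fps_deriv_taylor_series:
  "fps_deriv (taylor_series g c) = (\<Sum>a\<in>UNIV. fps_const (formal_shift c a) * taylor_series (partial a g) c)"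
proof (rule fps_ext)
  fix k
  have "fps_nth (fps_deriv (taylor_series g c)) k =
      of_nat (Suc k) * fps_const (1 / fact (Suc k)) * (\<Sum>a\<in>UNIV. \<Sum>as | length as = k.
        fps_const (of_real (partials (as @ [a]) g (base_point c))) *
       ((\<Prod>a\<leftarrow>as. formal_shift c a) * formal_shift c a))"
    by (simp add: taylor_series_def sum_lists_snoc mult.assoc del: of_nat_Suc fact_Suc)
  also have "of_nat (Suc k) * fps_const (1 / fact (Suc k)) = (fps_const (1 / fact k) :: complex fps)"
  proof -
    have "fps_const (of_nat (Suc k) * (1 / fact (Suc k))) = (fps_const (1 / fact k) :: complex fps)"
      by (rule arg_cong[of _ _ fps_const]) (simp add: field_simps del: of_nat_Suc)
    then show ?thesis by (metis fps_const_mult fps_of_nat)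
  qed
  finally show "fps_nth (fps_deriv (taylor_series g c)) k =
      fps_nth (\<Sum>a\<in>UNIV. fps_const (formal_shift c a) * taylor_series (partial a g) c) k"
    by (simp add: taylor_series_def fps_sum_nth sum_distrib_left partials_append mult_ac)
qed

lemma taylor_series_nth_0: "fps_nth (taylor_series g c) 0 = fps_const (of_real (g (base_point c)))"
  by (simp add: taylor_series_def)

text \<open>Induction on the order in the outer variable: the constant terms agree, and the
  derivatives agree by the product rule and the induction hypothesis for the partial derivatives of
  \<open>f\<close> and \<open>g\<close>, which is why both functions vary.\<close>

lemma taylor_series_mult:
  assumes "open V" "base_point c \<in> V" "smooth_on V f" "smooth_on V g"
  shows "taylor_series (\<lambda>y. f y * g y) c = taylor_series f c * taylor_series g c"
proof (rule fps_ext)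
  fix k
  show "fps_nth (taylor_series (\<lambda>y. f y * g y) c) k = fps_nth (taylor_series f c * taylor_series g c) k"
    using assms(3,4)
  proof (induction k arbitrary: f g)
    case 0
    then show ?case by (simp add: taylor_series_nth_0)
  next
    case (Suc k)
    note V = assms(1,2)
    let ?T = "\<lambda>g. taylor_series g c"
    have part: "?T (partial a (\<lambda>y. f y * g y)) = ?T (\<lambda>y. partial a f y * g y) + ?T (\<lambda>y. f y * partial a g y)" for a
    proof -
      \<comment> \<open>A two-term sum written over \<open>bool\<close>, so that additivity for
        indexed families applies.\<close>
      have "?T (partial a (\<lambda>y. f y * g y)) = ?T (\<lambda>y. \<Sum>b\<in>UNIV. if b then partial a f y * g y else f y * partial a g y)"
        using partial_mult[OF V(1) Suc.prems] by (intro taylor_series_cong[OF V]) (simp add: UNIV_bool add.commute)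
      also have "\<dots> = (\<Sum>b\<in>UNIV. ?T (\<lambda>y. if b then partial a f y * g y else f y * partial a g y))"
      proof (rule taylor_series_sum[OF V])
        show "smooth_on V (\<lambda>y. if b then partial a f y * g y else f y * partial a g y)" for b
          using Suc.prems by (cases b) (auto intro!: smooth_on_mult V smooth_on_partial)
      qed
      finally show ?thesis by (simp add: UNIV_bool add.commute)
    qed
    have "of_nat (Suc k) * fps_nth (?T (\<lambda>y. f y * g y)) (Suc k) = fps_nth (fps_deriv (?T (\<lambda>y. f y * g y))) k"
      by simp
    also have "\<dots> = (\<Sum>a\<in>UNIV. formal_shift c a *
        (fps_nth (?T (\<lambda>y. partial a f y * g y)) k + fps_nth (?T (\<lambda>y. f y * partial a g y)) k))"
      by (simp add: fps_deriv_taylor_series fps_sum_nth part)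
    also have "\<dots> = (\<Sum>a\<in>UNIV. formal_shift c a *
        (fps_nth (?T (partial a f) * ?T g) k + fps_nth (?T f * ?T (partial a g)) k))"
      using Suc.prems by (simp add: Suc.IH smooth_on_partial)
    also have "\<dots> = fps_nth (fps_deriv (?T f) * ?T g + ?T f * fps_deriv (?T g)) k"
    proof -
      have "fps_nth (fps_deriv (?T f) * ?T g) k =
          (\<Sum>a\<in>UNIV. formal_shift c a * fps_nth (?T (partial a f) * ?T g) k)"
        by (simp add: fps_deriv_taylor_series sum_distrib_right fps_sum_nth mult.assoc)
      moreover have "fps_nth (?T f * fps_deriv (?T g)) k =
          (\<Sum>a\<in>UNIV. formal_shift c a * fps_nth (?T f * ?T (partial a g)) k)"
        by (simp add: fps_deriv_taylor_series sum_distrib_left fps_sum_nth mult.left_commute[of "?T f"])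
      ultimately show ?thesis by (simp add: sum.distrib distrib_left)
    qed
    also have "\<dots> = fps_nth (fps_deriv (?T f * ?T g)) k"
      by (simp add: add.commute)
    also have "\<dots> = of_nat (Suc k) * fps_nth (?T f * ?T g) (Suc k)"
      by (simp only: fps_deriv_nth Suc_eq_plus1)
    finally show ?case by (metis mult_cancel_left of_nat_neq_0)
  qed
qed

section \<open>Evaluation at the formal point as a ring homomorphism\<close>

lemma formal_eval_cong:
  assumes "open V" "base_point c \<in> V" "\<And>y. y \<in> V \<Longrightarrow> f y = g y"
  shows "formal_eval f c = formal_eval g c"
  by (rule fps_ext) (simp add: formal_eval_nth taylor_series_cong[OF assms])

lemma formal_eval_sum:
  assumes "open V" "base_point c \<in> V" "\<And>i. i \<in> I \<Longrightarrow> smooth_on V (g i)"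
  shows "formal_eval (\<lambda>y. \<Sum>i\<in>I. g i y) c = (\<Sum>i\<in>I. formal_eval (g i) c)"
proof (rule fps_ext)
  fix n
  have "taylor_series (\<lambda>y. \<Sum>i\<in>I. g i y) c = (\<Sum>i\<in>I. taylor_series (g i) c)"
    by (rule taylor_series_sum[OF assms])
  then show "fps_nth (formal_eval (\<lambda>y. \<Sum>i\<in>I. g i y) c) n = fps_nth (\<Sum>i\<in>I. formal_eval (g i) c) n"
    by (simp add: formal_eval_nth fps_sum_nth) (rule sum.swap)
qed

lemma formal_eval_const: "formal_eval (\<lambda>_. r) c = fps_const (of_real r)"
proof (rule fps_ext)
  fix n
  have "fps_nth (taylor_series (\<lambda>_. r) c) k = (if k = 0 then fps_const (of_real r) else 0)" for k
  proof (cases "k = 0")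
    case False
    then have "(\<Sum>as | length as = k. fps_const (of_real (partials as (\<lambda>_. r) (base_point c))) *
       (\<Prod>a\<leftarrow>as. formal_shift c a)) = 0"
      by (intro sum.neutral) (auto simp: partials_const)
    then show ?thesis using False by (simp add: taylor_series_def)
  qed (simp add: taylor_series_nth_0)
  then have "fps_nth (formal_eval (\<lambda>_. r) c) n = (\<Sum>k\<le>n. if k = 0 then fps_nth (fps_const (of_real r)) n else 0)"
    unfolding formal_eval_nth by (intro sum.cong) auto
  then show "fps_nth (formal_eval (\<lambda>_. r) c) n = fps_nth (fps_const (complex_of_real r)) n"
    by (simp add: sum.delta)
qed

text \<open>Setting the outer variable to 1 is multiplicative once rearranging is justified: all
  Taylor sums may be extended to order \<open>n\<close>, and pairs of orders with
  \<open>j + l > n\<close> contribute nothing to \<open>\<hbar>\<^sup>n\<close>. The remaining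
  triangle regroups by \<open>k = j + l\<close> into the Cauchy product of the two Taylor
  series.\<close>

lemma formal_eval_mult:
  assumes "open V" "base_point c \<in> V" "smooth_on V f" "smooth_on V g"
  shows "formal_eval (\<lambda>y. f y * g y) c = formal_eval f c * formal_eval g c"
proof (rule fps_ext)
  fix n
  let ?t = "\<lambda>g k i. fps_nth (fps_nth (taylor_series g c) k) i"
  have ext: "fps_nth (formal_eval g c) i = (\<Sum>k\<le>n. ?t g k i)" if "i \<le> n" for g i
    unfolding formal_eval_nth
    by (rule sum.mono_neutral_left) (use that in \<open>auto simp: taylor_series_nth_nth_eq_0\<close>)
  have "fps_nth (formal_eval f c * formal_eval g c) n =
      (\<Sum>i\<le>n. (\<Sum>j\<le>n. ?t f j i) * (\<Sum>l\<le>n. ?t g l (n - i)))"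
    unfolding fps_mult_nth atLeast0AtMost by (intro sum.cong refl) (simp add: ext)
  also have "\<dots> = (\<Sum>i\<le>n. \<Sum>(j, l)\<in>{..n} \<times> {..n}. ?t f j i * ?t g l (n - i))"
    by (simp add: sum_product sum.cartesian_product)
  also have "\<dots> = (\<Sum>(j, l)\<in>{..n} \<times> {..n}. \<Sum>i\<le>n. ?t f j i * ?t g l (n - i))"
    by (subst sum.swap) (simp add: case_prod_unfold)
  also have "\<dots> = (\<Sum>(j, l)\<in>{(j, l). j + l \<le> n}. \<Sum>i\<le>n. ?t f j i * ?t g l (n - i))"
  proof (rule sum.mono_neutral_right)
    show "\<forall>p\<in>{..n} \<times> {..n} - {(j, l). j + l \<le> n}. (case p of (j, l) \<Rightarrow> \<Sum>i\<le>n. ?t f j i * ?t g l (n - i)) = 0"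
    proof -
      have "(\<Sum>i\<le>n. ?t f j i * ?t g l (n - i)) = 0" if "\<not> j + l \<le> n" for j l
      proof (rule sum.neutral, rule ballI)
        fix i assume "i \<in> {..n}"
        \<comment> \<open>If \<open>i \<ge> j\<close>, then \<open>n - i < l\<close>, so one of the
          two Taylor orders exceeds its power of \<open>\<hbar>\<close>.\<close>
        then show "?t f j i * ?t g l (n - i) = 0"
          using that by (cases "i < j") (auto simp: taylor_series_nth_nth_eq_0)
      qed
      then show ?thesis by auto
    qed
  qed auto
  also have "\<dots> = (\<Sum>k\<le>n. \<Sum>j\<le>k. \<Sum>i\<le>n. ?t f j i * ?t g (k - j) (n - i))"
    by (rule sum.triangle_reindex_eq)
  also have "\<dots> = fps_nth (formal_eval (\<lambda>y. f y * g y) c) n"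
    unfolding formal_eval_nth taylor_series_mult[OF assms]
    by (simp add: fps_mult_nth fps_sum_nth atLeast0AtMost)
  finally show "fps_nth (formal_eval (\<lambda>y. f y * g y) c) n = fps_nth (formal_eval f c * formal_eval g c) n" ..
qed

lemma formal_eval_prod:
  assumes "open V" "base_point c \<in> V" "finite W" "\<And>w. w \<in> W \<Longrightarrow> smooth_on V (g w)"
  shows "formal_eval (\<lambda>y. \<Prod>w\<in>W. g w y) c = (\<Prod>w\<in>W. formal_eval (g w) c)"
  using assms(3,4)
proof (induction W)
  case empty
  then show ?case by (simp add: formal_eval_const)
next
  case (insert w W)
  then show ?case by (simp add: formal_eval_mult[OF assms(1,2)] smooth_on_prod[OF assms(1)])
qed

lemma formal_eval_partials_perm:
  assumes "open V" "base_point c \<in> V" "smooth_on V f" "mset as = mset bs"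
  shows "formal_eval (partials as f) c = formal_eval (partials bs f) c"
  by (rule formal_eval_cong[OF assms(1,2)]) (rule partials_perm[OF assms(1,3) _ assms(4)])

section \<open>Weights of labelled bipartite multigraphs\<close>

lemma sum_lists_Cons_UNIV:
  "(\<Sum>l | length l = Suc n. h l) = (\<Sum>x\<in>(UNIV :: 'a::finite set). \<Sum>l | length l = n. h (x # l))"
proof -
  have "(\<Sum>l | length l = Suc n. h l) = (\<Sum>l | length l = n. \<Sum>x\<in>(UNIV :: 'a::finite set). h (x # l))"
    using sum_lists_Cons[where W = "UNIV :: 'a set" and n = n and h = h] by simp
  also have "\<dots> = (\<Sum>x\<in>UNIV. \<Sum>l | length l = n. h (x # l))" by (rule sum.swap)
  finally show ?thesis .
qed

lemma sum_lists_append: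
  "(\<Sum>l | length l = m + n. h l) =
   (\<Sum>k | length k = m. \<Sum>l :: 'a::finite list | length l = n. h (k @ l))"
proof -
  have "(\<Sum>k | length k = m. \<Sum>l | length l = n. h (k @ l)) =
      (\<Sum>(k, l) \<in> {k. length k = m} \<times> {l. length l = n}. h (k @ l))"
    by (rule sum.cartesian_product)
  also have "\<dots> = (\<Sum>l | length l = m + n. h l)"
    by (rule sum.reindex_bij_witness[of _ "\<lambda>l. (take m l, drop m l)" "\<lambda>(k, l). k @ l"]) auto
  finally show ?thesis ..
qed

lemma sum_zip_move_front:
  "(\<Sum>l :: 'd::finite list | length l = length (us @ e # vs). F (mset (zip (us @ e # vs) l))) =
   (\<Sum>l | length l = length (e # us @ vs). F (mset (zip (e # us @ vs) l)))"
proof (induction us arbitrary: F)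
  case (Cons u us)
  have "(\<Sum>l :: 'd list | length l = length ((u # us) @ e # vs). F (mset (zip ((u # us) @ e # vs) l))) =
      (\<Sum>x\<in>UNIV. \<Sum>l :: 'd list | length l = length (us @ e # vs). F (add_mset (u, x) (mset (zip (us @ e # vs) l))))"
    by (simp add: sum_lists_Cons_UNIV)
  also have "\<dots> = (\<Sum>x\<in>UNIV. \<Sum>l :: 'd list | length l = length (e # us @ vs). F (add_mset (u, x) (mset (zip (e # us @ vs) l))))"
    by (intro sum.cong refl Cons.IH[where F = "\<lambda>T. F (add_mset (u, _) T)"])
  also have "\<dots> = (\<Sum>x\<in>UNIV. \<Sum>y\<in>UNIV. \<Sum>l :: 'd list | length l = length (us @ vs).
      F (add_mset (u, x) (add_mset (e, y) (mset (zip (us @ vs) l)))))"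
    by (simp add: sum_lists_Cons_UNIV)
  also have "\<dots> = (\<Sum>y\<in>UNIV. \<Sum>x\<in>UNIV. \<Sum>l :: 'd list | length l = length (us @ vs).
      F (add_mset (e, y) (add_mset (u, x) (mset (zip (us @ vs) l)))))"
    by (subst sum.swap) (simp only: add_mset_commute)
  also have "\<dots> = (\<Sum>l | length l = length (e # (u # us) @ vs). F (mset (zip (e # (u # us) @ vs) l)))"
    by (simp add: sum_lists_Cons_UNIV)
  finally show ?case .
qed simp

text \<open>A dummy index travels with its edge and \<open>F\<close> sees only the pairs, so
  contractions do not depend on the numbering of the edges. \<open>F\<close> varies in the induction
  because the pair at the head is absorbed into it.\<close>

lemma sum_zip_perm:
  assumes "mset es = mset es'"
  shows "(\<Sum>l :: 'd::finite list | length l = length es. F (mset (zip es l))) =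
   (\<Sum>l | length l = length es'. F (mset (zip es' l)))"
  using assms
proof (induction es arbitrary: es' F)
  case (Cons e es)
  then have "e \<in> set es'" by (metis list.set_intros(1) set_mset_mset)
  then obtain us vs where es': "es' = us @ e # vs" by (meson split_list)
  then have m: "mset es = mset (us @ vs)" using Cons.prems by simp
  have "(\<Sum>l :: 'd list | length l = length (e # es). F (mset (zip (e # es) l))) =
      (\<Sum>x\<in>UNIV. \<Sum>l :: 'd list | length l = length es. F (add_mset (e, x) (mset (zip es l))))"
    by (simp add: sum_lists_Cons_UNIV)
  also have "\<dots> = (\<Sum>x\<in>UNIV. \<Sum>l :: 'd list | length l = length (us @ vs). F (add_mset (e, x) (mset (zip (us @ vs) l))))"
    by (intro sum.cong refl Cons.IH[OF m, where F = "\<lambda>T. F (add_mset (e, _) T)"])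
  also have "\<dots> = (\<Sum>l | length l = length (e # us @ vs). F (mset (zip (e # us @ vs) l)))"
    by (simp add: sum_lists_Cons_UNIV)
  finally show ?case unfolding es' sum_zip_move_front .
qed simp

definition degree_at :: "(int \<times> int) multiset \<Rightarrow> int \<Rightarrow> nat" where
  "degree_at E v = size {#e \<in># E. fst e = v#}"

text \<open>The product over black vertices of the multinomial coefficients of their edge
  multiplicities, with the denominators merged into one product over distinct edges. It counts the
  orderings of the half-edges at the black vertices, parallel edges being indistinguishable.\<close>

definition symmetry_factor :: "int set \<Rightarrow> (int \<times> int) multiset \<Rightarrow> 'r::field_char_0" where
  "symmetry_factor B E = (\<Prod>v\<in>B. fact (degree_at E v)) / (\<Prod>e\<in>set_mset E. fact (count E e))"

definition labelings :: "int set \<Rightarrow> 'd multiset \<Rightarrow> (int \<Rightarrow> 'd) set" where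
  "labelings W M = {a \<in> W \<rightarrow>\<^sub>E UNIV. image_mset a (mset_set W) = M}"

lemma finite_labelings: "finite W \<Longrightarrow> finite (labelings W (M :: 'd::finite multiset))"
  unfolding labelings_def by (rule finite_subset[OF _ finite_PiE[of W "\<lambda>_. UNIV"]]) auto

lemma labelings_empty:
  assumes "size M \<noteq> card W" shows "labelings W M = {}"
  using assms by (auto simp: labelings_def)

text \<open>\<open>s\<close> weighs a black vertex by its edge indices, \<open>D\<close> a white one
  by its label and its edge indices. The combinatorics is done for arbitrary weights; the integral
  enters when they are instantiated with Laurent series.\<close>

locale vertex_weights =
  fixes s :: "'d::finite multiset \<Rightarrow> 'r::field_char_0" and D :: "'d \<Rightarrow> 'd multiset \<Rightarrow> 'r"
begin

definition labelled_weight :: "int set \<Rightarrow> int set \<Rightarrow> (int \<Rightarrow> 'd) \<Rightarrow> ((int \<times> int) \<times> 'd) multiset \<Rightarrow> 'r" where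
  "labelled_weight B W a T =
     (\<Prod>v\<in>B. s (image_mset snd {#t \<in># T. fst (fst t) = v#})) *
     (\<Prod>w\<in>W. D (a w) (image_mset snd {#t \<in># T. snd (fst t) = w#}))"

definition contraction :: "int set \<Rightarrow> int set \<Rightarrow> (int \<Rightarrow> 'd) \<Rightarrow> (int \<times> int) list \<Rightarrow> 'r" where
  "contraction B W a es = (\<Sum>l | length l = length es. labelled_weight B W a (mset (zip es l)))"

text \<open>The edge list is the very choice made by \<open>edge_list\<close>, so the weight can be
  compared with the bracket of a graph by unfolding; any other list of the same edges gives the same
  value.\<close>

definition graph_weight :: "int set \<Rightarrow> int set \<Rightarrow> (int \<times> int) multiset \<Rightarrow> 'd multiset \<Rightarrow> 'r" where
  "graph_weight B W E M = symmetry_factor B E *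
     (\<Sum>a \<in> labelings W M. contraction B W a (SOME es. mset es = E))"

lemma graph_weight_alt:
  assumes "mset es = E"
  shows "graph_weight B W E M = symmetry_factor B E * (\<Sum>a \<in> labelings W M. contraction B W a es)"
proof -
  have "mset (SOME es. mset es = E) = E" using assms by (rule someI)
  then have "contraction B W a (SOME es. mset es = E) = contraction B W a es" for a
    unfolding contraction_def using assms by (intro sum_zip_perm) simp
  then show ?thesis by (simp add: graph_weight_def)
qed

lemma contraction_cong:
  assumes "\<And>w. w \<in> W \<Longrightarrow> a w = b w"
  shows "contraction B W a es = contraction B W b es"
  unfolding contraction_def labelled_weight_def using assms by simp

section \<open>Invariance under renumbering\<close>

lemma labelled_weight_relabel:
  assumes "bij \<beta>" "bij \<omega>"
  shows "labelled_weight (\<beta> ` B) (\<omega> ` W) a (image_mset (map_prod (map_prod \<beta> \<omega>) id) T) =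
    labelled_weight B W (a \<circ> \<omega>) T"
proof -
  have inj: "inj_on \<beta> X" "inj_on \<omega> X" "\<beta> u = \<beta> v \<longleftrightarrow> u = v" "\<omega> u = \<omega> v \<longleftrightarrow> u = v" for X u v
    using assms by (auto simp: bij_def intro: inj_on_subset dest: injD)
  show ?thesis
    unfolding labelled_weight_def prod.reindex[OF inj(1)] prod.reindex[OF inj(2)]
    by (simp add: filter_mset_image_mset inj multiset.map_comp o_def)
qed

lemma contraction_relabel:
  assumes "bij \<beta>" "bij \<omega>"
  shows "contraction (\<beta> ` B) (\<omega> ` W) a (map (map_prod \<beta> \<omega>) es) = contraction B W (a \<circ> \<omega>) es"
proof -
  have "mset (zip (map (map_prod \<beta> \<omega>) es) l) =
      image_mset (map_prod (map_prod \<beta> \<omega>) id) (mset (zip es l))" for l :: "'d list"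
    by (simp add: zip_map1 map_prod_def case_prod_unfold)
  then show ?thesis
    unfolding contraction_def by (simp add: labelled_weight_relabel[OF assms])
qed

end

lemma count_image_mset_of_inj:
  assumes "inj f" shows "count (image_mset f E) (f e) = count E e"
proof (induction E)
  case (add x E)
  then show ?case using inj_eq[OF assms, of x e] by simp
qed simp

lemma symmetry_factor_relabel:
  assumes "bij \<beta>" "bij \<omega>"
  shows "symmetry_factor (\<beta> ` B) (image_mset (map_prod \<beta> \<omega>) E) = symmetry_factor B E"
proof -
  have i: "inj \<beta>" "inj \<omega>" using assms by (auto simp: bij_def)
  then have m: "inj (map_prod \<beta> \<omega>)" by (rule prod.inj_map)
  have inj: "inj_on \<beta> X" "inj_on (map_prod \<beta> \<omega>) Y" "\<beta> u = \<beta> v \<longleftrightarrow> u = v" for X Y u v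
    by (rule inj_on_subset[OF i(1) subset_UNIV] inj_on_subset[OF m subset_UNIV] inj_eq[OF i(1)])+
  have "degree_at (image_mset (map_prod \<beta> \<omega>) E) (\<beta> v) = degree_at E v" for v
    by (simp add: degree_at_def filter_mset_image_mset inj(3))
  then show ?thesis
    by (simp add: symmetry_factor_def prod.reindex[OF inj(1)] prod.reindex[OF inj(2)] count_image_mset_of_inj[OF m])
qed

text \<open>Renumberings are bijections of all integers, separately for the two colours, so
  injectivity and inverses come without domain conditions.\<close>

lemma (in vertex_weights) graph_weight_relabel:
  assumes "bij \<beta>" "bij \<omega>"
  shows "graph_weight (\<beta> ` B) (\<omega> ` W) (image_mset (map_prod \<beta> \<omega>) E) M = graph_weight B W E M"
proof -
  obtain es where es: "mset es = E" by (metis ex_mset)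
  have inj: "inj_on \<omega> W" and inv: "inv \<omega> (\<omega> w) = w" for w
    using assms by (auto simp: bij_def intro: inj_on_subset)
  have ms: "mset_set (\<omega> ` W) = image_mset \<omega> (mset_set W)" by (rule image_mset_mset_set[OF inj, symmetric])
  \<comment> \<open>Labelings are extensional, so a transported labeling has to be cut back to its
    domain; this does not change its label monomial.\<close>
  have img: "image_mset (restrict f X) (mset_set X) = image_mset f (mset_set X)" for f :: "int \<Rightarrow> 'd" and X
    by (cases "finite X") (auto intro!: image_mset_cong)
  have "(\<Sum>a \<in> labelings (\<omega> ` W) M. contraction (\<beta> ` B) (\<omega> ` W) a (map (map_prod \<beta> \<omega>) es)) =
     (\<Sum>a \<in> labelings W M. contraction B W a es)"
  proof (rule sum.reindex_bij_witness[of _ "\<lambda>a. restrict (a \<circ> inv \<omega>) (\<omega> ` W)" "\<lambda>a. restrict (a \<circ> \<omega>) W"], goal_cases)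
    case (1 a)
    then show ?case by (auto simp: labelings_def fun_eq_iff PiE_iff extensional_def inv)
  next
    case (2 a)
    have "image_mset (restrict (a \<circ> \<omega>) W) (mset_set W) = image_mset a (mset_set (\<omega> ` W))"
      by (subst img) (simp add: ms multiset.map_comp)
    then show ?case using 2 by (simp add: labelings_def)
  next
    case (3 a)
    then show ?case by (auto simp: labelings_def fun_eq_iff PiE_iff extensional_def inv)
  next
    case (4 a)
    have "image_mset (restrict (a \<circ> inv \<omega>) (\<omega> ` W)) (mset_set (\<omega> ` W)) = image_mset a (mset_set W)"
      by (subst img) (simp add: ms multiset.map_comp o_def inv)
    then show ?case using 4 by (simp add: labelings_def)
  next
    case (5 a)
    show ?case unfolding contraction_relabel[OF assms] by (rule contraction_cong) simp
  qed
  moreover have es': "mset (map (map_prod \<beta> \<omega>) es) = image_mset (map_prod \<beta> \<omega>) E" by (simp add: es)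
  ultimately show ?thesis
    by (simp only: graph_weight_alt[OF es] graph_weight_alt[OF es'] symmetry_factor_relabel[OF assms])
qed

section \<open>Multiplicativity over disjoint unions\<close>

lemma symmetry_factor_union:
  assumes "finite B1" "finite B2" "B1 \<inter> B2 = {}" "set_mset E1 \<subseteq> B1 \<times> W1" "set_mset E2 \<subseteq> B2 \<times> W2"
  shows "symmetry_factor (B1 \<union> B2) (E1 + E2) = symmetry_factor B1 E1 * symmetry_factor B2 E2"
proof -
  have f1: "{#e \<in># E2. fst e = v#} = {#}" if "v \<in> B1" for v
    using that assms by (intro filter_mset_eq_mempty_iff[THEN iffD2]) fastforce
  have f2: "{#e \<in># E1. fst e = v#} = {#}" if "v \<in> B2" for v
    using that assms by (intro filter_mset_eq_mempty_iff[THEN iffD2]) fastforce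
  have disj: "set_mset E1 \<inter> set_mset E2 = {}" using assms by fastforce
  have c: "e \<in># E1 \<Longrightarrow> count E2 e = 0" "e \<in># E2 \<Longrightarrow> count E1 e = 0" for e
    using disj by (auto simp: count_eq_zero_iff)
  have "(\<Prod>v\<in>B1 \<union> B2. fact (degree_at (E1 + E2) v)) =
      (\<Prod>v\<in>B1. fact (degree_at E1 v)) * (\<Prod>v\<in>B2. fact (degree_at E2 v) :: 'a)"
    using assms(1-3) by (simp add: prod.union_disjoint degree_at_def f1 f2)
  moreover have "(\<Prod>e\<in>set_mset (E1 + E2). fact (count (E1 + E2) e)) =
      (\<Prod>e\<in>set_mset E1. fact (count E1 e)) * (\<Prod>e\<in>set_mset E2. fact (count E2 e) :: 'a)"
    using disj by (simp add: prod.union_disjoint c)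
  ultimately show ?thesis by (simp add: symmetry_factor_def)
qed

context vertex_weights
begin

lemma labelled_weight_union:
  assumes "finite B1" "finite B2" "B1 \<inter> B2 = {}" "finite W1" "finite W2" "W1 \<inter> W2 = {}"
    and "fst ` set_mset T1 \<subseteq> B1 \<times> W1" "fst ` set_mset T2 \<subseteq> B2 \<times> W2"
  shows "labelled_weight (B1 \<union> B2) (W1 \<union> W2) a (T1 + T2) =
    labelled_weight B1 W1 a T1 * labelled_weight B2 W2 a T2"
proof -
  have a1: "{#t \<in># T2. fst (fst t) = v#} = {#}" if "v \<in> B1" for v
    using that assms by (intro filter_mset_eq_mempty_iff[THEN iffD2]) fastforce
  have a2: "{#t \<in># T1. fst (fst t) = v#} = {#}" if "v \<in> B2" for v
    using that assms by (intro filter_mset_eq_mempty_iff[THEN iffD2]) fastforce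
  have a3: "{#t \<in># T2. snd (fst t) = v#} = {#}" if "v \<in> W1" for v
    using that assms by (intro filter_mset_eq_mempty_iff[THEN iffD2]) fastforce
  have a4: "{#t \<in># T1. snd (fst t) = v#} = {#}" if "v \<in> W2" for v
    using that assms by (intro filter_mset_eq_mempty_iff[THEN iffD2]) fastforce
  show ?thesis
    using assms(1-6) by (simp add: labelled_weight_def prod.union_disjoint a1 a2 a3 a4)
qed

lemma contraction_union:
  assumes "finite B1" "finite B2" "B1 \<inter> B2 = {}" "finite W1" "finite W2" "W1 \<inter> W2 = {}"
    and "set es1 \<subseteq> B1 \<times> W1" "set es2 \<subseteq> B2 \<times> W2"
  shows "contraction (B1 \<union> B2) (W1 \<union> W2) a (es1 @ es2) = contraction B1 W1 a es1 * contraction B2 W2 a es2"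
proof -
  have "labelled_weight (B1 \<union> B2) (W1 \<union> W2) a (mset (zip (es1 @ es2) (k @ l))) =
      labelled_weight B1 W1 a (mset (zip es1 k)) * labelled_weight B2 W2 a (mset (zip es2 l))"
    if "length k = length es1" "length l = length es2" for k l
  proof -
    have "fst ` set (zip es1 k) \<subseteq> B1 \<times> W1" "fst ` set (zip es2 l) \<subseteq> B2 \<times> W2"
      using assms(7,8) by (auto dest: set_zip_leftD)
    then show ?thesis using labelled_weight_union[OF assms(1-6)] that by simp
  qed
  then show ?thesis
    unfolding contraction_def length_append sum_lists_append
    by (simp add: sum_product)
qed

text \<open>A labeling of the union is a pair of labelings whose monomials multiply to
  \<open>M\<close>; hence the convolution, which is the coefficient at \<open>M\<close> of a product
  of series in \<open>q'\<close>.\<close>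

lemma graph_weight_union:
  assumes "finite B1" "finite B2" "B1 \<inter> B2 = {}" "finite W1" "finite W2" "W1 \<inter> W2 = {}"
    and "set_mset E1 \<subseteq> B1 \<times> W1" "set_mset E2 \<subseteq> B2 \<times> W2"
  shows "graph_weight (B1 \<union> B2) (W1 \<union> W2) (E1 + E2) M =
    (\<Sum>A | A \<subseteq># M. graph_weight B1 W1 E1 A * graph_weight B2 W2 E2 (M - A))"
proof -
  obtain es1 es2 where es: "mset es1 = E1" "mset es2 = E2" by (metis ex_mset)
  have sub: "set es1 \<subseteq> B1 \<times> W1" "set es2 \<subseteq> B2 \<times> W2" using assms(7,8) es by auto
  let ?c1 = "\<lambda>a. contraction B1 W1 a es1" and ?c2 = "\<lambda>a. contraction B2 W2 a es2"
  have fin: "finite {A. A \<subseteq># M}" by (rule finite_submultisets)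
  have img: "image_mset (restrict f X) (mset_set X) = image_mset f (mset_set X)" for f :: "int \<Rightarrow> 'd" and X
    by (cases "finite X") (auto intro!: image_mset_cong)
  have un: "mset_set (W1 \<union> W2) = mset_set W1 + mset_set W2"
    using assms(4-6) by (simp add: mset_set_Union)
  have "(\<Sum>a \<in> labelings (W1 \<union> W2) M. ?c1 a * ?c2 a) =
      (\<Sum>(A, a1, a2) \<in> Sigma {A. A \<subseteq># M} (\<lambda>A. labelings W1 A \<times> labelings W2 (M - A)). ?c1 a1 * ?c2 a2)"
  proof (rule sum.reindex_bij_witness[of _ "\<lambda>(A, a1, a2). \<lambda>w. if w \<in> W1 then a1 w else a2 w"
        "\<lambda>a. (image_mset a (mset_set W1), restrict a W1, restrict a W2)"], goal_cases)
    case (1 a)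
    then show ?case by (auto simp: labelings_def fun_eq_iff PiE_iff extensional_def)
  next
    case (2 a)
    then show ?case by (auto simp: labelings_def img un)
  next
    case (3 p)
    obtain A a1 a2 where p: "p = (A, a1, a2)" by (cases p)
    have "image_mset (\<lambda>w. if w \<in> W1 then a1 w else a2 w) (mset_set W1) = image_mset a1 (mset_set W1)"
      using assms(4) by (intro image_mset_cong) auto
    then show ?case using 3 assms(6) unfolding p
      by (auto simp: labelings_def fun_eq_iff PiE_iff extensional_def restrict_def)
  next
    case (4 p)
    obtain A a1 a2 where p: "p = (A, a1, a2)" by (cases p)
    have "image_mset (\<lambda>w. if w \<in> W1 then a1 w else a2 w) (mset_set W1) = image_mset a1 (mset_set W1)"
      using assms(4) by (intro image_mset_cong) auto
    moreover have "image_mset (\<lambda>w. if w \<in> W1 then a1 w else a2 w) (mset_set W2) = image_mset a2 (mset_set W2)"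
      using assms(5,6) by (intro image_mset_cong) auto
    ultimately show ?case using 4 assms(6) unfolding p
      by (auto simp: labelings_def PiE_iff extensional_def un subset_mset.add_diff_inverse)
  next
    case (5 a)
    have "?c1 (restrict a W1) = ?c1 a" "?c2 (restrict a W2) = ?c2 a"
      by (auto intro: contraction_cong)
    then show ?case by simp
  qed
  also have "\<dots> = (\<Sum>A | A \<subseteq># M. (\<Sum>a\<in>labelings W1 A. ?c1 a) * (\<Sum>a\<in>labelings W2 (M - A). ?c2 a))"
  proof -
    have "(\<Sum>(A, p) \<in> Sigma {A. A \<subseteq># M} (\<lambda>A. labelings W1 A \<times> labelings W2 (M - A)). ?c1 (fst p) * ?c2 (snd p)) =
        (\<Sum>A | A \<subseteq># M. \<Sum>p \<in> labelings W1 A \<times> labelings W2 (M - A). ?c1 (fst p) * ?c2 (snd p))"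
      using assms(4,5) fin by (intro sum.Sigma[symmetric]) (auto simp: finite_labelings)
    then show ?thesis
      by (simp add: sum_product sum.cartesian_product case_prod_unfold)
  qed
  finally have "(\<Sum>a \<in> labelings (W1 \<union> W2) M. contraction (B1 \<union> B2) (W1 \<union> W2) a (es1 @ es2)) =
      (\<Sum>A | A \<subseteq># M. (\<Sum>a\<in>labelings W1 A. ?c1 a) * (\<Sum>a\<in>labelings W2 (M - A). ?c2 a))"
    by (simp add: contraction_union[OF assms(1-6) sub])
  moreover have es12: "mset (es1 @ es2) = E1 + E2" using es by simp
  ultimately have "graph_weight (B1 \<union> B2) (W1 \<union> W2) (E1 + E2) M =
      symmetry_factor B1 E1 * symmetry_factor B2 E2 *
      (\<Sum>A | A \<subseteq># M. (\<Sum>a\<in>labelings W1 A. ?c1 a) * (\<Sum>a\<in>labelings W2 (M - A). ?c2 a))"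
    by (simp only: graph_weight_alt[OF es12] symmetry_factor_union[OF assms(1-3,7,8)])
  also have "\<dots> = (\<Sum>A | A \<subseteq># M. graph_weight B1 W1 E1 A * graph_weight B2 W2 E2 (M - A))"
  proof -
    have ac: "p * q * (x * y) = (p * x) * (q * y)" for p q x y :: 'r by (simp only: mult_ac)
    show ?thesis
      unfolding sum_distrib_left[of "symmetry_factor B1 E1 * symmetry_factor B2 E2" _ "{A. A \<subseteq># M}"]
        graph_weight_alt[OF es(1)] graph_weight_alt[OF es(2)] ac ..
  qed
  finally show ?thesis .
qed

end

section \<open>Decomposition into the component of a white vertex and the rest\<close>

definition edge_rel :: "(int \<times> int) multiset \<Rightarrow> (int \<times> int) set" where
  "edge_rel E = set_mset E \<union> (set_mset E)\<inverse>"

text \<open>The empty graph counts as connected here, in contrast to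
  \<open>connected_bigraph\<close>. It can only affect the coefficient at \<open>{#}\<close>, which
  \<open>euler\<close> annihilates.\<close>

definition connected_on :: "int set \<Rightarrow> int set \<Rightarrow> (int \<times> int) multiset \<Rightarrow> bool" where
  "connected_on B W E \<longleftrightarrow> (\<forall>u\<in>B \<union> W. \<forall>v\<in>B \<union> W. (u, v) \<in> (edge_rel E)\<^sup>*)"

text \<open>The valency bound comes from the order of \<open>S\<^sup>+\<close>. It leaves no
  isolated black vertex, so every component contains a white vertex.\<close>

definition edge_multisets :: "int set \<Rightarrow> int set \<Rightarrow> nat \<Rightarrow> (int \<times> int) multiset set" where
  "edge_multisets B W N = {E. set_mset E \<subseteq> B \<times> W \<and> size E = N \<and> (\<forall>v\<in>B. 2 \<le> degree_at E v)}"

definition connected_edge_multisets :: "int set \<Rightarrow> int set \<Rightarrow> nat \<Rightarrow> (int \<times> int) multiset set" where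
  "connected_edge_multisets B W N = {E \<in> edge_multisets B W N. connected_on B W E}"

lemma finite_multisets_of_size:
  assumes "finite X" shows "finite {E. set_mset E \<subseteq> X \<and> size E = N}"
proof -
  have "{E. set_mset E \<subseteq> X \<and> size E = N} \<subseteq> mset ` {xs. set xs \<subseteq> X \<and> length xs = N}"
  proof
    fix E assume "E \<in> {E. set_mset E \<subseteq> X \<and> size E = N}"
    moreover obtain xs where "E = mset xs" by (metis ex_mset)
    ultimately show "E \<in> mset ` {xs. set xs \<subseteq> X \<and> length xs = N}" by auto
  qed
  then show ?thesis by (rule finite_subset) (intro finite_imageI finite_lists_length_eq assms)
qed

lemma finite_edge_multisets: "finite B \<Longrightarrow> finite W \<Longrightarrow> finite (edge_multisets B W N)"
  by (rule finite_subset[OF _ finite_multisets_of_size[of "B \<times> W" N]]) (auto simp: edge_multisets_def)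

lemma finite_connected_edge_multisets: "finite B \<Longrightarrow> finite W \<Longrightarrow> finite (connected_edge_multisets B W N)"
  by (simp add: connected_edge_multisets_def finite_edge_multisets)

text \<open>Distinct black vertices are ends of distinct edges. Sums over \<open>n \<le> N\<close>
  black vertices therefore see all graphs with \<open>N\<close> edges.\<close>

lemma edge_multisets_empty:
  assumes "N < card B" shows "edge_multisets B W N = {}"
proof -
  have "card B \<le> N" if E: "E \<in> edge_multisets B W N" for E
  proof -
    have "B \<subseteq> fst ` set_mset E"
    proof
      fix v assume "v \<in> B"
      then have "size {#e \<in># E. fst e = v#} \<noteq> 0" using E by (force simp: edge_multisets_def degree_at_def)
      then obtain e where "e \<in># {#e \<in># E. fst e = v#}" by (metis multiset_nonemptyE size_empty)
      then show "v \<in> fst ` set_mset E" by force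
    qed
    then have "card B \<le> card (fst ` set_mset E)" by (intro card_mono) auto
    also have "\<dots> \<le> card (set_mset E)" by (rule card_image_le) simp
    also have "\<dots> \<le> size E" by (metis mset_set_set_mset_msubset size_mset_mono size_mset_set)
    finally show ?thesis using E by (simp add: edge_multisets_def)
  qed
  then show ?thesis using assms by fastforce
qed

lemma sym_edge_rel: "sym (edge_rel E)"
  by (auto simp: edge_rel_def sym_def)

lemma degree_at_filter:
  assumes "P v" shows "degree_at {#e \<in># E. P (fst e)#} v = degree_at E v"
proof -
  have "{#e \<in># {#e \<in># E. P (fst e)#}. fst e = v#} = {#e \<in># E. fst e = v#}"
    using assms by (auto simp: multiset_eq_iff)
  then show ?thesis by (simp add: degree_at_def)
qed

lemma degree_at_plus: "degree_at (E + F) v = degree_at E v + degree_at F v"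
  by (simp add: degree_at_def)

text \<open>Both ends of an edge lie in the component \<open>K\<close> of \<open>w0\<close> or
  neither does, so testing the black end splits the edges correctly and keeps all black valencies. A
  path from \<open>w0\<close> uses only edges of \<open>E1\<close>.\<close>

lemma component_decomposition:
  fixes B W :: "int set" and w0 :: int
  assumes disj: "B \<inter> W = {}" and w0: "w0 \<in> W" and E: "E \<in> edge_multisets B W N"
  defines "K \<equiv> (edge_rel E)\<^sup>* `` {w0}"
  defines "E1 \<equiv> {#e \<in># E. fst e \<in> K#}" and "E2 \<equiv> {#e \<in># E. fst e \<notin> K#}"
  shows "E1 \<in> connected_edge_multisets (B \<inter> K) (W \<inter> K) (size E1)"
    and "E2 \<in> edge_multisets (B - B \<inter> K) (W - W \<inter> K) (N - size E1)"
    and "size E1 \<le> N" and "E1 + E2 = E" and "w0 \<in> W \<inter> K"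
proof -
  have sub: "set_mset E \<subseteq> B \<times> W" and N: "size E = N" and deg: "\<And>v. v \<in> B \<Longrightarrow> 2 \<le> degree_at E v"
    using E by (auto simp: edge_multisets_def)
  have step: "x \<in> K \<Longrightarrow> (x, y) \<in> edge_rel E \<Longrightarrow> y \<in> K" for x y
    unfolding K_def by (auto intro: rtrancl_into_rtrancl)
  have edge: "b \<in> K \<longleftrightarrow> w \<in> K" if "(b, w) \<in># E" for b w
    using step[of b w] step[of w b] that by (auto simp: edge_rel_def)
  show sum: "E1 + E2 = E" by (simp add: E1_def E2_def)
  have "size E1 + size E2 = N" using N sum by (metis size_union)
  then show "size E1 \<le> N" by simp
  have size2: "size E2 = N - size E1" using \<open>size E1 + size E2 = N\<close> by simp
  show "w0 \<in> W \<inter> K" using w0 by (simp add: K_def)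
  have sub1: "set_mset E1 \<subseteq> (B \<inter> K) \<times> (W \<inter> K)" using sub edge by (auto simp: E1_def)
  have sub2: "set_mset E2 \<subseteq> (B - B \<inter> K) \<times> (W - W \<inter> K)" using sub edge by (auto simp: E2_def)
  have reach: "(w0, v) \<in> (edge_rel E1)\<^sup>*" if "v \<in> K" for v
  proof -
    have "(w0, v) \<in> (edge_rel E)\<^sup>*" using that by (simp add: K_def)
    then show ?thesis
    proof (induction rule: rtrancl_induct)
      case (step y z)
      then have "y \<in> K" by (simp add: K_def)
      then have "(y, z) \<in> edge_rel E1" using step.hyps(2) edge by (auto simp: edge_rel_def E1_def)
      then show ?case using step.IH by (rule rtrancl_into_rtrancl[rotated])
    qed simp
  qed
  have "connected_on (B \<inter> K) (W \<inter> K) E1"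
    unfolding connected_on_def
  proof (intro ballI)
    fix u v assume "u \<in> B \<inter> K \<union> W \<inter> K" "v \<in> B \<inter> K \<union> W \<inter> K"
    then have "(u, w0) \<in> (edge_rel E1)\<^sup>*" "(w0, v) \<in> (edge_rel E1)\<^sup>*"
      using reach symD[OF sym_rtrancl[OF sym_edge_rel]] by blast+
    then show "(u, v) \<in> (edge_rel E1)\<^sup>*" by (rule rtrancl_trans)
  qed
  moreover have "degree_at E1 v = degree_at E v" if "v \<in> B \<inter> K" for v
    unfolding E1_def using that by (intro degree_at_filter) auto
  ultimately show "E1 \<in> connected_edge_multisets (B \<inter> K) (W \<inter> K) (size E1)"
    using sub1 deg by (auto simp: connected_edge_multisets_def edge_multisets_def)
  have "degree_at E2 v = degree_at E v" if "v \<in> B - B \<inter> K" for v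
    unfolding E2_def using that by (intro degree_at_filter) auto
  then show "E2 \<in> edge_multisets (B - B \<inter> K) (W - W \<inter> K) (N - size E1)"
    using sub2 deg size2 by (auto simp: edge_multisets_def)
qed

text \<open>No edge of \<open>E2\<close> touches \<open>B1 \<union> W1\<close>, so a path from
  \<open>w0\<close> stays there, and connectedness of \<open>E1\<close> makes it reach everything:
  the component of \<open>w0\<close> recovers all the data.\<close>

lemma component_composition:
  fixes B W :: "int set" and w0 :: int
  assumes disj: "B \<inter> W = {}" and B1: "B1 \<subseteq> B" and W1: "W1 \<subseteq> W" "w0 \<in> W1"
    and E1: "E1 \<in> connected_edge_multisets B1 W1 N1" and E2: "E2 \<in> edge_multisets (B - B1) (W - W1) N2"
  defines "K \<equiv> (edge_rel (E1 + E2))\<^sup>* `` {w0}"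
  shows "B \<inter> K = B1" and "W \<inter> K = W1" and "{#e \<in># E1 + E2. fst e \<in> K#} = E1"
    and "{#e \<in># E1 + E2. fst e \<notin> K#} = E2" and "E1 + E2 \<in> edge_multisets B W (N1 + N2)"
proof -
  have s1: "set_mset E1 \<subseteq> B1 \<times> W1" and s2: "set_mset E2 \<subseteq> (B - B1) \<times> (W - W1)"
    and con: "connected_on B1 W1 E1"
    and size: "size E1 = N1" "size E2 = N2"
    and deg: "\<And>v. v \<in> B1 \<Longrightarrow> 2 \<le> degree_at E1 v" "\<And>v. v \<in> B - B1 \<Longrightarrow> 2 \<le> degree_at E2 v"
    using E1 E2 by (auto simp: connected_edge_multisets_def edge_multisets_def)
  have "K = B1 \<union> W1"
  proof (intro equalityI subsetI)
    fix v assume "v \<in> K"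
    then have "(w0, v) \<in> (edge_rel (E1 + E2))\<^sup>*" by (simp add: K_def)
    then show "v \<in> B1 \<union> W1"
    proof (induction rule: rtrancl_induct)
      case (step y z)
      have "(y, z) \<notin> edge_rel E2" using step.IH s2 disj B1 W1 by (auto simp: edge_rel_def)
      then have "(y, z) \<in> edge_rel E1" using step.hyps(2) by (auto simp: edge_rel_def)
      then show ?case using s1 by (auto simp: edge_rel_def)
    qed (simp add: W1)
  next
    fix v assume "v \<in> B1 \<union> W1"
    then have "(w0, v) \<in> (edge_rel E1)\<^sup>*" using con W1 by (auto simp: connected_on_def)
    moreover have "edge_rel E1 \<subseteq> edge_rel (E1 + E2)" by (auto simp: edge_rel_def)
    ultimately show "v \<in> K" unfolding K_def using rtrancl_mono by blast
  qed
  then show BK: "B \<inter> K = B1" and "W \<inter> K = W1" using disj B1 W1 by auto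
  have in1: "fst e \<in> K" if "e \<in># E1" for e using that s1 BK by auto
  have in2: "fst e \<notin> K" if "e \<in># E2" for e using that s2 BK by auto
  have "{#e \<in># E1. fst e \<in> K#} = E1" "{#e \<in># E2. fst e \<notin> K#} = E2"
    "{#e \<in># E1. fst e \<notin> K#} = {#}" "{#e \<in># E2. fst e \<in> K#} = {#}"
    using in1 in2 by (simp_all add: filter_mset_eq_conv)
  then show "{#e \<in># E1 + E2. fst e \<in> K#} = E1" "{#e \<in># E1 + E2. fst e \<notin> K#} = E2"
    by (simp_all del: filter_mset_eq_mempty_iff)
  have "2 \<le> degree_at (E1 + E2) v" if "v \<in> B" for v
    using deg[of v] that by (cases "v \<in> B1") (auto simp: degree_at_plus intro: trans_le_add1 trans_le_add2)
  then show "E1 + E2 \<in> edge_multisets B W (N1 + N2)"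
    using s1 s2 B1 W1 size by (auto simp: edge_multisets_def)
qed

text \<open>The two preceding constructions are mutually inverse. The number of edges of the
  component is a summation index of its own, since the series are graded by edges.\<close>

lemma sum_edge_multisets_decompose:
  fixes B W :: "int set" and w0 :: int
  assumes fin: "finite B" "finite W" and disj: "B \<inter> W = {}" and w0: "w0 \<in> W"
  shows "(\<Sum>E \<in> edge_multisets B W N. f E) =
    (\<Sum>B1 \<in> Pow B. \<Sum>W1 \<in> {X \<in> Pow W. w0 \<in> X}. \<Sum>N1\<le>N.
      \<Sum>E1 \<in> connected_edge_multisets B1 W1 N1. \<Sum>E2 \<in> edge_multisets (B - B1) (W - W1) (N - N1).
        f (E1 + E2))"
proof -
  let ?T = "SIGMA B1:Pow B. SIGMA W1:{X \<in> Pow W. w0 \<in> X}. SIGMA N1:{..N}.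
    SIGMA E1:connected_edge_multisets B1 W1 N1. edge_multisets (B - B1) (W - W1) (N - N1)"
  have f1: "finite (connected_edge_multisets B1 W1 N1)" "finite (edge_multisets (B - B1) (W - W1) N2)"
    if "B1 \<subseteq> B" "W1 \<subseteq> W" for B1 W1 N1 N2
    using that fin finite_subset by (auto intro!: finite_connected_edge_multisets finite_edge_multisets)
  have f2: "finite (SIGMA N1:{..N}. SIGMA E1:connected_edge_multisets B1 W1 N1. edge_multisets (B - B1) (W - W1) (N - N1))"
    if "B1 \<subseteq> B" "W1 \<subseteq> W" for B1 W1
    using that by (intro finite_SigmaI f1) auto
  have f3: "finite (SIGMA W1:{X \<in> Pow W. w0 \<in> X}. SIGMA N1:{..N}.
    SIGMA E1:connected_edge_multisets B1 W1 N1. edge_multisets (B - B1) (W - W1) (N - N1))" if "B1 \<subseteq> B" for B1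
    using that fin by (intro finite_SigmaI[OF _ f2]) auto
  have "(\<Sum>E \<in> edge_multisets B W N. f E) = (\<Sum>(B1, W1, N1, E1, E2) \<in> ?T. f (E1 + E2))"
  proof (rule sum.reindex_bij_witness[of _ "\<lambda>(B1, W1, N1, E1, E2). E1 + E2"
      "\<lambda>E. let K = (edge_rel E)\<^sup>* `` {w0}; E1 = {#e \<in># E. fst e \<in> K#} in
         (B \<inter> K, W \<inter> K, size E1, E1, {#e \<in># E. fst e \<notin> K#})"], goal_cases)
    case (1 E)
    then show ?case by (simp add: Let_def)
  next
    case (2 E)
    from component_decomposition[OF disj w0 2] show ?case by (simp add: Let_def)
  next
    case (3 p)
    obtain B1 W1 N1 E1 E2 where p: "p = (B1, W1, N1, E1, E2)" by (cases p) auto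
    then have *: "B1 \<subseteq> B" "W1 \<subseteq> W" "w0 \<in> W1" "N1 \<le> N" "E1 \<in> connected_edge_multisets B1 W1 N1"
      "E2 \<in> edge_multisets (B - B1) (W - W1) (N - N1)"
      using 3 by auto
    have "size E1 = N1" using *(5) by (simp add: connected_edge_multisets_def edge_multisets_def)
    then show ?case unfolding p using component_composition(1-4)[OF disj *(1-3,5,6)]
      by (simp only: Let_def prod.case)
  next
    case (4 p)
    obtain B1 W1 N1 E1 E2 where p: "p = (B1, W1, N1, E1, E2)" by (cases p) auto
    then have *: "B1 \<subseteq> B" "W1 \<subseteq> W" "w0 \<in> W1" "N1 \<le> N" "E1 \<in> connected_edge_multisets B1 W1 N1"
      "E2 \<in> edge_multisets (B - B1) (W - W1) (N - N1)"
      using 4 by auto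
    show ?case unfolding p using component_composition(5)[OF disj *(1-3,5,6)] *(4) by simp
  qed (simp add: Let_def)
  also have "\<dots> = (\<Sum>B1 \<in> Pow B. \<Sum>W1 \<in> {X \<in> Pow W. w0 \<in> X}. \<Sum>N1\<le>N.
      \<Sum>E1 \<in> connected_edge_multisets B1 W1 N1. \<Sum>E2 \<in> edge_multisets (B - B1) (W - W1) (N - N1).
        f (E1 + E2))"
    using fin f1 f2 f3 by (simp add: sum.Sigma case_prod_unfold)
  finally show ?thesis .
qed

text \<open>A bijection from \<open>A\<close> to \<open>A'\<close> extends to the whole type:
  \<open>A' - A\<close> and \<open>A - A'\<close> have the same size and are matched in the opposite
  direction, everything else stays fixed.\<close>

lemma ex_bij_image_eq:
  fixes A A' :: "'a set"
  assumes "finite A" "finite A'" "card A = card A'"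
  obtains \<beta> where "bij \<beta>" "\<beta> ` A = A'"
proof -
  have "card (A' - A) = card (A - A')"
    using assms card_Diff_subset_Int[of A A'] card_Diff_subset_Int[of A' A] by (simp add: Int_commute)
  then obtain g where g: "bij_betw g (A' - A) (A - A')"
    using assms finite_same_card_bij[of "A' - A" "A - A'"] by auto
  obtain h where h: "bij_betw h A A'" using assms finite_same_card_bij by blast
  define \<beta> where "\<beta> x = (if x \<in> A then h x else if x \<in> A' then g x else x)" for x
  have "bij_betw \<beta> A A'" using h by (rule bij_betw_cong[THEN iffD1, rotated]) (simp add: \<beta>_def)
  moreover have "bij_betw \<beta> (A' - A) (A - A')" using g by (rule bij_betw_cong[THEN iffD1, rotated]) (simp add: \<beta>_def)
  moreover have "bij_betw \<beta> (- (A \<union> A')) (- (A \<union> A'))"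
    using bij_betw_id by (rule bij_betw_cong[THEN iffD1, rotated]) (simp add: \<beta>_def)
  ultimately have "bij_betw \<beta> (A \<union> (A' - A) \<union> - (A \<union> A')) (A' \<union> (A - A') \<union> - (A \<union> A'))"
    by (intro bij_betw_combine) auto
  moreover have "A \<union> (A' - A) \<union> - (A \<union> A') = UNIV" "A' \<union> (A - A') \<union> - (A \<union> A') = UNIV" by auto
  ultimately have "bij \<beta>" by simp
  moreover have "\<beta> ` A = A'" using \<open>bij_betw \<beta> A A'\<close> by (simp add: bij_betw_def)
  ultimately show ?thesis by (rule that)
qed

section \<open>Transport of graphs along bijections\<close>

lemma image_mset_in_edge_multisets:
  assumes "bij \<beta>" "bij \<omega>" "E \<in> edge_multisets B W N"
  shows "image_mset (map_prod \<beta> \<omega>) E \<in> edge_multisets (\<beta> ` B) (\<omega> ` W) N"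
proof -
  have "\<beta> u = \<beta> v \<longleftrightarrow> u = v" for u v using assms(1) by (simp add: bij_def inj_eq)
  then have "degree_at (image_mset (map_prod \<beta> \<omega>) E) (\<beta> v) = degree_at E v" for v
    by (simp add: degree_at_def filter_mset_image_mset)
  then show ?thesis using assms(3) by (auto simp: edge_multisets_def)
qed

lemma image_mset_in_connected_edge_multisets:
  assumes "bij \<beta>" "bij \<omega>" "B \<inter> W = {}" "E \<in> connected_edge_multisets B W N"
  shows "image_mset (map_prod \<beta> \<omega>) E \<in> connected_edge_multisets (\<beta> ` B) (\<omega> ` W) N"
proof -
  let ?E = "image_mset (map_prod \<beta> \<omega>) E"
  \<comment> \<open>The two colour-wise bijections are glued into one map of vertices;
    \<open>B \<inter> W = {}\<close> makes it act as \<open>\<omega>\<close> on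
    \<open>W\<close>.\<close>
  let ?p = "\<lambda>v. if v \<in> B then \<beta> v else \<omega> v"
  have sub: "set_mset E \<subseteq> B \<times> W" and con: "connected_on B W E"
    using assms(4) by (auto simp: connected_edge_multisets_def edge_multisets_def)
  have path: "(?p u, ?p v) \<in> (edge_rel ?E)\<^sup>*" if "(u, v) \<in> (edge_rel E)\<^sup>*" for u v
    using that
  proof (induction rule: rtrancl_induct)
    case (step y z)
    then have "(?p y, ?p z) \<in> edge_rel ?E" using sub assms(3) by (force simp: edge_rel_def)
    then show ?case using step.IH by (rule rtrancl_into_rtrancl[rotated])
  qed simp
  have "connected_on (\<beta> ` B) (\<omega> ` W) ?E"
    unfolding connected_on_def
  proof (intro ballI)
    have pre: "\<exists>u \<in> B \<union> W. x = ?p u" if "x \<in> \<beta> ` B \<union> \<omega> ` W" for x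
      using that assms(3) by auto
    fix x y assume "x \<in> \<beta> ` B \<union> \<omega> ` W" "y \<in> \<beta> ` B \<union> \<omega> ` W"
    then obtain u v where "u \<in> B \<union> W" "v \<in> B \<union> W" "x = ?p u" "y = ?p v" using pre by metis
    then show "(x, y) \<in> (edge_rel ?E)\<^sup>*" using path con by (auto simp only: connected_on_def)
  qed
  then show ?thesis
    using assms(4) image_mset_in_edge_multisets[OF assms(1,2)] by (simp add: connected_edge_multisets_def)
qed

section \<open>The exponential formula\<close>

abbreviation blacks :: "nat \<Rightarrow> int set" where "blacks n \<equiv> {1..int n}"
abbreviation whites :: "nat \<Rightarrow> int set" where "whites m \<equiv> {- int m..-1}"

context vertex_weights
begin

definition total_weight :: "int set \<Rightarrow> int set \<Rightarrow> nat \<Rightarrow> 'd multiset \<Rightarrow> 'r" where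
  "total_weight B W N M = (\<Sum>E \<in> edge_multisets B W N. graph_weight B W E M)"

definition connected_weight :: "int set \<Rightarrow> int set \<Rightarrow> nat \<Rightarrow> 'd multiset \<Rightarrow> 'r" where
  "connected_weight B W N M = (\<Sum>E \<in> connected_edge_multisets B W N. graph_weight B W E M)"

lemma graph_weight_eq_0: "card W \<noteq> size M \<Longrightarrow> graph_weight B W E M = 0"
  using labelings_empty[of M W] by (simp add: graph_weight_def)

lemma connected_weight_eq_0: "card W \<noteq> size M \<or> N < card B \<Longrightarrow> connected_weight B W N M = 0"
  using edge_multisets_empty[of N B W] graph_weight_eq_0
  by (auto simp: connected_weight_def connected_edge_multisets_def)

lemma total_weight_eq_0: "card W \<noteq> size M \<or> N < card B \<Longrightarrow> total_weight B W N M = 0"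
  using edge_multisets_empty[of N B W] graph_weight_eq_0
  by (auto simp: total_weight_def)

lemma total_weight_relabel:
  assumes "bij \<beta>" "bij \<omega>"
  shows "total_weight (\<beta> ` B) (\<omega> ` W) N M = total_weight B W N M"
  unfolding total_weight_def
proof (rule sum.reindex_bij_witness[of _ "image_mset (map_prod (inv \<beta>) (inv \<omega>))" "image_mset (map_prod \<beta> \<omega>)", symmetric], goal_cases)
  case (2 E)
  then show ?case by (rule image_mset_in_edge_multisets[OF assms])
next
  case (4 E)
  have "inv \<beta> ` \<beta> ` B = B" "inv \<omega> ` \<omega> ` W = W"
    using assms by (simp_all add: bij_def image_inv_f_f)
  then show ?case
    using image_mset_in_edge_multisets[OF bij_imp_bij_inv[OF assms(1)] bij_imp_bij_inv[OF assms(2)] 4] by simp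
next
  case (1 E)
  have "map_prod (inv \<beta>) (inv \<omega>) (map_prod \<beta> \<omega> e) = e" for e using assms by (cases e) (simp add: bij_def)
  then show ?case by (simp add: multiset.map_comp o_def)
next
  case (3 E)
  have "map_prod \<beta> \<omega> (map_prod (inv \<beta>) (inv \<omega>) e) = e" for e
    using assms by (cases e) (simp add: bij_def surj_f_inv_f)
  then show ?case by (simp add: multiset.map_comp o_def)
next
  case (5 E)
  then show ?case by (simp add: graph_weight_relabel[OF assms])
qed

text \<open>Disjointness is assumed before and after, because connectedness is transported along the
  bijections and back along their inverses.\<close>

lemma connected_weight_relabel:
  assumes "bij \<beta>" "bij \<omega>" "B \<inter> W = {}" "\<beta> ` B \<inter> \<omega> ` W = {}"
  shows "connected_weight (\<beta> ` B) (\<omega> ` W) N M = connected_weight B W N M"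
  unfolding connected_weight_def
proof (rule sum.reindex_bij_witness[of _ "image_mset (map_prod (inv \<beta>) (inv \<omega>))" "image_mset (map_prod \<beta> \<omega>)", symmetric], goal_cases)
  case (2 E)
  then show ?case by (rule image_mset_in_connected_edge_multisets[OF assms(1-3)])
next
  case (4 E)
  have "inv \<beta> ` \<beta> ` B = B" "inv \<omega> ` \<omega> ` W = W"
    using assms by (simp_all add: bij_def image_inv_f_f)
  then show ?case
    using image_mset_in_connected_edge_multisets[OF bij_imp_bij_inv[OF assms(1)] bij_imp_bij_inv[OF assms(2)] assms(4) 4] by simp
next
  case (1 E)
  have "map_prod (inv \<beta>) (inv \<omega>) (map_prod \<beta> \<omega> e) = e" for e using assms by (cases e) (simp add: bij_def)
  then show ?case by (simp add: multiset.map_comp o_def)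
next
  case (3 E)
  have "map_prod \<beta> \<omega> (map_prod (inv \<beta>) (inv \<omega>) e) = e" for e
    using assms by (cases e) (simp add: bij_def surj_f_inv_f)
  then show ?case by (simp add: multiset.map_comp o_def)
next
  case (5 E)
  then show ?case by (simp add: graph_weight_relabel[OF assms(1,2)])
qed

text \<open>Weights depend on cardinalities only, so in the decomposition the sums over subsets
  become binomial sums over standard vertex sets.\<close>

lemma total_weight_card:
  assumes "finite B" "finite W"
  shows "total_weight B W N M = total_weight (blacks (card B)) (whites (card W)) N M"
proof -
  obtain \<beta> where \<beta>: "bij \<beta>" "\<beta> ` B = blacks (card B)"
    using ex_bij_image_eq[of B "blacks (card B)"] assms by auto
  obtain \<omega> where \<omega>: "bij \<omega>" "\<omega> ` W = whites (card W)"
    using ex_bij_image_eq[of W "whites (card W)"] assms by auto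
  show ?thesis using total_weight_relabel[OF \<beta>(1) \<omega>(1), of B W] \<beta> \<omega> by simp
qed

lemma connected_weight_card:
  assumes "finite B" "finite W" "B \<inter> W = {}"
  shows "connected_weight B W N M = connected_weight (blacks (card B)) (whites (card W)) N M"
proof -
  obtain \<beta> where \<beta>: "bij \<beta>" "\<beta> ` B = blacks (card B)"
    using ex_bij_image_eq[of B "blacks (card B)"] assms by auto
  obtain \<omega> where \<omega>: "bij \<omega>" "\<omega> ` W = whites (card W)"
    using ex_bij_image_eq[of W "whites (card W)"] assms by auto
  have "\<beta> ` B \<inter> \<omega> ` W = {}" unfolding \<beta> \<omega> by auto
  then show ?thesis using connected_weight_relabel[OF \<beta>(1) \<omega>(1) assms(3)] \<beta> \<omega> by simp
qed

lemma total_weight_decompose: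
  assumes fin: "finite B" "finite W" and disj: "B \<inter> W = {}" and w0: "w0 \<in> W"
  shows "total_weight B W N M = (\<Sum>B1 \<in> Pow B. \<Sum>W1 \<in> {X \<in> Pow W. w0 \<in> X}. \<Sum>N1\<le>N. \<Sum>A | A \<subseteq># M.
      connected_weight B1 W1 N1 A * total_weight (B - B1) (W - W1) (N - N1) (M - A))"
proof -
  have "(\<Sum>E1 \<in> connected_edge_multisets B1 W1 N1. \<Sum>E2 \<in> edge_multisets (B - B1) (W - W1) N2.
        graph_weight B W (E1 + E2) M) =
      (\<Sum>A | A \<subseteq># M. connected_weight B1 W1 N1 A * total_weight (B - B1) (W - W1) N2 (M - A))"
    if "B1 \<in> Pow B" "W1 \<in> {X \<in> Pow W. w0 \<in> X}" for B1 W1 N1 N2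
  proof -
    have f: "finite B1" "finite W1" using that fin finite_subset by auto
    have u: "B1 \<union> (B - B1) = B" "W1 \<union> (W - W1) = W" using that by auto
    have "(\<Sum>E1 \<in> connected_edge_multisets B1 W1 N1. \<Sum>E2 \<in> edge_multisets (B - B1) (W - W1) N2.
        graph_weight B W (E1 + E2) M) =
      (\<Sum>E1 \<in> connected_edge_multisets B1 W1 N1. \<Sum>E2 \<in> edge_multisets (B - B1) (W - W1) N2.
        \<Sum>A | A \<subseteq># M. graph_weight B1 W1 E1 A * graph_weight (B - B1) (W - W1) E2 (M - A))"
    proof (intro sum.cong refl)
      fix E1 E2 assume "E1 \<in> connected_edge_multisets B1 W1 N1" "E2 \<in> edge_multisets (B - B1) (W - W1) N2"
      then have "set_mset E1 \<subseteq> B1 \<times> W1" "set_mset E2 \<subseteq> (B - B1) \<times> (W - W1)"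
        by (auto simp: connected_edge_multisets_def edge_multisets_def)
      then show "graph_weight B W (E1 + E2) M =
          (\<Sum>A | A \<subseteq># M. graph_weight B1 W1 E1 A * graph_weight (B - B1) (W - W1) E2 (M - A))"
        using graph_weight_union[of B1 "B - B1" W1 "W - W1" E1 E2 M] f fin u by auto
    qed
    also have "\<dots> = (\<Sum>E1 \<in> connected_edge_multisets B1 W1 N1. \<Sum>A | A \<subseteq># M. \<Sum>E2 \<in> edge_multisets (B - B1) (W - W1) N2.
        graph_weight B1 W1 E1 A * graph_weight (B - B1) (W - W1) E2 (M - A))"
      by (intro sum.cong[OF refl] sum.swap)
    also have "\<dots> = (\<Sum>A | A \<subseteq># M. \<Sum>E1 \<in> connected_edge_multisets B1 W1 N1. \<Sum>E2 \<in> edge_multisets (B - B1) (W - W1) N2.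
        graph_weight B1 W1 E1 A * graph_weight (B - B1) (W - W1) E2 (M - A))"
      by (rule sum.swap)
    finally show ?thesis unfolding connected_weight_def total_weight_def sum_product .
  qed
  then show ?thesis
    unfolding total_weight_def[of B W] sum_edge_multisets_decompose[OF assms]
    by (intro sum.cong refl) auto
qed

end

section \<open>Sums over subsets by cardinality\<close>

lemma sum_Pow_card:
  assumes "finite X"
  shows "(\<Sum>A \<in> Pow X. h (card A)) = (\<Sum>k\<le>card X. of_nat (card X choose k) * (h k :: 'a::comm_ring_1))"
proof -
  have "(\<Sum>A \<in> Pow X. h (card A)) = (\<Sum>k\<le>card X. \<Sum>A \<in> {A \<in> Pow X. card A = k}. h (card A))"
    by (rule sum.group[symmetric]) (use assms in \<open>auto intro: card_mono\<close>)
  also have "\<dots> = (\<Sum>k\<le>card X. of_nat (card {A \<in> Pow X. card A = k}) * h k)"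
    by (intro sum.cong refl) simp
  finally show ?thesis using n_subsets[OF assms] by (simp add: Pow_def)
qed

lemma sum_Pow_card_containing:
  assumes "finite X" "x \<in> X"
  shows "(\<Sum>A \<in> {A \<in> Pow X. x \<in> A}. h (card A)) =
    (\<Sum>k\<in>{1..card X}. of_nat ((card X - 1) choose (k - 1)) * (h k :: 'a::comm_ring_1))"
proof -
  have "(\<Sum>A \<in> {A \<in> Pow X. x \<in> A}. h (card A)) = (\<Sum>A \<in> Pow (X - {x}). h (Suc (card A)))"
  proof (rule sum.reindex_bij_witness[of _ "insert x" "\<lambda>A. A - {x}"], goal_cases)
    case (5 A)
    then have "finite A" using assms finite_subset by auto
    then show ?case using 5 card_Suc_Diff1[of A x] by simp
  qed (use assms in auto)
  also have "\<dots> = (\<Sum>k\<le>card X - 1. of_nat ((card X - 1) choose k) * h (Suc k))"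
    using sum_Pow_card[of "X - {x}" "\<lambda>k. h (Suc k)"] assms by simp
  also have "\<dots> = (\<Sum>k\<in>{1..card X}. of_nat ((card X - 1) choose (k - 1)) * h k)"
  proof (rule sum.reindex_bij_witness[of _ "\<lambda>k. k - 1" Suc], goal_cases)
    case (2 k)
    have "card X > 0" using assms card_gt_0_iff by blast
    then show ?case using 2 by auto
  qed auto
  finally show ?thesis .
qed

lemma sum_swap_pairs:
  "(\<Sum>i\<in>I. \<Sum>k\<in>K. \<Sum>x\<in>X. \<Sum>y\<in>Y. f i k x y) = (\<Sum>x\<in>X. \<Sum>y\<in>Y. \<Sum>i\<in>I. \<Sum>k\<in>K. f i k x y)"
proof -
  have "(\<Sum>i\<in>I. \<Sum>k\<in>K. \<Sum>x\<in>X. \<Sum>y\<in>Y. f i k x y) = (\<Sum>i\<in>I. \<Sum>x\<in>X. \<Sum>k\<in>K. \<Sum>y\<in>Y. f i k x y)"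
    by (rule sum.cong[OF refl], rule sum.swap)
  also have "\<dots> = (\<Sum>x\<in>X. \<Sum>i\<in>I. \<Sum>k\<in>K. \<Sum>y\<in>Y. f i k x y)" by (rule sum.swap)
  also have "\<dots> = (\<Sum>x\<in>X. \<Sum>i\<in>I. \<Sum>y\<in>Y. \<Sum>k\<in>K. f i k x y)"
    by (rule sum.cong[OF refl], rule sum.cong[OF refl], rule sum.swap)
  also have "\<dots> = (\<Sum>x\<in>X. \<Sum>y\<in>Y. \<Sum>i\<in>I. \<Sum>k\<in>K. f i k x y)"
    by (rule sum.cong[OF refl], rule sum.swap)
  finally show ?thesis .
qed

text \<open>Marking one of all \<open>m\<close> vertices and completing its component of size
  \<open>a\<close> amounts to choosing the component and marking a vertex in it. So the Euler factor
  \<open>m\<close> of the whole graph becomes the Euler factor \<open>a\<close> of the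
  component.\<close>

lemma of_nat_mult_binomial_div_fact:
  assumes "1 \<le> a" "a \<le> m"
  shows "of_nat m * of_nat ((m - 1) choose (a - 1)) / fact m = (of_nat a / (fact a * fact (m - a)) :: 'a::field_char_0)"
proof -
  obtain a' m' where am: "a = Suc a'" "m = Suc m'" using assms by (metis Suc_le_D One_nat_def Suc_le_mono le_trans)
  then have le: "a' \<le> m'" using assms by simp
  have "of_nat (m' choose a') = (fact m' / (fact a' * fact (m' - a')) :: 'a)"
    by (rule binomial_fact[OF le])
  then show ?thesis
    by (simp add: am field_simps del: of_nat_Suc)
qed

context vertex_weights
begin

text \<open>The exponential generating series of numbered graphs. The number of white vertices is
  forced by the degree of \<open>M\<close>, the number of black ones is bounded by the number of
  edges.\<close>

definition total_series :: "'d multiset \<Rightarrow> 'r fps" where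
  "total_series M = Abs_fps (\<lambda>N. \<Sum>n\<le>N.
     total_weight (blacks n) (whites (size M)) N M / (fact n * fact (size M)))"

definition connected_series :: "'d multiset \<Rightarrow> 'r fps" where
  "connected_series M = Abs_fps (\<lambda>N. \<Sum>n\<le>N.
     connected_weight (blacks n) (whites (size M)) N M / (fact n * fact (size M)))"

text \<open>White vertices are interchangeable, so the marked one may be fixed as \<open>-1\<close>
  at the price of a factor \<open>m\<close>; the factorials then distribute over the component and
  the rest.\<close>

theorem euler_total_series:
  "euler total_series M = series_mult total_series (euler connected_series) M"
proof (rule fps_ext)
  fix N
  define m where "m = size M"
  define c where "c n N A = connected_weight (blacks n) (whites (size A)) N A / (fact n * fact (size A))" for n N A
  define t where "t n N A = total_weight (blacks n) (whites (size A)) N A / (fact n * fact (size A))" for n N A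
  have c0: "c n N A = 0" if "N < n" for n N A using that by (simp add: c_def connected_weight_eq_0)
  have t0: "t n N A = 0" if "N < n" for n N A using that by (simp add: t_def total_weight_eq_0)
  have fin: "finite {A. A \<subseteq># M}" by (rule finite_submultisets)
  \<comment> \<open>Both factors vanish when there are more black vertices than edges, so the
    triangle \<open>i + j \<le> N\<close> shrinks to a rectangle, over which the sum
    factors.\<close>
  have conv: "(\<Sum>n\<le>N. \<Sum>i\<le>n. c i N1 A * t (n - i) (N - N1) (M - A)) =
      (\<Sum>i\<le>N1. c i N1 A) * (\<Sum>j\<le>N - N1. t j (N - N1) (M - A))" if "N1 \<le> N" for N1 A
  proof -
    have "(\<Sum>n\<le>N. \<Sum>i\<le>n. c i N1 A * t (n - i) (N - N1) (M - A)) =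
        (\<Sum>(i, j)\<in>{(i, j). i + j \<le> N}. c i N1 A * t j (N - N1) (M - A))"
      by (rule sum.triangle_reindex_eq[symmetric])
    also have "\<dots> = (\<Sum>(i, j)\<in>{..N1} \<times> {..N - N1}. c i N1 A * t j (N - N1) (M - A))"
    proof (rule sum.mono_neutral_right)
      show "finite {(i, j). i + j \<le> N}"
        by (rule finite_subset[of _ "{..N} \<times> {..N}"]) auto
      show "\<forall>p\<in>{(i, j). i + j \<le> N} - {..N1} \<times> {..N - N1}. (case p of (i, j) \<Rightarrow> c i N1 A * t j (N - N1) (M - A)) = 0"
        using c0 t0 by (auto simp: not_less[symmetric])
    qed (use that in auto)
    finally show ?thesis by (simp add: sum_product sum.cartesian_product)
  qed
  have key: "of_nat m * t n N M = (\<Sum>N1\<le>N. \<Sum>A | A \<subseteq># M. of_nat (size A) * (\<Sum>i\<le>n. c i N1 A * t (n - i) (N - N1) (M - A)))"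
    for n
  proof (cases "m = 0")
    case True
    then show ?thesis by (simp add: m_def)
  next
    case False
    have w0: "-1 \<in> whites m" using False by simp
    let ?g = "\<lambda>N1 A i k. connected_weight (blacks i) (whites k) N1 A * total_weight (blacks (n - i)) (whites (m - k)) (N - N1) (M - A)"
    have "total_weight (blacks n) (whites m) N M =
        (\<Sum>B1 \<in> Pow (blacks n). \<Sum>W1 \<in> {X \<in> Pow (whites m). -1 \<in> X}.
          \<Sum>N1\<le>N. \<Sum>A | A \<subseteq># M. ?g N1 A (card B1) (card W1))"
    proof (subst total_weight_decompose[OF finite_atLeastAtMost_int finite_atLeastAtMost_int _ w0], goal_cases)
      case 2
      show ?case
      proof (intro sum.cong refl)
        fix B1 W1 N1 A assume "B1 \<in> Pow (blacks n)" "W1 \<in> {X \<in> Pow (whites m). -1 \<in> X}"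
        then have sub: "B1 \<subseteq> blacks n" "W1 \<subseteq> whites m" by auto
        have f: "finite B1" "finite W1" using sub finite_subset by blast+
        have d: "B1 \<inter> W1 = {}" using sub by fastforce
        have "card (blacks n - B1) = n - card B1" "card (whites m - W1) = m - card W1"
          using sub f by (simp_all add: card_Diff_subset)
        then show "connected_weight B1 W1 N1 A * total_weight (blacks n - B1) (whites m - W1) (N - N1) (M - A) =
            ?g N1 A (card B1) (card W1)"
          using connected_weight_card[OF f d] total_weight_card[of "blacks n - B1" "whites m - W1"] by simp
      qed
    qed auto
    also have "\<dots> = (\<Sum>i\<le>n. of_nat (n choose i) * (\<Sum>k\<in>{1..m}. of_nat ((m - 1) choose (k - 1)) *
        (\<Sum>N1\<le>N. \<Sum>A | A \<subseteq># M. ?g N1 A i k)))"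
      using sum_Pow_card_containing[of "whites m" "-1" "\<lambda>k. \<Sum>N1\<le>N. \<Sum>A | A \<subseteq># M. ?g N1 A _ k"] w0
        sum_Pow_card[of "blacks n" "\<lambda>i. (\<Sum>k\<in>{1..m}. of_nat ((m - 1) choose (k - 1)) *
          (\<Sum>N1\<le>N. \<Sum>A | A \<subseteq># M. ?g N1 A i k))"]
      by simp
    also have "\<dots> = (\<Sum>N1\<le>N. \<Sum>A | A \<subseteq># M. \<Sum>i\<le>n. \<Sum>k\<in>{1..m}.
        of_nat (n choose i) * of_nat ((m - 1) choose (k - 1)) * ?g N1 A i k)"
      unfolding sum_distrib_left by (subst sum_swap_pairs) (simp only: mult.assoc)
    \<comment> \<open>A labeling with monomial \<open>A\<close> needs exactly \<open>size A\<close>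
      white vertices, so at most one \<open>k\<close> survives, and none for \<open>A = {#}\<close>,
      because the component contains \<open>-1\<close>.\<close>
    also have "\<dots> = (\<Sum>N1\<le>N. \<Sum>A | A \<subseteq># M. \<Sum>i\<le>n.
        if A = {#} then 0 else of_nat (n choose i) * of_nat ((m - 1) choose (size A - 1)) * ?g N1 A i (size A))"
    proof (intro sum.cong refl)
      fix N1 A i assume A: "A \<in> {A. A \<subseteq># M}"
      have le: "size A \<le> m" using A size_mset_mono by (auto simp: m_def)
      have "(\<Sum>k\<in>{1..m}. of_nat (n choose i) * of_nat ((m - 1) choose (k - 1)) * ?g N1 A i k) =
          (\<Sum>k\<in>{1..m}. if k = size A then of_nat (n choose i) * of_nat ((m - 1) choose (k - 1)) * ?g N1 A i k else 0)"
        by (intro sum.cong refl) (auto simp: connected_weight_eq_0)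
      also have "\<dots> = (if size A \<in> {1..m} then of_nat (n choose i) * of_nat ((m - 1) choose (size A - 1)) * ?g N1 A i (size A) else 0)"
        by (simp add: sum.delta)
      finally show "(\<Sum>k\<in>{1..m}. of_nat (n choose i) * of_nat ((m - 1) choose (k - 1)) * ?g N1 A i k) =
          (if A = {#} then 0 else of_nat (n choose i) * of_nat ((m - 1) choose (size A - 1)) * ?g N1 A i (size A))"
        using le by (auto simp: Suc_le_eq nonempty_has_size)
    qed
    finally have tw: "total_weight (blacks n) (whites m) N M = \<dots>" .
    have "of_nat m * t n N M = (\<Sum>N1\<le>N. \<Sum>A | A \<subseteq># M. \<Sum>i\<le>n. of_nat m / (fact n * fact m) *
        (if A = {#} then 0 else of_nat (n choose i) * of_nat ((m - 1) choose (size A - 1)) * ?g N1 A i (size A)))"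
      unfolding t_def m_def[symmetric] tw by (simp add: sum_distrib_left sum_divide_distrib)
    also have "\<dots> = (\<Sum>N1\<le>N. \<Sum>A | A \<subseteq># M. \<Sum>i\<le>n. of_nat (size A) * (c i N1 A * t (n - i) (N - N1) (M - A)))"
    proof (intro sum.cong refl)
      fix N1 A i assume A: "A \<in> {A. A \<subseteq># M}" and i: "i \<in> {..n}"
      show "of_nat m / (fact n * fact m) *
        (if A = {#} then 0 else of_nat (n choose i) * of_nat ((m - 1) choose (size A - 1)) * ?g N1 A i (size A)) =
        of_nat (size A) * (c i N1 A * t (n - i) (N - N1) (M - A))"
      proof (cases "A = {#}")
        case False
        have le: "size A \<le> m" using A size_mset_mono by (auto simp: m_def)
        have sz: "size (M - A) = m - size A" using A by (simp add: size_Diff_submset m_def)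
        have 1: "1 \<le> size A" using False by (simp add: Suc_le_eq nonempty_has_size)
        have "of_nat m / (fact n * fact m) * (of_nat (n choose i) * of_nat ((m - 1) choose (size A - 1)) * ?g N1 A i (size A)) =
            (of_nat (n choose i) / fact n) * (of_nat m * of_nat ((m - 1) choose (size A - 1)) / fact m) * ?g N1 A i (size A)"
          by simp
        also have "of_nat (n choose i) / fact n = (1 / (fact i * fact (n - i)) :: 'r)"
          using i by (simp add: binomial_fact)
        also have "of_nat m * of_nat ((m - 1) choose (size A - 1)) / fact m = (of_nat (size A) / (fact (size A) * fact (m - size A)) :: 'r)"
          by (rule of_nat_mult_binomial_div_fact[OF 1 le])
        finally show ?thesis using False by (simp add: c_def t_def sz)
      qed simp
    qed
    finally show ?thesis by (simp add: sum_distrib_left)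
  qed
  have "fps_nth (euler total_series M) N = (\<Sum>n\<le>N. of_nat m * t n N M)"
    by (simp add: euler_def total_series_def t_def m_def sum_distrib_left fps_of_nat[symmetric] del: fps_of_nat)
  also have "\<dots> = (\<Sum>N1\<le>N. \<Sum>A | A \<subseteq># M. \<Sum>n\<le>N. of_nat (size A) * (\<Sum>i\<le>n. c i N1 A * t (n - i) (N - N1) (M - A)))"
    unfolding key by (subst sum.swap) (intro sum.cong refl sum.swap)
  also have "\<dots> = (\<Sum>N1\<le>N. \<Sum>A | A \<subseteq># M. of_nat (size A) * ((\<Sum>i\<le>N1. c i N1 A) * (\<Sum>j\<le>N - N1. t j (N - N1) (M - A))))"
    unfolding sum_distrib_left[symmetric] by (intro sum.cong refl) (simp add: conv)
  also have "\<dots> = (\<Sum>A | A \<subseteq># M. \<Sum>N1\<le>N. of_nat (size A) * ((\<Sum>i\<le>N1. c i N1 A) * (\<Sum>j\<le>N - N1. t j (N - N1) (M - A))))"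
    by (rule sum.swap)
  also have "\<dots> = fps_nth (series_mult (euler connected_series) total_series M) N"
  proof -
    have "fps_nth (euler connected_series A * total_series (M - A)) N =
        (\<Sum>N1\<le>N. of_nat (size A) * ((\<Sum>i\<le>N1. c i N1 A) * (\<Sum>j\<le>N - N1. t j (N - N1) (M - A))))" for A
    proof -
      have "fps_nth (euler connected_series A * total_series (M - A)) N =
          of_nat (size A) * fps_nth (connected_series A * total_series (M - A)) N"
        unfolding euler_def mult.assoc by (metis fps_mult_left_const_nth fps_of_nat)
      also have "fps_nth (connected_series A * total_series (M - A)) N =
          (\<Sum>N1\<le>N. (\<Sum>i\<le>N1. c i N1 A) * (\<Sum>j\<le>N - N1. t j (N - N1) (M - A)))"
        by (simp only: fps_mult_nth atLeast0AtMost total_series_def connected_series_def c_def t_def fps_nth_Abs_fps)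
      finally show ?thesis by (simp only: sum_distrib_left)
    qed
    then show ?thesis by (simp add: series_mult_def fps_sum_nth)
  qed
  finally show "fps_nth (euler total_series M) N = fps_nth (series_mult total_series (euler connected_series) M) N"
    by (simp add: series_mult_commute)
qed

end

section \<open>Isomorphism classes of graphs\<close>

definition vertex_perms :: "bigraph \<Rightarrow> ((int \<Rightarrow> int) \<times> (int \<Rightarrow> int)) set" where
  "vertex_perms \<gamma> = {\<sigma>. \<sigma> permutes black \<gamma>} \<times> {\<tau>. \<tau> permutes white \<gamma>}"

definition relabel :: "(int \<Rightarrow> int) \<times> (int \<Rightarrow> int) \<Rightarrow> bigraph \<Rightarrow> bigraph" where
  "relabel p \<gamma> = Bigraph (nblack \<gamma>) (nwhite \<gamma>) (image_mset (map_prod (fst p) (snd p)) (edges \<gamma>))"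

lemma relabel_simps [simp]:
  "nblack (relabel p \<gamma>) = nblack \<gamma>" "nwhite (relabel p \<gamma>) = nwhite \<gamma>"
  "black (relabel p \<gamma>) = black \<gamma>" "white (relabel p \<gamma>) = white \<gamma>"
  "size (edges (relabel p \<gamma>)) = size (edges \<gamma>)"
  "edges (relabel p \<gamma>) = image_mset (map_prod (fst p) (snd p)) (edges \<gamma>)"
  by (simp_all add: relabel_def black_def white_def)

lemma finite_black [simp]: "finite (black \<gamma>)" and finite_white [simp]: "finite (white \<gamma>)"
  by (simp_all add: black_def white_def)

lemma black_white_disjoint: "black \<gamma> \<inter> white \<gamma> = {}"
  by (auto simp: black_def white_def)

lemma finite_vertex_perms: "finite (vertex_perms \<gamma>)"
  by (simp add: vertex_perms_def finite_permutations)

lemma card_vertex_perms: "card (vertex_perms \<gamma>) = fact (nblack \<gamma>) * fact (nwhite \<gamma>)"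
  by (simp add: vertex_perms_def card_cartesian_product card_permutations[OF refl] black_def white_def)

text \<open>Isomorphisms become an action of the permutations of both vertex sets. Well-formedness
  confines the edges to black-white pairs, the only ones whose multiplicities \<open>isos\<close>
  controls.\<close>

lemma isos_iff:
  assumes "wf_bigraph \<gamma>" "wf_bigraph \<delta>"
  shows "p \<in> isos \<gamma> \<delta> \<longleftrightarrow> p \<in> vertex_perms \<gamma> \<and> relabel p \<gamma> = \<delta>"
proof (cases p)
  case (Pair \<sigma> \<tau>)
  show ?thesis
  proof
    assume p: "p \<in> isos \<gamma> \<delta>"
    then have st: "\<sigma> permutes black \<gamma>" "\<tau> permutes white \<gamma>"
      and n: "nblack \<gamma> = nblack \<delta>" "nwhite \<gamma> = nwhite \<delta>"
      and c: "\<And>b w. b \<in> black \<gamma> \<Longrightarrow> w \<in> white \<gamma> \<Longrightarrow> count (edges \<delta>) (\<sigma> b, \<tau> w) = count (edges \<gamma>) (b, w)"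
      by (auto simp: isos_def Pair)
    have bw: "black \<delta> = black \<gamma>" "white \<delta> = white \<gamma>" using n by (simp_all add: black_def white_def)
    have inj: "inj (map_prod \<sigma> \<tau>)" using st by (intro prod.inj_map permutes_inj)
    have "image_mset (map_prod \<sigma> \<tau>) (edges \<gamma>) = edges \<delta>"
    proof (rule multiset_eqI)
      fix e
      show "count (image_mset (map_prod \<sigma> \<tau>) (edges \<gamma>)) e = count (edges \<delta>) e"
      proof (cases "e \<in> black \<gamma> \<times> white \<gamma>")
        case True
        then have "fst e \<in> \<sigma> ` black \<gamma>" "snd e \<in> \<tau> ` white \<gamma>"
          using permutes_image[OF st(1)] permutes_image[OF st(2)] by auto
        then obtain b w where "b \<in> black \<gamma>" "w \<in> white \<gamma>" "fst e = \<sigma> b" "snd e = \<tau> w" by blast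
        then have bw': "b \<in> black \<gamma>" "w \<in> white \<gamma>" "e = map_prod \<sigma> \<tau> (b, w)" by (auto simp: prod_eq_iff)
        then show ?thesis using c[OF bw'(1,2)] count_image_mset_of_inj[OF inj] by (metis map_prod_simp)
      next
        case False
        have "e \<notin># edges \<delta>" using False assms(2) bw by (auto simp: wf_bigraph_def)
        moreover have "e \<notin># image_mset (map_prod \<sigma> \<tau>) (edges \<gamma>)"
          using False assms(1) permutes_in_image[OF st(1)] permutes_in_image[OF st(2)]
          by (auto simp: wf_bigraph_def)
        ultimately show ?thesis by (metis count_eq_zero_iff)
      qed
    qed
    then show "p \<in> vertex_perms \<gamma> \<and> relabel p \<gamma> = \<delta>"
      using st n by (simp add: vertex_perms_def relabel_def Pair)
  next
    assume p: "p \<in> vertex_perms \<gamma> \<and> relabel p \<gamma> = \<delta>"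
    then have st: "\<sigma> permutes black \<gamma>" "\<tau> permutes white \<gamma>" by (auto simp: vertex_perms_def Pair)
    have inj: "inj (map_prod \<sigma> \<tau>)" using st by (intro prod.inj_map permutes_inj)
    have "count (edges (relabel p \<gamma>)) (\<sigma> b, \<tau> w) = count (edges \<gamma>) (b, w)" for b w
      using count_image_mset_of_inj[OF inj, of "edges \<gamma>" "(b, w)"] by (simp add: Pair)
    then show "p \<in> isos \<gamma> \<delta>" using st p unfolding isos_def Pair by auto
  qed
qed

lemma relabel_comp: "relabel (\<sigma>' \<circ> \<sigma>, \<tau>' \<circ> \<tau>) \<gamma> = relabel (\<sigma>', \<tau>') (relabel (\<sigma>, \<tau>) \<gamma>)"
  by (simp add: relabel_def multiset.map_comp prod.map_comp o_def)

text \<open>Composition with one fixed isomorphism identifies the automorphisms of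
  \<open>\<gamma>\<close> with the isomorphisms to \<open>\<delta>\<close>.\<close>

lemma card_isos:
  assumes "wf_bigraph \<gamma>" "wf_bigraph \<delta>" "isos \<gamma> \<delta> \<noteq> {}"
  shows "card (isos \<gamma> \<delta>) = card (sym_group \<gamma>)"
proof -
  obtain \<sigma>0 \<tau>0 where p0: "(\<sigma>0, \<tau>0) \<in> vertex_perms \<gamma>" "relabel (\<sigma>0, \<tau>0) \<gamma> = \<delta>"
    using assms(3) isos_iff[OF assms(1,2)] by auto
  then have st: "\<sigma>0 permutes black \<gamma>" "\<tau>0 permutes white \<gamma>" by (auto simp: vertex_perms_def)
  have iv: "inv \<sigma>0 \<circ> \<sigma>0 = id" "\<sigma>0 \<circ> inv \<sigma>0 = id" "inv \<tau>0 \<circ> \<tau>0 = id" "\<tau>0 \<circ> inv \<tau>0 = id"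
    using permutes_inv_o[OF st(1)] permutes_inv_o[OF st(2)] by auto
  have id_relabel: "relabel (id, id) \<gamma> = \<gamma>" by (cases \<gamma>) (simp add: relabel_def prod.map_id0)
  have undo: "relabel (inv \<sigma>0, inv \<tau>0) \<delta> = \<gamma>"
    using p0(2) relabel_comp[of "inv \<sigma>0" \<sigma>0 "inv \<tau>0" \<tau>0 \<gamma>] iv id_relabel by simp
  have "bij_betw (\<lambda>(\<sigma>, \<tau>). (\<sigma>0 \<circ> \<sigma>, \<tau>0 \<circ> \<tau>)) (isos \<gamma> \<gamma>) (isos \<gamma> \<delta>)"
  proof (rule bij_betw_byWitness[where f' = "\<lambda>(\<sigma>, \<tau>). (inv \<sigma>0 \<circ> \<sigma>, inv \<tau>0 \<circ> \<tau>)"])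
    show "\<forall>a\<in>isos \<gamma> \<gamma>. (\<lambda>(\<sigma>, \<tau>). (inv \<sigma>0 \<circ> \<sigma>, inv \<tau>0 \<circ> \<tau>)) ((\<lambda>(\<sigma>, \<tau>). (\<sigma>0 \<circ> \<sigma>, \<tau>0 \<circ> \<tau>)) a) = a"
      by (auto simp: o_assoc iv)
    show "\<forall>a\<in>isos \<gamma> \<delta>. (\<lambda>(\<sigma>, \<tau>). (\<sigma>0 \<circ> \<sigma>, \<tau>0 \<circ> \<tau>)) ((\<lambda>(\<sigma>, \<tau>). (inv \<sigma>0 \<circ> \<sigma>, inv \<tau>0 \<circ> \<tau>)) a) = a"
      by (auto simp: o_assoc iv)
    show "(\<lambda>(\<sigma>, \<tau>). (\<sigma>0 \<circ> \<sigma>, \<tau>0 \<circ> \<tau>)) ` isos \<gamma> \<gamma> \<subseteq> isos \<gamma> \<delta>"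
      using st by (auto simp: isos_iff[OF assms(1,1)] isos_iff[OF assms(1,2)] relabel_comp p0(2) vertex_perms_def intro: permutes_compose)
    show "(\<lambda>(\<sigma>, \<tau>). (inv \<sigma>0 \<circ> \<sigma>, inv \<tau>0 \<circ> \<tau>)) ` isos \<gamma> \<delta> \<subseteq> isos \<gamma> \<gamma>"
      using permutes_inv[OF st(1)] permutes_inv[OF st(2)]
      by (auto simp: isos_iff[OF assms(1,1)] isos_iff[OF assms(1,2)] relabel_comp undo vertex_perms_def
          intro: permutes_compose)
  qed
  then show ?thesis unfolding sym_group_def by (rule bij_betw_same_card[symmetric])
qed

lemma vdegree_black:
  assumes "wf_bigraph \<gamma>" "v \<in> black \<gamma>"
  shows "vdegree \<gamma> v = degree_at (edges \<gamma>) v"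
proof -
  have "{#e \<in># edges \<gamma>. fst e = v \<or> snd e = v#} = {#e \<in># edges \<gamma>. fst e = v#}"
    using assms black_white_disjoint by (intro filter_mset_cong refl) (fastforce simp: wf_bigraph_def)
  then show ?thesis by (simp add: vdegree_def degree_at_def)
qed

lemma connected_bigraph_iff:
  "connected_bigraph \<gamma> \<longleftrightarrow> vertices \<gamma> \<noteq> {} \<and> connected_on (black \<gamma>) (white \<gamma>) (edges \<gamma>)"
  by (simp add: connected_bigraph_def connected_on_def edge_rel_def vertices_def)

text \<open>The one-vertex graph \<open>\<bullet>\<close> is the only element without white vertices; in all others
  connectedness excludes isolated black vertices, so that black vertices have valency at least 2.\<close>

lemma Gamma_circ_iff:
  "\<gamma> \<in> Gamma_circ \<longleftrightarrow> \<gamma> = Bigraph 1 0 {#} \<or>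
     nwhite \<gamma> \<noteq> 0 \<and> edges \<gamma> \<in> connected_edge_multisets (black \<gamma>) (white \<gamma>) (size (edges \<gamma>))"
proof (cases "nwhite \<gamma> = 0")
  case True
  then have w: "white \<gamma> = {}" by (simp add: white_def)
  have "\<gamma> = Bigraph 1 0 {#}" if \<gamma>: "\<gamma> \<in> Gamma_circ"
  proof -
    have e: "edges \<gamma> = {#}" using \<gamma> w by (simp add: Gamma_circ_def wf_bigraph_def)
    have con: "connected_bigraph \<gamma>" using \<gamma> by (simp add: Gamma_circ_def)
    then have "nblack \<gamma> \<noteq> 0" using w by (auto simp: connected_bigraph_def vertices_def black_def)
    moreover have "\<not> 2 \<le> nblack \<gamma>"
    proof
      assume "2 \<le> nblack \<gamma>"
      then have "1 \<in> vertices \<gamma>" "2 \<in> vertices \<gamma>" by (auto simp: vertices_def black_def)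
      then have "(1 :: int, 2) \<in> ({} :: (int \<times> int) set)\<^sup>*" using con e by (force simp: connected_bigraph_def)
      then show False by simp
    qed
    ultimately have "nblack \<gamma> = 1" by simp
    then show ?thesis using e True by (cases \<gamma>) simp
  qed
  moreover have "Bigraph 1 0 {#} \<in> Gamma_circ"
    by (auto simp: Gamma_circ_def wf_bigraph_def connected_bigraph_def vertices_def black_def white_def vdegree_def)
  ultimately show ?thesis using True by auto
next
  case False
  then have w1: "-1 \<in> white \<gamma>" by (simp add: white_def)
  have b1: "-1 \<notin> black \<gamma>" by (simp add: black_def)
  have "2 \<le> degree_at (edges \<gamma>) v"
    if wf: "wf_bigraph \<gamma>" and con: "connected_on (black \<gamma>) (white \<gamma>) (edges \<gamma>)"
      and leaf: "\<forall>v\<in>vertices \<gamma>. vdegree \<gamma> v = 1 \<longrightarrow> v \<in> white \<gamma>" and v: "v \<in> black \<gamma>" for v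
  proof -
    have "(v, -1) \<in> (edge_rel (edges \<gamma>))\<^sup>*" "v \<noteq> -1" using con v w1 b1 by (auto simp: connected_on_def)
    then obtain z where "(v, z) \<in> edge_rel (edges \<gamma>)" by (metis converse_rtranclE)
    then have "(v, z) \<in># edges \<gamma>"
      using wf v black_white_disjoint[of \<gamma>] by (auto simp: edge_rel_def wf_bigraph_def)
    then have "(v, z) \<in># {#e \<in># edges \<gamma>. fst e = v#}" by simp
    then have "degree_at (edges \<gamma>) v \<noteq> 0" unfolding degree_at_def by (metis empty_iff set_mset_empty size_eq_0_iff_empty)
    moreover have "degree_at (edges \<gamma>) v \<noteq> 1"
      using leaf v vdegree_black[OF wf v] black_white_disjoint[of \<gamma>] by (auto simp: vertices_def)
    ultimately show ?thesis by simp
  qed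
  moreover have "v \<in> white \<gamma>" if "wf_bigraph \<gamma>" "\<forall>v\<in>black \<gamma>. 2 \<le> degree_at (edges \<gamma>) v"
    "v \<in> vertices \<gamma>" "vdegree \<gamma> v = 1" for v
    using that vdegree_black[of \<gamma> v] by (force simp: vertices_def)
  ultimately show ?thesis using False w1
    by (auto simp: Gamma_circ_def connected_bigraph_iff connected_edge_multisets_def edge_multisets_def
        wf_bigraph_def vertices_def)
qed

lemma Gamma_circ_wf: "\<gamma> \<in> Gamma_circ \<Longrightarrow> wf_bigraph \<gamma>"
  by (simp add: Gamma_circ_def)

lemma relabel_in_Gamma_circ:
  assumes "\<gamma> \<in> Gamma_circ" "p \<in> vertex_perms \<gamma>"
  shows "relabel p \<gamma> \<in> Gamma_circ"
proof -
  have st: "fst p permutes black \<gamma>" "snd p permutes white \<gamma>" using assms(2) by (auto simp: vertex_perms_def)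
  show ?thesis
  proof (cases "nwhite \<gamma> = 0")
    case True
    then show ?thesis using assms(1) by (auto simp: Gamma_circ_iff relabel_def)
  next
    case False
    then have "edges \<gamma> \<in> connected_edge_multisets (black \<gamma>) (white \<gamma>) (size (edges \<gamma>))"
      using assms(1) by (auto simp: Gamma_circ_iff)
    from image_mset_in_connected_edge_multisets[OF permutes_bij[OF st(1)] permutes_bij[OF st(2)] black_white_disjoint this]
    show ?thesis
      using False by (simp add: Gamma_circ_iff permutes_image[OF st(1)] permutes_image[OF st(2)])
  qed
qed

text \<open>Orbit and stabiliser: the class of \<open>\<gamma>\<close> is its orbit, and the
  permutations leading to a given \<open>\<delta>\<close> are the isomorphisms to it, equally many
  for each.\<close>

lemma card_class:
  assumes "\<gamma> \<in> Gamma_circ"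
  shows "card {\<delta> \<in> Gamma_circ. isos \<gamma> \<delta> \<noteq> {}} * card (sym_group \<gamma>) = fact (nblack \<gamma>) * fact (nwhite \<gamma>)"
    and "finite {\<delta> \<in> Gamma_circ. isos \<gamma> \<delta> \<noteq> {}}"
proof -
  let ?C = "{\<delta> \<in> Gamma_circ. isos \<gamma> \<delta> \<noteq> {}}"
  have wf: "wf_bigraph \<gamma>" by (rule Gamma_circ_wf[OF assms])
  have sub: "(\<lambda>p. relabel p \<gamma>) ` vertex_perms \<gamma> = ?C"
  proof (intro equalityI subsetI)
    fix \<delta> assume "\<delta> \<in> (\<lambda>p. relabel p \<gamma>) ` vertex_perms \<gamma>"
    then obtain p where p: "p \<in> vertex_perms \<gamma>" "\<delta> = relabel p \<gamma>" by blast
    then have \<delta>: "\<delta> \<in> Gamma_circ" using relabel_in_Gamma_circ[OF assms] by simp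
    then have "p \<in> isos \<gamma> \<delta>" using p isos_iff[OF wf Gamma_circ_wf[OF \<delta>]] by simp
    then show "\<delta> \<in> ?C" using \<delta> by auto
  next
    fix \<delta> assume "\<delta> \<in> ?C"
    then obtain p where "\<delta> \<in> Gamma_circ" "p \<in> isos \<gamma> \<delta>" by blast
    then have "p \<in> vertex_perms \<gamma>" "\<delta> = relabel p \<gamma>" using isos_iff[OF wf Gamma_circ_wf] by auto
    then show "\<delta> \<in> (\<lambda>p. relabel p \<gamma>) ` vertex_perms \<gamma>" by blast
  qed
  then show fin: "finite ?C" using finite_vertex_perms finite_imageI by metis
  have "card (vertex_perms \<gamma>) = (\<Sum>p\<in>vertex_perms \<gamma>. 1)" by simp
  also have "\<dots> = (\<Sum>\<delta>\<in>?C. \<Sum>p\<in>{p \<in> vertex_perms \<gamma>. relabel p \<gamma> = \<delta>}. 1)"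
    by (rule sum.group[symmetric]) (use sub fin in \<open>auto simp: finite_vertex_perms\<close>)
  also have "\<dots> = (\<Sum>\<delta>\<in>?C. card (sym_group \<gamma>))"
  proof (rule sum.cong[OF refl])
    fix \<delta> assume \<delta>: "\<delta> \<in> ?C"
    then have "{p \<in> vertex_perms \<gamma>. relabel p \<gamma> = \<delta>} = isos \<gamma> \<delta>"
      using isos_iff[OF wf Gamma_circ_wf] by auto
    then show "(\<Sum>p\<in>{p \<in> vertex_perms \<gamma>. relabel p \<gamma> = \<delta>}. 1) = card (sym_group \<gamma>)"
      using card_isos[OF wf Gamma_circ_wf] \<delta> by auto
  qed
  finally show "card ?C * card (sym_group \<gamma>) = fact (nblack \<gamma>) * fact (nwhite \<gamma>)"
    by (simp add: card_vertex_perms)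
qed

text \<open>The fibres of the quotient map are the classes, on which \<open>f\<close> and the vertex
  numbers are constant, so by \<open>card_class\<close> the weights \<open>1/(n! m!)\<close> add up
  to the inverse order of the symmetry group.\<close>

lemma sum_classes:
  fixes f :: "bigraph \<Rightarrow> 'a::field_char_0"
  assumes inv: "\<And>\<gamma> p. \<gamma> \<in> Gamma_circ \<Longrightarrow> p \<in> vertex_perms \<gamma> \<Longrightarrow> f (relabel p \<gamma>) = f \<gamma>"
  shows "(\<Sum>C \<in> {C \<in> Gamma_circ_classes. size (edges (class_rep C)) = N}.
      f (class_rep C) / of_nat (card (sym_group (class_rep C)))) =
    (\<Sum>\<gamma> \<in> {\<gamma> \<in> Gamma_circ. size (edges \<gamma>) = N}. f \<gamma> / (fact (nblack \<gamma>) * fact (nwhite \<gamma>)))"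
proof -
  let ?r = "{(\<gamma>, \<delta>) \<in> Gamma_circ \<times> Gamma_circ. isos \<gamma> \<delta> \<noteq> {}}"
  let ?G = "{\<gamma> \<in> Gamma_circ. size (edges \<gamma>) = N}"
  let ?T = "{C \<in> Gamma_circ_classes. size (edges (class_rep C)) = N}"
  have iso: "\<exists>p\<in>vertex_perms \<gamma>. \<delta> = relabel p \<gamma>" if "(\<gamma>, \<delta>) \<in> ?r" for \<gamma> \<delta>
  proof -
    have \<gamma>: "\<gamma> \<in> Gamma_circ" and \<delta>: "\<delta> \<in> Gamma_circ" and "isos \<gamma> \<delta> \<noteq> {}" using that by auto
    then obtain p where "p \<in> isos \<gamma> \<delta>" by blast
    then have "p \<in> vertex_perms \<gamma>" "\<delta> = relabel p \<gamma>"
      using isos_iff[OF Gamma_circ_wf[OF \<gamma>] Gamma_circ_wf[OF \<delta>]] by auto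
    then show ?thesis by blast
  qed
  have size: "size (edges \<delta>) = size (edges \<gamma>)" if "(\<gamma>, \<delta>) \<in> ?r" for \<gamma> \<delta>
    using iso[OF that] by auto
  have cls: "C = ?r `` {class_rep C}" if "C \<in> Gamma_circ_classes" for C
  proof -
    have "?r `` {class_rep C} \<in> Gamma_circ_classes"
      unfolding Gamma_circ_classes_def by (rule quotientI) (rule class_rep_in_Gamma_circ(2)[OF that])
    moreover have "class_rep C \<in> ?r `` {class_rep C}"
      using class_rep_in_Gamma_circ(2)[OF that] isos_refl by simp
    ultimately show ?thesis
      using class_rep_in_Gamma_circ(1)[OF that] quotient_disj[OF equiv_isos] that
      unfolding Gamma_circ_classes_def by blast
  qed
  have "(\<Sum>\<gamma> \<in> ?G. f \<gamma> / (fact (nblack \<gamma>) * fact (nwhite \<gamma>))) =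
      (\<Sum>C\<in>?T. \<Sum>\<gamma>\<in>{\<gamma> \<in> ?G. ?r `` {\<gamma>} = C}. f \<gamma> / (fact (nblack \<gamma>) * fact (nwhite \<gamma>)))"
  proof (rule sum.group[symmetric])
    show "finite ?G" by (rule finite_Gamma_circ_edges)
    show "finite ?T" by (rule finite_classes_edges)
    show "(\<lambda>\<gamma>. ?r `` {\<gamma>}) ` ?G \<subseteq> ?T"
    proof
      fix C assume "C \<in> (\<lambda>\<gamma>. ?r `` {\<gamma>}) ` ?G"
      then obtain \<gamma> where \<gamma>: "\<gamma> \<in> ?G" and C: "C = ?r `` {\<gamma>}" by blast
      have mem: "C \<in> Gamma_circ_classes" unfolding C Gamma_circ_classes_def using \<gamma> by (intro quotientI) simp
      have "\<delta> \<in> C \<Longrightarrow> (\<gamma>, \<delta>) \<in> ?r" for \<delta> using \<gamma> by (simp add: C)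
      then have "(\<gamma>, class_rep C) \<in> ?r" using class_rep_in_Gamma_circ(1)[OF mem] .
      then show "C \<in> ?T" using size \<gamma> mem by fastforce
    qed
  qed
  also have "\<dots> = (\<Sum>C\<in>?T. f (class_rep C) / of_nat (card (sym_group (class_rep C))))"
  proof (rule sum.cong[OF refl])
    fix C assume "C \<in> ?T"
    then have C: "C \<in> Gamma_circ_classes" and N: "size (edges (class_rep C)) = N" by auto
    define \<gamma>0 where "\<gamma>0 = class_rep C"
    have \<gamma>0: "\<gamma>0 \<in> Gamma_circ" unfolding \<gamma>0_def by (rule class_rep_in_Gamma_circ(2)[OF C])
    have Ceq: "C = {\<delta> \<in> Gamma_circ. isos \<gamma>0 \<delta> \<noteq> {}}" using cls[OF C] \<gamma>0 by (auto simp: \<gamma>0_def)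
    have "{\<gamma> \<in> ?G. ?r `` {\<gamma>} = C} = C"
    proof (intro equalityI subsetI)
      fix \<gamma> assume "\<gamma> \<in> {\<gamma> \<in> ?G. ?r `` {\<gamma>} = C}"
      then show "\<gamma> \<in> C" using isos_refl[of \<gamma>] by auto
    next
      fix \<gamma> assume \<gamma>: "\<gamma> \<in> C"
      then have r: "(\<gamma>0, \<gamma>) \<in> ?r" using Ceq \<gamma>0 by auto
      then have "?r `` {\<gamma>0} = ?r `` {\<gamma>}" by (rule equiv_class_eq[OF equiv_isos])
      then show "\<gamma> \<in> {\<gamma> \<in> ?G. ?r `` {\<gamma>} = C}"
        using r size[OF r] N cls[OF C] by (auto simp: \<gamma>0_def)
    qed
    then have "(\<Sum>\<gamma>\<in>{\<gamma> \<in> ?G. ?r `` {\<gamma>} = C}. f \<gamma> / (fact (nblack \<gamma>) * fact (nwhite \<gamma>))) =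
        (\<Sum>\<gamma>\<in>C. f \<gamma> / (fact (nblack \<gamma>) * fact (nwhite \<gamma>)))" by simp
    also have "\<dots> = (\<Sum>\<gamma>\<in>C. f \<gamma>0 / (fact (nblack \<gamma>0) * fact (nwhite \<gamma>0)))"
    proof (rule sum.cong[OF refl])
      fix \<gamma> assume "\<gamma> \<in> C"
      then have "(\<gamma>0, \<gamma>) \<in> ?r" using Ceq \<gamma>0 by auto
      then obtain p where "p \<in> vertex_perms \<gamma>0" "\<gamma> = relabel p \<gamma>0" using iso by blast
      then show "f \<gamma> / (fact (nblack \<gamma>) * fact (nwhite \<gamma>)) = f \<gamma>0 / (fact (nblack \<gamma>0) * fact (nwhite \<gamma>0))"
        using inv[OF \<gamma>0] by simp
    qed
    also have "\<dots> = of_nat (card C) * f \<gamma>0 / (fact (nblack \<gamma>0) * fact (nwhite \<gamma>0))" by simp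
    also have "(fact (nblack \<gamma>0) * fact (nwhite \<gamma>0) :: 'a) = of_nat (card C * card (sym_group \<gamma>0))"
      using card_class(1)[OF \<gamma>0] Ceq by simp
    also have "of_nat (card C) * f \<gamma>0 / of_nat (card C * card (sym_group \<gamma>0)) = f \<gamma>0 / of_nat (card (sym_group \<gamma>0))"
    proof -
      have "card C \<noteq> 0" using card_class[OF \<gamma>0] Ceq by (metis fact_nonzero mult_eq_0_iff mult_0)
      then show ?thesis by simp
    qed
    finally show "(\<Sum>\<gamma>\<in>{\<gamma> \<in> ?G. ?r `` {\<gamma>} = C}. f \<gamma> / (fact (nblack \<gamma>) * fact (nwhite \<gamma>))) =
        f (class_rep C) / of_nat (card (sym_group (class_rep C)))" by (simp add: \<gamma>0_def)
  qed
  finally show ?thesis ..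
qed

text \<open>A nonempty monomial excludes the one-vertex black graph, so the graphs that count are
  given by a number of black vertices and a connected edge multiset.\<close>

lemma (in vertex_weights) sum_Gamma_circ:
  assumes "M \<noteq> {#}"
  shows "(\<Sum>\<gamma> \<in> {\<gamma> \<in> Gamma_circ. size (edges \<gamma>) = N}.
      graph_weight (black \<gamma>) (white \<gamma>) (edges \<gamma>) M / (fact (nblack \<gamma>) * fact (nwhite \<gamma>))) =
    fps_nth (connected_series M) N"
proof -
  let ?m = "size M"
  let ?h = "\<lambda>\<gamma>. graph_weight (black \<gamma>) (white \<gamma>) (edges \<gamma>) M / (fact (nblack \<gamma>) * fact (nwhite \<gamma>))"
  have m: "?m \<noteq> 0" using assms by simp
  have "(\<Sum>\<gamma> \<in> {\<gamma> \<in> Gamma_circ. size (edges \<gamma>) = N}. ?h \<gamma>) =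
      (\<Sum>\<gamma> \<in> {\<gamma> \<in> Gamma_circ. size (edges \<gamma>) = N \<and> nwhite \<gamma> = ?m}. ?h \<gamma>)"
  proof (rule sum.mono_neutral_right)
    show "finite {\<gamma> \<in> Gamma_circ. size (edges \<gamma>) = N}" by (rule finite_Gamma_circ_edges)
    have "graph_weight (black \<gamma>) (white \<gamma>) (edges \<gamma>) M = 0" if "nwhite \<gamma> \<noteq> ?m" for \<gamma>
      using that by (intro graph_weight_eq_0) (simp add: white_def)
    then show "\<forall>\<gamma> \<in> {\<gamma> \<in> Gamma_circ. size (edges \<gamma>) = N} - {\<gamma> \<in> Gamma_circ. size (edges \<gamma>) = N \<and> nwhite \<gamma> = ?m}. ?h \<gamma> = 0"
      by simp
  qed auto
  also have "\<dots> = (\<Sum>(n, E) \<in> (SIGMA n:{..N}. connected_edge_multisets (blacks n) (whites ?m) N).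
      graph_weight (blacks n) (whites ?m) E M / (fact n * fact ?m))"
  proof (rule sum.reindex_bij_witness[of _ "\<lambda>(n, E). Bigraph n ?m E" "\<lambda>\<gamma>. (nblack \<gamma>, edges \<gamma>)"], goal_cases)
    case (2 \<gamma>)
    then have "edges \<gamma> \<in> connected_edge_multisets (black \<gamma>) (white \<gamma>) N" "nwhite \<gamma> = ?m"
      using m by (auto simp: Gamma_circ_iff)
    moreover from this have "nblack \<gamma> \<le> N"
      using edge_multisets_empty[of N "black \<gamma>" "white \<gamma>"]
      by (cases "nblack \<gamma> \<le> N") (auto simp: connected_edge_multisets_def black_def)
    ultimately show ?case by (simp add: black_def white_def)
  next
    case (4 p)
    then show ?case using m
      by (auto simp: Gamma_circ_iff black_def white_def connected_edge_multisets_def edge_multisets_def)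
  next
    case (1 \<gamma>)
    then show ?case by (cases \<gamma>) simp
  next
    case (5 \<gamma>)
    then show ?case by (simp add: black_def white_def)
  qed auto
  also have "\<dots> = fps_nth (connected_series M) N"
    by (simp add: sum.Sigma[symmetric] finite_connected_edge_multisets connected_series_def
        connected_weight_def sum_divide_distrib)
  finally show ?thesis .
qed

section \<open>Expansion over ordered half-edges\<close>

lemma symmetry_factor_superset:
  assumes "finite X" "set_mset E \<subseteq> X"
  shows "symmetry_factor B E = (\<Prod>v\<in>B. fact (degree_at E v)) / (\<Prod>e\<in>X. fact (count E e))"
proof -
  have "(\<Prod>e\<in>X. fact (count E e) :: 'a) = (\<Prod>e\<in>set_mset E. fact (count E e))"
    using assms by (intro prod.mono_neutral_right) (auto simp: not_in_iff)
  then show ?thesis by (simp add: symmetry_factor_def)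
qed

lemma degree_at_add_mset: "degree_at (add_mset (v, w) E) u = degree_at E u + (if u = v then 1 else 0)"
  by (simp add: degree_at_def)

text \<open>Adding an edge multiplies the symmetry factor by the new valency over the new
  multiplicity; this is the recursion for the count of orderings.\<close>

lemma symmetry_factor_add_mset:
  assumes "finite B" "v \<in> B"
  shows "symmetry_factor B (add_mset (v, w) E) * of_nat (count (add_mset (v, w) E) (v, w)) =
    (symmetry_factor B E * of_nat (degree_at (add_mset (v, w) E) v) :: 'r::field_char_0)"
proof -
  let ?E = "add_mset (v, w) E"
  let ?X = "set_mset ?E"
  let ?P = "\<Prod>u\<in>B - {v}. fact (degree_at E u) :: 'r" and ?Q = "\<Prod>e\<in>?X - {(v, w)}. fact (count E e) :: 'r"
  have P: "(\<Prod>u\<in>B. fact (degree_at ?E u)) = fact (Suc (degree_at E v)) * ?P"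
    "(\<Prod>u\<in>B. fact (degree_at E u)) = fact (degree_at E v) * ?P"
    using assms by (simp_all add: prod.remove[of B v] degree_at_add_mset)
  have "(\<Prod>e\<in>?X - {(v, w)}. fact (count ?E e)) = ?Q" by (rule prod.cong) auto
  moreover have "(\<Prod>e\<in>?X. fact (count ?E e) :: 'r) = fact (count ?E (v, w)) * (\<Prod>e\<in>?X - {(v, w)}. fact (count ?E e))"
    by (rule prod.remove) auto
  ultimately have Q1: "(\<Prod>e\<in>?X. fact (count ?E e)) = fact (Suc (count E (v, w))) * ?Q"
    by (simp only: count_add_mset simp_thms if_True)
  have Q2: "(\<Prod>e\<in>?X. fact (count E e) :: 'r) = fact (count E (v, w)) * ?Q"
    by (rule prod.remove) auto
  have s1: "symmetry_factor B ?E = (fact (Suc (degree_at E v)) * ?P) / (fact (Suc (count E (v, w))) * ?Q)"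
    unfolding P[symmetric] Q1[symmetric] by (rule symmetry_factor_superset) auto
  have s2: "symmetry_factor B E = (fact (degree_at E v) * ?P) / (fact (count E (v, w)) * ?Q)"
    unfolding P[symmetric] Q2[symmetric] by (rule symmetry_factor_superset) auto
  have "?Q \<noteq> 0" by simp
  then show ?thesis unfolding s1 s2 by (simp add: degree_at_add_mset field_simps del: of_nat_Suc)
qed

lemma degree_at_eq_sum:
  assumes "finite W" "set_mset E \<subseteq> B \<times> W"
  shows "degree_at E v = (\<Sum>w\<in>W. count E (v, w))"
  using assms(2)
proof (induction E)
  case (add e E)
  obtain b w where e: "e = (b, w)" by (cases e)
  have "(\<Sum>x\<in>W. count (add_mset e E) (v, x)) = (\<Sum>x\<in>W. count E (v, x) + (if v = b \<and> x = w then 1 else 0))"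
    by (intro sum.cong refl) (auto simp: e)
  also have "\<dots> = (\<Sum>x\<in>W. count E (v, x)) + (if v = b then 1 else 0)"
    using add.prems assms(1) by (auto simp: sum.distrib e sum.delta)
  finally show ?case using add by (simp add: e degree_at_add_mset)
qed (simp add: degree_at_def)

text \<open>Induction on the half-edges. The first one, at \<open>v\<close>, can go to any neighbour
  \<open>w\<close>, and the orderings that do so are the fraction
  \<open>count E (v, w) / degree_at E v\<close> of all; these fractions add up to 1.\<close>

lemma card_arrangements:
  assumes "finite B" "finite W" "set_mset E \<subseteq> B \<times> W" "mset vs = image_mset fst E"
  shows "of_nat (card {ws. length ws = length vs \<and> mset (zip vs ws) = E}) = (symmetry_factor B E :: 'r::field_char_0)"
  using assms(3,4)
proof (induction vs arbitrary: E)
  case Nil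
  then have "E = {#}" by simp
  moreover have "{ws :: int list. length ws = length ([] :: int list) \<and> mset (zip ([] :: int list) ws) = {#}} = {[]}" by auto
  ultimately show ?case by (simp add: symmetry_factor_def degree_at_def)
next
  case (Cons v vs)
  let ?S = "\<lambda>vs E. {ws :: int list. length ws = length vs \<and> mset (zip vs ws) = E}"
  let ?N = "{w \<in> W. (v, w) \<in># E}"
  have "v \<in># image_mset fst E" using Cons.prems(2) by (metis list.set_intros(1) set_mset_mset)
  then obtain w0 where w0: "(v, w0) \<in># E" by auto
  then have v: "v \<in> B" using Cons.prems by auto
  have finS: "finite (?S vs F)" if "set_mset F \<subseteq> B \<times> W" for vs F
  proof (rule finite_subset)
    show "?S vs F \<subseteq> {ws. set ws \<subseteq> W \<and> length ws = length vs}"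
    proof safe
      fix ws w assume "length ws = length vs" "F = mset (zip vs ws)" "w \<in> set ws"
      then have "w \<in> snd ` set (zip vs ws)" by (metis map_snd_zip set_map)
      then show "w \<in> W" using that \<open>F = mset (zip vs ws)\<close> by auto
    qed
  qed (rule finite_lists_length_eq[OF assms(2)])
  have split: "?S (v # vs) E = (\<Union>w\<in>?N. (#) w ` ?S vs (E - {#(v, w)#}))"
  proof (intro equalityI subsetI)
    fix ws assume "ws \<in> ?S (v # vs) E"
    then obtain w ws' where ws: "ws = w # ws'" "length ws' = length vs" "add_mset (v, w) (mset (zip vs ws')) = E"
      by (auto simp: length_Suc_conv)
    then have "(v, w) \<in># E" "mset (zip vs ws') = E - {#(v, w)#}" by auto
    then show "ws \<in> (\<Union>w\<in>?N. (#) w ` ?S vs (E - {#(v, w)#}))" using ws Cons.prems by auto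
  next
    fix ws assume "ws \<in> (\<Union>w\<in>?N. (#) w ` ?S vs (E - {#(v, w)#}))"
    then show "ws \<in> ?S (v # vs) E" by auto
  qed
  have sub: "set_mset (E - {#(v, w)#}) \<subseteq> B \<times> W" for w using Cons.prems(1) by (meson in_diffD subset_iff)
  have "card (?S (v # vs) E) = (\<Sum>w\<in>?N. card (?S vs (E - {#(v, w)#})))"
    unfolding split using assms(2) finS[OF sub]
    by (subst card_UN_disjoint) (auto simp: card_image)
  then have "of_nat (card (?S (v # vs) E)) = (\<Sum>w\<in>?N. of_nat (card (?S vs (E - {#(v, w)#}))) :: 'r)" by simp
  also have "\<dots> = (\<Sum>w\<in>?N. symmetry_factor B E * of_nat (count E (v, w)) / of_nat (degree_at E v))"
  proof (rule sum.cong[OF refl])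
    fix w assume w: "w \<in> ?N"
    then have E: "E = add_mset (v, w) (E - {#(v, w)#})" by simp
    have "mset vs = image_mset fst (E - {#(v, w)#})"
      using Cons.prems(2) arg_cong[OF E, of "image_mset fst"] by simp
    then have "of_nat (card (?S vs (E - {#(v, w)#}))) = (symmetry_factor B (E - {#(v, w)#}) :: 'r)"
      using Cons.IH[OF sub] by simp
    moreover have "degree_at E v \<noteq> 0" by (subst E) (simp add: degree_at_add_mset)
    ultimately show "of_nat (card (?S vs (E - {#(v, w)#}))) = (symmetry_factor B E * of_nat (count E (v, w)) / of_nat (degree_at E v) :: 'r)"
      using symmetry_factor_add_mset[OF assms(1) v, of w "E - {#(v, w)#}", where 'r = 'r] E by (simp add: field_simps)
  qed
  also have "\<dots> = symmetry_factor B E * of_nat (\<Sum>w\<in>?N. count E (v, w)) / of_nat (degree_at E v)"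
    by (simp add: sum_distrib_left sum_divide_distrib)
  also have "(\<Sum>w\<in>?N. count E (v, w)) = degree_at E v"
    unfolding degree_at_eq_sum[OF assms(2) Cons.prems(1)]
    by (rule sum.mono_neutral_left) (use assms(2) in \<open>auto simp: not_in_iff\<close>)
  also have "symmetry_factor B E * of_nat (degree_at E v) / of_nat (degree_at E v) = (symmetry_factor B E :: 'r)"
  proof -
    have "{#e \<in># E. fst e = v#} \<noteq> {#}" using w0 by auto
    then have "degree_at E v \<noteq> 0" unfolding degree_at_def by (metis size_eq_0_iff_empty)
    then show ?thesis by simp
  qed
  finally show ?case .
qed

text \<open>The black ends of the half-edges, vertex by vertex, for prescribed valencies.\<close>

fun blocks :: "int \<Rightarrow> nat list \<Rightarrow> int list" where
  "blocks v [] = []"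
| "blocks v (k # ks) = replicate k v @ blocks (v + 1) ks"

lemma length_blocks [simp]: "length (blocks v ks) = sum_list ks"
  by (induction ks arbitrary: v) auto

lemma set_blocks: "set (blocks v ks) \<subseteq> {v..<v + int (length ks)}"
  by (induction ks arbitrary: v) fastforce+

lemma count_blocks:
  "i < length ks \<Longrightarrow> count (mset (blocks v ks)) (v + int i) = ks ! i"
proof (induction ks arbitrary: v i)
  case (Cons k ks)
  show ?case
  proof (cases i)
    case 0
    have "v \<notin> set (blocks (v + 1) ks)" using set_blocks[of "v + 1" ks] by auto
    then show ?thesis using 0 by (simp add: count_mset_0_iff[symmetric] del: count_mset_0_iff)
  next
    case (Suc j)
    then have "count (mset (blocks (v + 1) ks)) (v + 1 + int j) = ks ! j" using Cons by auto
    then show ?thesis using Suc by (simp add: add_ac)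
  qed
qed simp

lemma labels_for_append:
  "length us = length as \<Longrightarrow> labels_for (us @ vs) (as @ bs) w = labels_for us as w @ labels_for vs bs w"
  by (simp add: labels_for_def)

lemma labels_for_replicate:
  "labels_for (replicate (length as) v) as w = (if v = w then as else [])"
  by (induction as) (auto simp: labels_for_def)

lemma labels_for_notin: "w \<notin> set ws \<Longrightarrow> labels_for ws as w = []"
  by (auto simp: labels_for_def filter_empty_conv dest: set_zip_leftD)

text \<open>The blocks and the concatenation are cut at the same places, so the vertex
  \<open>v0 + i\<close> receives exactly the tuple \<open>L ! i\<close>.\<close>

lemma prod_labels_for_blocks:
  fixes h :: "'d list \<Rightarrow> 'r::comm_monoid_mult"
  shows "(\<Prod>v\<in>{v0..<v0 + int (length L)}. h (labels_for (blocks v0 (map length L)) (concat L) v)) = (\<Prod>as\<leftarrow>L. h as)"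
proof (induction L arbitrary: v0)
  case (Cons as L)
  let ?l = "\<lambda>v. labels_for (blocks v0 (map length (as # L))) (concat (as # L)) v"
  have l: "?l v = (if v = v0 then as else []) @ labels_for (blocks (v0 + 1) (map length L)) (concat L) v" for v
    by (simp add: labels_for_append labels_for_replicate)
  have "v0 \<notin> set (blocks (v0 + 1) (map length L))" using set_blocks[of "v0 + 1" "map length L"] by auto
  then have l0: "?l v0 = as" unfolding l by (simp add: labels_for_notin)
  have "{v0..<v0 + int (length (as # L))} = insert v0 {v0 + 1..<v0 + 1 + int (length L)}" by auto
  then have "(\<Prod>v\<in>{v0..<v0 + int (length (as # L))}. h (?l v)) =
      h as * (\<Prod>v\<in>{v0 + 1..<v0 + 1 + int (length L)}. h (?l v))"
    using l0 by simp
  also have "(\<Prod>v\<in>{v0 + 1..<v0 + 1 + int (length L)}. h (?l v)) = (\<Prod>as\<leftarrow>L. h as)"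
    unfolding Cons.IH[of "v0 + 1", symmetric] by (intro prod.cong refl) (simp only: l, simp)
  finally show ?case by simp
qed simp

section \<open>From index tuples to contractions\<close>

lemma image_mset_zip_fst:
  "length vs = length l \<Longrightarrow> length ws = length l \<Longrightarrow>
   image_mset snd {#t \<in># mset (zip (zip vs ws) l). fst (fst t) = v#} = mset (labels_for vs l v)"
proof (induction vs arbitrary: ws l)
  case (Cons v vs)
  then show ?case by (cases ws; cases l) (auto simp: labels_for_def)
qed (simp add: labels_for_def)

lemma image_mset_zip_snd:
  "length vs = length l \<Longrightarrow> length ws = length l \<Longrightarrow>
   image_mset snd {#t \<in># mset (zip (zip vs ws) l). snd (fst t) = w#} = mset (labels_for ws l w)"
proof (induction vs arbitrary: ws l)
  case (Cons v vs)
  then show ?case by (cases ws; cases l) (auto simp: labels_for_def)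
qed (simp add: labels_for_def)

text \<open>Prescribed lengths tell where to cut, which makes \<open>concat\<close>
  invertible.\<close>

lemma bij_betw_concat:
  "bij_betw concat {L. map length L = ks} {l :: 'a list. length l = sum_list ks}"
proof (induction ks)
  case Nil
  then show ?case by (auto simp: bij_betw_def)
next
  case (Cons k ks)
  show ?case
    unfolding bij_betw_def
  proof
    show "inj_on concat {L :: 'a list list. map length L = k # ks}"
    proof (rule inj_onI)
      fix L L' :: "'a list list" assume "L \<in> {L. map length L = k # ks}" "L' \<in> {L. map length L = k # ks}"
        and eq: "concat L = concat L'"
      then obtain as L0 as' L0' where L: "L = as # L0" "length as = k" "map length L0 = ks"
        and L': "L' = as' # L0'" "length as' = k" "map length L0' = ks"
        by (auto simp: map_eq_Cons_conv)
      then have "as = as'" "concat L0 = concat L0'" using eq by simp_all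
      then show "L = L'" using Cons.IH L L' by (simp add: bij_betw_def inj_on_def)
    qed
    show "concat ` {L :: 'a list list. map length L = k # ks} = {l. length l = sum_list (k # ks)}"
    proof (intro equalityI subsetI)
      fix l :: "'a list" assume "l \<in> concat ` {L. map length L = k # ks}"
      then show "l \<in> {l. length l = sum_list (k # ks)}" by (auto simp: length_concat)
    next
      fix l :: "'a list" assume l: "l \<in> {l. length l = sum_list (k # ks)}"
      then have "drop k l \<in> concat ` {L. map length L = ks}" using Cons.IH by (simp add: bij_betw_def)
      then obtain L where "map length L = ks" "drop k l = concat L" by auto
      then show "l \<in> concat ` {L. map length L = k # ks}"
        using l by (intro image_eqI[of _ _ "take k l # L"]) (auto simp: append_take_drop_id simp flip: \<open>drop k l = concat L\<close>)
    qed
  qed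
qed

lemma mset_blocks_degrees:
  assumes "set_mset E \<subseteq> blacks n \<times> W"
  shows "mset (blocks 1 (map (degree_at E) [1..int n])) = image_mset fst E"
proof (rule multiset_eqI)
  fix v
  have d: "count (image_mset fst E) v = degree_at E v"
    by (induction E) (auto simp: degree_at_def)
  show "count (mset (blocks 1 (map (degree_at E) [1..int n]))) v = count (image_mset fst E) v"
  proof (cases "v \<in> blacks n")
    case True
    then have "nat (v - 1) < n" "v = 1 + int (nat (v - 1))" unfolding atLeastAtMost_iff by linarith+
    then show ?thesis using count_blocks[of "nat (v - 1)" "map (degree_at E) [1..int n]" 1] d by simp
  next
    case False
    then have "v \<notin> set (blocks 1 (map (degree_at E) [1..int n]))"
      using set_blocks[of 1 "map (degree_at E) [1..int n]"] by auto
    moreover have "degree_at E v = 0" using False assms by (force simp: degree_at_def)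
    ultimately show ?thesis using d by (simp add: count_mset_0_iff)
  qed
qed

lemma count_image_fst: "count (image_mset fst E) v = degree_at E v"
  by (induction E) (auto simp: degree_at_def)

lemma finite_compositions: "finite {ks :: nat list. (\<forall>k\<in>set ks. 2 \<le> k) \<and> sum_list ks = N}"
proof (rule finite_subset)
  show "{ks :: nat list. (\<forall>k\<in>set ks. 2 \<le> k) \<and> sum_list ks = N} \<subseteq> {ks. set ks \<subseteq> {..N} \<and> length ks \<le> N}"
  proof safe
    fix ks :: "nat list" assume "\<forall>k\<in>set ks. 2 \<le> k"
    then show "length ks \<le> sum_list ks" by (induction ks) auto
  next
    fix ks :: "nat list" and k assume "k \<in> set ks"
    then show "k \<le> sum_list ks" by (simp add: member_le_sum_list)
  qed
qed (rule finite_lists_length_le, simp)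

lemma length_le_sum_list: "\<forall>k\<in>set ks. 2 \<le> (k :: nat) \<Longrightarrow> length ks \<le> sum_list ks"
  by (induction ks) auto

lemma set_subset_of_zip:
  assumes "length ws = length vs" "set (zip vs ws) \<subseteq> B \<times> W" shows "set ws \<subseteq> W"
proof
  fix w assume "w \<in> set ws"
  then have "w \<in> snd ` set (zip vs ws)" using assms(1) by (metis map_snd_zip set_map)
  then show "w \<in> W" using assms(2) by auto
qed

context vertex_weights
begin

text \<open>A pair \<open>(ks, ws)\<close> is a multigraph with ordered half-edges. The multigraph
  determines its valencies \<open>ks\<close>, so its fibre is a set of lists \<open>ws\<close> of
  white ends, counted by \<open>card_arrangements\<close>.\<close>

lemma sum_arrangements:
  assumes "finite W"
  shows "(\<Sum>ks | length ks = n \<and> (\<forall>k\<in>set ks. 2 \<le> k) \<and> sum_list ks = N. \<Sum>ws | length ws = N \<and> set ws \<subseteq> W.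
      contraction (blacks n) W a (zip (blocks 1 ks) ws)) =
    (\<Sum>E \<in> edge_multisets (blacks n) W N. symmetry_factor (blacks n) E * contraction (blacks n) W a (SOME es. mset es = E))"
proof -
  let ?K = "{ks. length ks = n \<and> (\<forall>k\<in>set ks. 2 \<le> k) \<and> sum_list ks = N}"
  let ?P = "?K \<times> {ws. length ws = N \<and> set ws \<subseteq> W}"
  let ?e = "\<lambda>(ks, ws). mset (zip (blocks 1 ks) ws)"
  let ?c = "\<lambda>E. contraction (blacks n) W a (SOME es. mset es = E)"
  have finK: "finite ?K" by (rule finite_subset[OF _ finite_compositions[of N]]) auto
  have finW: "finite {ws. length ws = N \<and> set ws \<subseteq> W}"
    using finite_lists_length_eq[OF assms, of N] by (simp add: conj_commute)
  have c: "contraction (blacks n) W a es = ?c (mset es)" for es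
  proof -
    have "mset (SOME es'. mset es' = mset es) = mset es" by (rule someI) (rule refl)
    then show ?thesis unfolding contraction_def by (intro sum_zip_perm) simp
  qed
  have fst_zip: "image_mset fst (mset (zip (blocks 1 ks) ws)) = mset (blocks 1 ks)"
    if "(ks, ws) \<in> ?P" for ks ws using that by (simp flip: mset_map)
  \<comment> \<open>The valencies are read back from the edge multiset; list position
    \<open>i\<close> belongs to vertex \<open>1 + i\<close>.\<close>
  have ks: "ks = map (degree_at (?e (ks, ws))) [1..int n]" if P: "(ks, ws) \<in> ?P" for ks ws
  proof (rule nth_equalityI)
    fix i assume i: "i < length ks"
    then have "ks ! i = count (mset (blocks 1 ks)) (1 + int i)" by (rule count_blocks[symmetric])
    also have "\<dots> = degree_at (?e (ks, ws)) (1 + int i)"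
      using fst_zip[OF P] count_image_fst[of "?e (ks, ws)" "1 + int i"] by simp
    finally show "ks ! i = map (degree_at (?e (ks, ws))) [1..int n] ! i" using i P by simp
  qed (use P in simp)
  have img: "?e ` ?P \<subseteq> edge_multisets (blacks n) W N"
  proof
    fix E assume "E \<in> ?e ` ?P"
    then obtain ks ws where P: "(ks, ws) \<in> ?P" and E: "E = ?e (ks, ws)" by blast
    have "set (zip (blocks 1 ks) ws) \<subseteq> blacks n \<times> W"
      using P set_blocks[of 1 ks] by (fastforce dest: set_zip_leftD set_zip_rightD)
    moreover have "2 \<le> degree_at E v" if v: "v \<in> blacks n" for v
    proof -
      have "degree_at E v \<in> set ks" using ks[OF P] v E by (metis image_eqI set_map set_upto)
      then show ?thesis using P by simp
    qed
    ultimately show "E \<in> edge_multisets (blacks n) W N" using P by (simp add: edge_multisets_def E)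
  qed
  have "(\<Sum>ks\<in>?K. \<Sum>ws | length ws = N \<and> set ws \<subseteq> W. contraction (blacks n) W a (zip (blocks 1 ks) ws)) =
      (\<Sum>p\<in>?P. ?c (?e p))"
    unfolding sum.cartesian_product by (rule sum.cong[OF refl]) (simp only: case_prod_beta c[symmetric])
  also have "\<dots> = (\<Sum>E \<in> edge_multisets (blacks n) W N. \<Sum>p\<in>{p \<in> ?P. ?e p = E}. ?c (?e p))"
    by (rule sum.group[symmetric]) (use img finK finW assms in \<open>auto intro: finite_edge_multisets\<close>)
  also have "\<dots> = (\<Sum>E \<in> edge_multisets (blacks n) W N. of_nat (card {p \<in> ?P. ?e p = E}) * ?c E)"
    by (intro sum.cong refl) simp
  also have "\<dots> = (\<Sum>E \<in> edge_multisets (blacks n) W N. symmetry_factor (blacks n) E * ?c E)"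
  proof (rule sum.cong[OF refl])
    fix E assume E: "E \<in> edge_multisets (blacks n) W N"
    then have sub: "set_mset E \<subseteq> blacks n \<times> W" by (simp add: edge_multisets_def)
    define k where "k = map (degree_at E) [1..int n]"
    have blk: "mset (blocks 1 k) = image_mset fst E" unfolding k_def by (rule mset_blocks_degrees[OF sub])
    have "length (blocks 1 k) = size E" using arg_cong[OF blk, of size] by simp
    also have "\<dots> = N" using E by (simp add: edge_multisets_def)
    finally have len: "sum_list k = N" by simp
    have "{p \<in> ?P. ?e p = E} = Pair k ` {ws. length ws = length (blocks 1 k) \<and> mset (zip (blocks 1 k) ws) = E}"
    proof (intro equalityI subsetI)
      fix p assume p: "p \<in> {p \<in> ?P. ?e p = E}"
      obtain ks' ws where pp: "p = (ks', ws)" by (cases p)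
      then have "ks' = k" using ks[of ks' ws] p by (simp add: k_def)
      then show "p \<in> Pair k ` {ws. length ws = length (blocks 1 k) \<and> mset (zip (blocks 1 k) ws) = E}"
        using p pp by auto
    next
      fix p assume "p \<in> Pair k ` {ws. length ws = length (blocks 1 k) \<and> mset (zip (blocks 1 k) ws) = E}"
      then obtain ws where ws: "p = (k, ws)" "length ws = length (blocks 1 k)" "mset (zip (blocks 1 k) ws) = E" by auto
      have "set (zip (blocks 1 k) ws) \<subseteq> blacks n \<times> W" using ws(3) sub by (metis set_mset_mset)
      then have "set ws \<subseteq> W" by (rule set_subset_of_zip[OF ws(2)])
      moreover have "\<forall>x\<in>set k. 2 \<le> x" using E by (auto simp: k_def edge_multisets_def)
      moreover have "length k = n" by (simp add: k_def)
      ultimately show "p \<in> {p \<in> ?P. ?e p = E}" using ws len by simp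
    qed
    then have "card {p \<in> ?P. ?e p = E} = card {ws. length ws = length (blocks 1 k) \<and> mset (zip (blocks 1 k) ws) = E}"
      by (simp add: card_image inj_on_def)
    then show "of_nat (card {p \<in> ?P. ?e p = E}) * ?c E = symmetry_factor (blacks n) E * ?c E"
      using card_arrangements[OF _ assms sub blk, where 'r = 'r] by simp
  qed
  finally show ?thesis .
qed

text \<open>With the lengths fixed, the tuples in \<open>L\<close> are one index list cut into
  blocks, and summing over that list is the contraction.\<close>

lemma sum_lists_with_lengths:
  assumes "length ws = sum_list ks"
  shows "(\<Sum>L | map length L = ks. (\<Prod>as\<leftarrow>L. s (mset as)) * (\<Prod>w\<in>W. D (a w) (mset (labels_for ws (concat L) w)))) =
    contraction (blacks (length ks)) W a (zip (blocks 1 ks) ws)"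
proof -
  let ?lw = "\<lambda>l. labelled_weight (blacks (length ks)) W a (mset (zip (zip (blocks 1 ks) ws) l))"
  have "(\<Sum>L | map length L = ks. (\<Prod>as\<leftarrow>L. s (mset as)) * (\<Prod>w\<in>W. D (a w) (mset (labels_for ws (concat L) w)))) =
      (\<Sum>L | map length L = ks. ?lw (concat L))"
  proof (rule sum.cong[OF refl])
    fix L :: "'d list list" assume "L \<in> {L. map length L = ks}"
    then have L: "ks = map length L" by simp
    have len: "length (blocks 1 ks) = length (concat L)" "length ws = length (concat L)"
      using assms by (simp_all add: L length_concat)
    have b: "blacks (length ks) = {1..<1 + int (length L)}" by (auto simp: L)
    show "(\<Prod>as\<leftarrow>L. s (mset as)) * (\<Prod>w\<in>W. D (a w) (mset (labels_for ws (concat L) w))) = ?lw (concat L)"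
      unfolding labelled_weight_def image_mset_zip_fst[OF len] image_mset_zip_snd[OF len] b
      using prod_labels_for_blocks[of "\<lambda>as. s (mset as)" 1 L] by (simp add: L)
  qed
  also have "\<dots> = (\<Sum>l | length l = sum_list ks. ?lw l)"
    by (rule sum.reindex_bij_betw[OF bij_betw_concat])
  also have "\<dots> = contraction (blacks (length ks)) W a (zip (blocks 1 ks) ws)"
    using assms by (simp add: contraction_def)
  finally show ?thesis .
qed

text \<open>The right side is the form in which the integral appears after the Leibniz rule. Its
  index tuples are grouped first by their lengths, that is by the black valencies, and then by the
  number of black vertices.\<close>

theorem total_series_nth:
  defines "W \<equiv> \<lambda>M. whites (size M)"
  shows "fps_nth (total_series M) N = (\<Sum>L | (\<forall>as\<in>set L. 2 \<le> length as) \<and> length (concat L) = N.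
    (\<Sum>a\<in>labelings (W M) M. \<Sum>ws | length ws = N \<and> set ws \<subseteq> W M.
      (\<Prod>as\<leftarrow>L. s (mset as)) * (\<Prod>w\<in>W M. D (a w) (mset (labels_for ws (concat L) w)))) /
    (fact (length L) * fact (size M)))"
proof -
  let ?W = "W M" and ?m = "size M"
  let ?T = "{L :: 'd list list. (\<forall>as\<in>set L. 2 \<le> length as) \<and> length (concat L) = N}"
  let ?KK = "{ks :: nat list. (\<forall>k\<in>set ks. 2 \<le> k) \<and> sum_list ks = N}"
  let ?K = "\<lambda>n. {ks. length ks = n \<and> (\<forall>k\<in>set ks. 2 \<le> k) \<and> sum_list ks = N}"
  let ?WS = "{ws. length ws = N \<and> set ws \<subseteq> ?W}"
  let ?h = "\<lambda>L a ws. (\<Prod>as\<leftarrow>L. s (mset as)) * (\<Prod>w\<in>?W. D (a w) (mset (labels_for ws (concat L) w)))"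
  let ?c = "\<lambda>n a E. contraction (blacks n) ?W a (SOME es. mset es = E)"
  have finW: "finite ?W" by (simp add: W_def)
  have "(\<Sum>L\<in>?T. (\<Sum>a\<in>labelings ?W M. \<Sum>ws\<in>?WS. ?h L a ws) / (fact (length L) * fact ?m)) =
      (\<Sum>ks\<in>?KK. \<Sum>L\<in>{L \<in> ?T. map length L = ks}. (\<Sum>a\<in>labelings ?W M. \<Sum>ws\<in>?WS. ?h L a ws) / (fact (length L) * fact ?m))"
    by (rule sum.group[symmetric])
       (use finite_index_tuples[where 'd = 'd, of N] finite_compositions[of N] in \<open>auto simp: length_concat\<close>)
  also have "\<dots> = (\<Sum>ks\<in>?KK. (\<Sum>a\<in>labelings ?W M. \<Sum>ws\<in>?WS. contraction (blacks (length ks)) ?W a (zip (blocks 1 ks) ws)) /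
      (fact (length ks) * fact ?m))"
  proof (rule sum.cong[OF refl])
    fix ks assume ks: "ks \<in> ?KK"
    have T: "{L \<in> ?T. map length L = ks} = {L. map length L = ks}"
      using ks by (auto simp: length_concat)
    have "(\<Sum>L\<in>{L \<in> ?T. map length L = ks}. (\<Sum>a\<in>labelings ?W M. \<Sum>ws\<in>?WS. ?h L a ws) / (fact (length L) * fact ?m)) =
        (\<Sum>L | map length L = ks. (\<Sum>a\<in>labelings ?W M. \<Sum>ws\<in>?WS. ?h L a ws) / (fact (length ks) * fact ?m))"
      unfolding T by (intro sum.cong refl) auto
    also have "\<dots> = (\<Sum>L | map length L = ks. \<Sum>a\<in>labelings ?W M. \<Sum>ws\<in>?WS. ?h L a ws) / (fact (length ks) * fact ?m)"
      by (rule sum_divide_distrib[symmetric])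
    also have "(\<Sum>L | map length L = ks. \<Sum>a\<in>labelings ?W M. \<Sum>ws\<in>?WS. ?h L a ws) =
        (\<Sum>a\<in>labelings ?W M. \<Sum>L | map length L = ks. \<Sum>ws\<in>?WS. ?h L a ws)"
      by (rule sum.swap)
    also have "\<dots> = (\<Sum>a\<in>labelings ?W M. \<Sum>ws\<in>?WS. \<Sum>L | map length L = ks. ?h L a ws)"
      by (rule sum.cong[OF refl], rule sum.swap)
    also have "\<dots> = (\<Sum>a\<in>labelings ?W M. \<Sum>ws\<in>?WS. contraction (blacks (length ks)) ?W a (zip (blocks 1 ks) ws))"
      using ks by (intro sum.cong refl sum_lists_with_lengths) auto
    finally show "(\<Sum>L\<in>{L \<in> ?T. map length L = ks}. (\<Sum>a\<in>labelings ?W M. \<Sum>ws\<in>?WS. ?h L a ws) / (fact (length L) * fact ?m)) =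
      (\<Sum>a\<in>labelings ?W M. \<Sum>ws\<in>?WS. contraction (blacks (length ks)) ?W a (zip (blocks 1 ks) ws)) / (fact (length ks) * fact ?m)" .
  qed
  also have "\<dots> = (\<Sum>n\<le>N. \<Sum>ks\<in>{ks \<in> ?KK. length ks = n}.
      (\<Sum>a\<in>labelings ?W M. \<Sum>ws\<in>?WS. contraction (blacks (length ks)) ?W a (zip (blocks 1 ks) ws)) / (fact (length ks) * fact ?m))"
    by (rule sum.group[symmetric]) (auto simp: finite_compositions length_le_sum_list)
  also have "\<dots> = (\<Sum>n\<le>N. total_weight (blacks n) ?W N M / (fact n * fact ?m))"
  proof (rule sum.cong[OF refl])
    fix n
    have "{ks \<in> ?KK. length ks = n} = ?K n" by auto
    then have "(\<Sum>ks\<in>{ks \<in> ?KK. length ks = n}.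
        (\<Sum>a\<in>labelings ?W M. \<Sum>ws\<in>?WS. contraction (blacks (length ks)) ?W a (zip (blocks 1 ks) ws)) / (fact (length ks) * fact ?m)) =
      (\<Sum>ks\<in>?K n. (\<Sum>a\<in>labelings ?W M. \<Sum>ws\<in>?WS. contraction (blacks n) ?W a (zip (blocks 1 ks) ws)) / (fact n * fact ?m))"
      by (intro sum.cong) auto
    also have "\<dots> = (\<Sum>ks\<in>?K n. \<Sum>a\<in>labelings ?W M. \<Sum>ws\<in>?WS. contraction (blacks n) ?W a (zip (blocks 1 ks) ws)) / (fact n * fact ?m)"
      by (rule sum_divide_distrib[symmetric])
    also have "(\<Sum>ks\<in>?K n. \<Sum>a\<in>labelings ?W M. \<Sum>ws\<in>?WS. contraction (blacks n) ?W a (zip (blocks 1 ks) ws)) =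
        (\<Sum>a\<in>labelings ?W M. \<Sum>ks\<in>?K n. \<Sum>ws\<in>?WS. contraction (blacks n) ?W a (zip (blocks 1 ks) ws))"
      by (rule sum.swap)
    also have "\<dots> = (\<Sum>a\<in>labelings ?W M. \<Sum>E \<in> edge_multisets (blacks n) ?W N. symmetry_factor (blacks n) E * ?c n a E)"
      by (rule sum.cong[OF refl], rule sum_arrangements[OF finW])
    also have "\<dots> = (\<Sum>E \<in> edge_multisets (blacks n) ?W N. \<Sum>a\<in>labelings ?W M. symmetry_factor (blacks n) E * ?c n a E)"
      by (rule sum.swap)
    also have "\<dots> = total_weight (blacks n) ?W N M"
      unfolding total_weight_def graph_weight_def by (simp only: sum_distrib_left)
    finally show "(\<Sum>ks\<in>{ks \<in> ?KK. length ks = n}.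
        (\<Sum>a\<in>labelings ?W M. \<Sum>ws\<in>?WS. contraction (blacks (length ks)) ?W a (zip (blocks 1 ks) ws)) / (fact (length ks) * fact ?m)) =
      total_weight (blacks n) ?W N M / (fact n * fact ?m)" .
  qed
  finally show ?thesis by (simp add: total_series_def W_def)
qed

end

section \<open>Evaluation of the formal integral\<close>

lemma hbar_over_i_nonzero: "hbar_over_i \<noteq> 0"
  by (simp add: hbar_over_i_def)

lemma i_over_hbar_eq: "i_over_hbar = inverse hbar_over_i"
proof -
  have "hbar_over_i * i_over_hbar = fls_const (1 / \<i>) * fls_const \<i> * (fls_X * fls_X_inv)"
    by (simp only: hbar_over_i_def i_over_hbar_def mult_ac)
  also have "\<dots> = 1" by (simp add: fls_X_times_conv_shift fls_const_mult_const)
  finally show ?thesis by (simp add: inverse_unique)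
qed

lemma fps_to_fls_prod: "fps_to_fls (\<Prod>x\<in>X. f x) = (\<Prod>x\<in>X. fps_to_fls (f x :: 'a::comm_ring_1 fps))"
  by (induction X rule: infinite_finite_induct) (simp_all add: fls_times_fps_to_fls)

lemma fps_to_fls_sum: "fps_to_fls (\<Sum>x\<in>X. f x) = (\<Sum>x\<in>X. fps_to_fls (f x :: 'a::comm_ring_1 fps))"
  by (induction X rule: infinite_finite_induct) simp_all

lemma mset_SOME: "mset (SOME as. mset as = A) = A"
  by (rule someI_ex) (rule ex_mset)

text \<open>A word with content \<open>M\<close> is a labeling read along the white vertices from
  \<open>-m\<close> to \<open>-1\<close>; the vertex \<open>w\<close> stands at position
  \<open>w + m\<close>.\<close>

lemma linear_power_coeff_eq:
  fixes Y' :: "real ^ 'd::finite \<Rightarrow> real ^ 'd"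
  shows "linear_power_coeff Y' M y = (\<Sum>a\<in>labelings (whites (size M)) M. \<Prod>w\<in>whites (size M). Y' y $ a w)"
proof -
  let ?m = "int (size M)" and ?W = "whites (size M)"
  have ms: "mset [-?m..-1] = mset_set ?W"
    by (subst mset_set_set[symmetric]) simp_all
  show ?thesis
    unfolding linear_power_coeff_def
  proof (rule sum.reindex_bij_witness[of _ "\<lambda>a. map a [-?m..-1]" "\<lambda>bs. \<lambda>w\<in>?W. bs ! nat (w + ?m)"], goal_cases)
    case (1 bs)
    then have "length bs = size M" by auto
    then show ?case by (intro nth_equalityI) auto
  next
    case (2 bs)
    then have len: "length bs = size M" and M: "mset bs = M" by auto
    then have "map (\<lambda>w\<in>?W. bs ! nat (w + ?m)) [-?m..-1] = bs" by (intro nth_equalityI) auto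
    then have "image_mset (\<lambda>w\<in>?W. bs ! nat (w + ?m)) (mset_set ?W) = M" using M by (metis ms mset_map)
    then show ?case by (simp add: labelings_def)
  next
    case (3 a)
    then have "a \<in> extensional ?W" by (auto simp: labelings_def PiE_def)
    then show ?case by (auto simp: fun_eq_iff extensional_def)
  next
    case (4 a)
    then show ?case by (simp add: labelings_def ms)
  next
    case (5 bs)
    then have "length bs = size M" by auto
    then have eq: "map (\<lambda>w\<in>?W. bs ! nat (w + ?m)) [-?m..-1] = bs" by (intro nth_equalityI) auto
    have "(\<Prod>b\<leftarrow>bs. Y' y $ b) = (\<Prod>w\<leftarrow>[-?m..-1]. Y' y $ (\<lambda>w\<in>?W. bs ! nat (w + ?m)) w)"
      using arg_cong[OF eq, of "\<lambda>xs. \<Prod>b\<leftarrow>xs. Y' y $ b"] by (simp only: map_map o_def)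
    also have "\<dots> = (\<Prod>w\<in>?W. Y' y $ (\<lambda>w\<in>?W. bs ! nat (w + ?m)) w)"
      by (subst prod.distinct_set_conv_list[symmetric]) simp_all
    finally show ?case by simp
  qed
qed

text \<open>Every derivative lands on exactly one factor, so the powers of
  \<open>\<hbar>/\<i>\<close> at the white vertices add up to the total number of
  derivatives.\<close>

lemma sum_length_labels_for:
  assumes "finite W" "length ws = length l" "set ws \<subseteq> W"
  shows "(\<Sum>w\<in>W. length (labels_for ws l w)) = length l"
  using assms(2,3)
proof (induction ws l rule: list_induct2)
  case Nil
  then show ?case by (simp add: labels_for_def)
next
  case (Cons v ws a l)
  have "(\<Sum>w\<in>W. length (labels_for (v # ws) (a # l) w)) = (\<Sum>w\<in>W. (if w = v then 1 else 0) + length (labels_for ws l w))"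
    by (intro sum.cong refl) (auto simp: labels_for_def)
  also have "\<dots> = Suc (length l)" using Cons assms(1) by (simp add: sum.distrib)
  finally show ?case by simp
qed

text \<open>One factor \<open>\<i>/\<hbar>\<close> per vertex and \<open>\<hbar>/\<i>\<close> per edge (inside \<open>fourier_inversion\<close>) make up
  \<open>(\<hbar>/\<i>)\<close> to the power \<open>b\<^sub>\<gamma> - 1\<close>; the remaining factor is the one in front of the logarithm.\<close>

definition black_weight :: "('n::finite, 'd::finite) gen_fun \<Rightarrow> real ^ 'n \<Rightarrow> 'd multiset \<Rightarrow> complex fls" where
  "black_weight S x A = i_over_hbar * fps_to_fls (S (SOME as. mset as = A) x)"

definition white_weight ::
  "(real ^ 'd::finite \<Rightarrow> real ^ 'd) \<Rightarrow> ('d \<Rightarrow> complex fps) \<Rightarrow> 'd \<Rightarrow> 'd multiset \<Rightarrow> complex fls" where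
  "white_weight Y' c b A = i_over_hbar * fourier_inversion (SOME as. mset as = A) (\<lambda>y. Y' y $ b) c"

text \<open>One point \<open>x\<close> is fixed, since nothing is differentiated with respect to it.
  \<open>V\<close> is the chart in which \<open>Y'\<close> is smooth and which contains the
  classical image of \<open>x\<close>.\<close>

locale thick_morphism_at =
  fixes S :: "('n::finite, 'd::finite) gen_fun" and x :: "real ^ 'n"
    and Y' :: "real ^ 'd \<Rightarrow> real ^ 'd" and V :: "(real ^ 'd) set"
  assumes open_V: "open V" and smooth: "smooth_on V Y'"
    and base_point_in: "base_point (\<lambda>a. S [a] x) \<in> V"
    and symmetric: "\<And>as bs. mset as = mset bs \<Longrightarrow> S as x = S bs x"
begin

abbreviation c :: "'d \<Rightarrow> complex fps" where "c \<equiv> \<lambda>a. S [a] x"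

sublocale vertex_weights "black_weight S x" "white_weight Y' c" .

lemma black_weight_mset: "black_weight S x (mset as) = i_over_hbar * fps_to_fls (S as x)"
  unfolding black_weight_def using symmetric[OF mset_SOME] by simp

lemma white_weight_mset:
  "white_weight Y' c b (mset as) = i_over_hbar * fourier_inversion as (\<lambda>y. Y' y $ b) c"
proof -
  let ?as = "SOME bs. mset bs = mset as"
  have "length ?as = length as" by (metis mset_SOME size_mset)
  moreover have "formal_eval (partials ?as (\<lambda>y. Y' y $ b)) c = formal_eval (partials as (\<lambda>y. Y' y $ b)) c"
    by (rule formal_eval_partials_perm[OF open_V base_point_in smooth_on_component[OF open_V smooth] mset_SOME])
  ultimately show ?thesis by (simp add: white_weight_def fourier_inversion_def)
qed

text \<open>The Leibniz rule over assignments, carried through Taylor evaluation by its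
  compatibility with sums and products.\<close>

lemma fourier_inversion_linear_power_coeff:
  "fourier_inversion l (linear_power_coeff Y' M) c =
    (\<Sum>a\<in>labelings (whites (size M)) M. \<Sum>ws | length ws = length l \<and> set ws \<subseteq> whites (size M).
      \<Prod>w\<in>whites (size M). fourier_inversion (labels_for ws l w) (\<lambda>y. Y' y $ a w) c)"
proof -
  let ?W = "whites (size M)" and ?L = "labelings (whites (size M)) M"
  let ?WS = "{ws. length ws = length l \<and> set ws \<subseteq> ?W}"
  have sm: "smooth_on V (\<lambda>y. Y' y $ b)" for b by (rule smooth_on_component[OF open_V smooth])
  have "partials l (linear_power_coeff Y' M) y =
      (\<Sum>a\<in>?L. \<Sum>ws\<in>?WS. \<Prod>w\<in>?W. partials (labels_for ws l w) (\<lambda>y. Y' y $ a w) y)" if y: "y \<in> V" for y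
  proof -
    have "partials l (linear_power_coeff Y' M) y = partials l (\<lambda>y. \<Sum>a\<in>?L. \<Prod>w\<in>?W. Y' y $ a w) y"
      by (simp add: linear_power_coeff_eq[abs_def])
    also have "\<dots> = (\<Sum>a\<in>?L. partials l (\<lambda>y. \<Prod>w\<in>?W. Y' y $ a w) y)"
      by (rule partials_sum[OF open_V smooth_on_prod[OF open_V _ sm] y]) simp
    also have "\<dots> = (\<Sum>a\<in>?L. \<Sum>ws\<in>?WS. \<Prod>w\<in>?W. partials (labels_for ws l w) (\<lambda>y. Y' y $ a w) y)"
      by (rule sum.cong[OF refl], rule partials_prod[OF open_V _ sm y]) simp
    finally show ?thesis .
  qed
  then have "formal_eval (partials l (linear_power_coeff Y' M)) c =
      formal_eval (\<lambda>y. \<Sum>a\<in>?L. \<Sum>ws\<in>?WS. \<Prod>w\<in>?W. partials (labels_for ws l w) (\<lambda>y. Y' y $ a w) y) c"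
    by (rule formal_eval_cong[OF open_V base_point_in])
  also have "\<dots> = (\<Sum>a\<in>?L. \<Sum>ws\<in>?WS. formal_eval (\<lambda>y. \<Prod>w\<in>?W. partials (labels_for ws l w) (\<lambda>y. Y' y $ a w) y) c)"
  proof -
    have s1: "smooth_on V (\<lambda>y. \<Prod>w\<in>?W. partials (labels_for ws l w) (\<lambda>y. Y' y $ a w) y)" for a ws
      by (rule smooth_on_prod[OF open_V _ smooth_on_partials[OF sm]]) simp
    have "formal_eval (\<lambda>y. \<Sum>a\<in>?L. \<Sum>ws\<in>?WS. \<Prod>w\<in>?W. partials (labels_for ws l w) (\<lambda>y. Y' y $ a w) y) c =
        (\<Sum>a\<in>?L. formal_eval (\<lambda>y. \<Sum>ws\<in>?WS. \<Prod>w\<in>?W. partials (labels_for ws l w) (\<lambda>y. Y' y $ a w) y) c)"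
      by (rule formal_eval_sum[OF open_V base_point_in smooth_on_sum[OF open_V s1]])
    also have "\<dots> = (\<Sum>a\<in>?L. \<Sum>ws\<in>?WS. formal_eval (\<lambda>y. \<Prod>w\<in>?W. partials (labels_for ws l w) (\<lambda>y. Y' y $ a w) y) c)"
      by (rule sum.cong[OF refl], rule formal_eval_sum[OF open_V base_point_in s1])
    finally show ?thesis .
  qed
  also have "\<dots> = (\<Sum>a\<in>?L. \<Sum>ws\<in>?WS. \<Prod>w\<in>?W. formal_eval (partials (labels_for ws l w) (\<lambda>y. Y' y $ a w)) c)"
    by (rule sum.cong[OF refl], rule sum.cong[OF refl],
        rule formal_eval_prod[OF open_V base_point_in _ smooth_on_partials[OF sm]]) simp
  finally have ev: "formal_eval (partials l (linear_power_coeff Y' M)) c = \<dots>" .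
  \<comment> \<open>The power of \<open>\<hbar>/\<i>\<close> is shared out among the white vertices
    according to the derivatives they receive.\<close>
  have pw: "(\<Prod>w\<in>?W. fourier_inversion (labels_for ws l w) (\<lambda>y. Y' y $ a w) c) =
      hbar_over_i ^ length l * (\<Prod>w\<in>?W. fps_to_fls (formal_eval (partials (labels_for ws l w) (\<lambda>y. Y' y $ a w)) c))"
    if "ws \<in> ?WS" for ws a
    using sum_length_labels_for[of ?W ws l] that
    by (simp add: fourier_inversion_def prod.distrib power_sum[symmetric])
  show ?thesis
    unfolding fourier_inversion_def[of l] ev fps_to_fls_sum fps_to_fls_prod sum_distrib_left
    by (rule sum.cong[OF refl], rule sum.cong[OF refl]) (simp add: pw)
qed

text \<open>The comparison is made for each list \<open>L\<close> of index tuples. The factor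
  \<open>\<i>/\<hbar>\<close> occurs once per tuple and once per variable in \<open>M\<close>, that
  is once per vertex, and the two factorials are those of the exponential series.\<close>

theorem thick_integral_eq: "thick_integral S Y' x M = total_series M"
proof (rule fps_ext)
  fix N
  let ?W = "whites (size M)"
  show "fps_nth (thick_integral S Y' x M) N = fps_nth (total_series M) N"
    unfolding thick_integral_def total_series_nth fps_nth_Abs_fps
  proof (rule sum.cong[OF refl])
    fix L :: "'d list list" assume "L \<in> {L. (\<forall>as\<in>set L. 2 \<le> length as) \<and> length (concat L) = N}"
    then have N: "length (concat L) = N" by simp
    have b: "(\<Prod>as\<leftarrow>L. black_weight S x (mset as)) = i_over_hbar ^ length L * fps_to_fls (\<Prod>as\<leftarrow>L. S as x)"
      by (induction L) (simp_all add: black_weight_mset fls_times_fps_to_fls mult_ac)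
    have w: "(\<Prod>w\<in>?W. white_weight Y' c (a w) (mset (labels_for ws (concat L) w))) =
        i_over_hbar ^ size M * (\<Prod>w\<in>?W. fourier_inversion (labels_for ws (concat L) w) (\<lambda>y. Y' y $ a w) c)" for a ws
      by (simp add: white_weight_mset prod.distrib)
    show "i_over_hbar ^ length L / fact (length L) * fps_to_fls (\<Prod>as\<leftarrow>L. S as x) *
       (i_over_hbar ^ size M / fact (size M) * fourier_inversion (concat L) (linear_power_coeff Y' M) c) =
      (\<Sum>a\<in>labelings ?W M. \<Sum>ws | length ws = N \<and> set ws \<subseteq> ?W.
      (\<Prod>as\<leftarrow>L. black_weight S x (mset as)) * (\<Prod>w\<in>?W. white_weight Y' c (a w) (mset (labels_for ws (concat L) w)))) /
      (fact (length L) * fact (size M))"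
      unfolding b w fourier_inversion_linear_power_coeff N sum_distrib_left[symmetric] by simp
  qed
qed

text \<open>\<open>labels_at\<close> tests both ends of an edge; black and white vertices have
  disjoint numbers, so only the black end can match.\<close>

lemma mset_labels_at_black:
  assumes "wf_bigraph \<gamma>" "v \<in> black \<gamma>"
  shows "mset (labels_at \<gamma> l v) = image_mset snd {#t \<in># mset (zip (edge_list \<gamma>) l). fst (fst t) = v#}"
proof -
  have es: "set (edge_list \<gamma>) = set_mset (edges \<gamma>)" by (metis edge_list_def mset_SOME set_mset_mset)
  have "filter (\<lambda>(e, a). fst e = v \<or> snd e = v) (zip (edge_list \<gamma>) l) = filter (\<lambda>t. fst (fst t) = v) (zip (edge_list \<gamma>) l)"
  proof (rule filter_cong[OF refl])
    fix t assume "t \<in> set (zip (edge_list \<gamma>) l)"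
    then have "fst t \<in># edges \<gamma>" using es by (metis prod.collapse set_zip_leftD)
    then have "fst t \<in> black \<gamma> \<times> white \<gamma>" using assms(1) by (auto simp: wf_bigraph_def)
    then have "snd (fst t) \<noteq> v" using assms(2) black_white_disjoint[of \<gamma>] by (auto simp: mem_Times_iff)
    then show "(case t of (e, a) \<Rightarrow> fst e = v \<or> snd e = v) = (fst (fst t) = v)" by (simp add: case_prod_unfold)
  qed
  then show ?thesis by (simp add: labels_at_def)
qed

lemma mset_labels_at_white:
  assumes "wf_bigraph \<gamma>" "w \<in> white \<gamma>"
  shows "mset (labels_at \<gamma> l w) = image_mset snd {#t \<in># mset (zip (edge_list \<gamma>) l). snd (fst t) = w#}"
proof -
  have es: "set (edge_list \<gamma>) = set_mset (edges \<gamma>)" by (metis edge_list_def mset_SOME set_mset_mset)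
  have "filter (\<lambda>(e, a). fst e = w \<or> snd e = w) (zip (edge_list \<gamma>) l) = filter (\<lambda>t. snd (fst t) = w) (zip (edge_list \<gamma>) l)"
  proof (rule filter_cong[OF refl])
    fix t assume "t \<in> set (zip (edge_list \<gamma>) l)"
    then have "fst t \<in># edges \<gamma>" using es by (metis prod.collapse set_zip_leftD)
    then have "fst t \<in> black \<gamma> \<times> white \<gamma>" using assms(1) by (auto simp: wf_bigraph_def)
    then have "fst (fst t) \<noteq> w" using assms(2) black_white_disjoint[of \<gamma>] by (auto simp: mem_Times_iff)
    then show "(case t of (e, a) \<Rightarrow> fst e = w \<or> snd e = w) = (snd (fst t) = w)" by (simp add: case_prod_unfold)
  qed
  then show ?thesis by (simp add: labels_at_def)
qed

end

section \<open>Matching graph weights with brackets\<close>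

lemma sum_size_filter:
  assumes "finite W" "\<And>t. t \<in># T \<Longrightarrow> h t \<in> W"
  shows "(\<Sum>w\<in>W. size {#t \<in># T. h t = w#}) = size T"
  using assms(2)
proof (induction T)
  case (add t T)
  have "(\<Sum>w\<in>W. size {#u \<in># add_mset t T. h u = w#}) = (\<Sum>w\<in>W. (if w = h t then 1 else 0) + size {#u \<in># T. h u = w#})"
    by (intro sum.cong refl) auto
  then show ?case using add assms(1) by (simp add: sum.distrib)
qed simp

text \<open>At a black vertex, grouping the white vertices by multiplicity turns the powers of
  \<open>i!\<close> into one factorial per white vertex.\<close>

lemma prod_black_factor:
  assumes "wf_bigraph \<gamma>"
  shows "(\<Prod>v\<in>black \<gamma>. black_factor \<gamma> v) = symmetry_factor (black \<gamma>) (edges \<gamma>)"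
proof -
  let ?E = "edges \<gamma>" and ?W = "white \<gamma>"
  have "(\<Prod>i = 1..vdegree \<gamma> v. fact i ^ card {w \<in> ?W. count ?E (v, w) = i}) = (\<Prod>w\<in>?W. fact (count ?E (v, w)) :: complex)"
    if v: "v \<in> black \<gamma>" for v
  proof -
    have le: "count ?E (v, w) \<le> vdegree \<gamma> v" for w
    proof -
      have "replicate_mset (count ?E (v, w)) (v, w) \<subseteq># {#e \<in># ?E. fst e = v \<or> snd e = v#}"
        by (simp add: count_le_replicate_mset_subset_eq[symmetric])
      then show ?thesis unfolding vdegree_def by (metis size_mset_mono size_replicate_mset)
    qed
    have "(\<Prod>w\<in>?W. fact (count ?E (v, w)) :: complex) =
        (\<Prod>i\<in>{0..vdegree \<gamma> v}. \<Prod>w\<in>{w \<in> ?W. count ?E (v, w) = i}. fact (count ?E (v, w)))"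
      by (rule prod.group[symmetric]) (use le in auto)
    also have "\<dots> = (\<Prod>i\<in>{0..vdegree \<gamma> v}. fact i ^ card {w \<in> ?W. count ?E (v, w) = i})"
      by (intro prod.cong refl) simp
    \<comment> \<open>Non-neighbours have multiplicity 0 and contribute
      \<open>0! = 1\<close>.\<close>
    also have "\<dots> = (\<Prod>i = 1..vdegree \<gamma> v. fact i ^ card {w \<in> ?W. count ?E (v, w) = i})"
      by (rule prod.mono_neutral_right) (auto simp: Suc_le_eq)
    finally show ?thesis ..
  qed
  then have "(\<Prod>v\<in>black \<gamma>. black_factor \<gamma> v) =
      (\<Prod>v\<in>black \<gamma>. fact (degree_at ?E v) / (\<Prod>w\<in>?W. fact (count ?E (v, w))))"
    by (intro prod.cong refl) (simp add: black_factor_def vdegree_black[OF assms])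
  also have "\<dots> = (\<Prod>v\<in>black \<gamma>. fact (degree_at ?E v)) / (\<Prod>e\<in>black \<gamma> \<times> ?W. fact (count ?E e))"
    by (simp add: prod_dividef prod.cartesian_product case_prod_unfold)
  also have "\<dots> = symmetry_factor (black \<gamma>) ?E"
    using assms by (intro symmetry_factor_superset[symmetric]) (auto simp: wf_bigraph_def)
  finally show ?thesis .
qed

text \<open>The symmetry factor is defined over any field of characteristic 0; the embedding of
  constants is a ring homomorphism, so the two versions are compared after clearing the
  denominator.\<close>

lemma fls_const_symmetry_factor:
  "fls_const (symmetry_factor B E :: complex) = symmetry_factor B E"
proof -
  have f: "fls_const (fact n :: complex) = fact n" for n
    by (metis fls_of_nat of_nat_fact)
  have p: "fls_const (\<Prod>x\<in>X. h x :: complex) = (\<Prod>x\<in>X. fls_const (h x))" for X :: "'z set" and h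
    by (induction X rule: infinite_finite_induct) (simp_all add: fls_const_mult_const[symmetric])
  have "fls_const (symmetry_factor B E :: complex) * (\<Prod>e\<in>set_mset E. fact (count E e)) = (\<Prod>v\<in>B. fact (degree_at E v))"
    unfolding f[symmetric] p[symmetric] fls_const_mult_const by (simp add: symmetry_factor_def)
  then show ?thesis by (simp add: symmetry_factor_def[where 'r = "complex fls"] eq_divide_eq)
qed

context thick_morphism_at
begin

text \<open>The powers of \<open>\<hbar>\<close> in a labelled weight depend on the graph only, not
  on labels or indices, so they come out of the contraction; what remains inside is the bracket
  without its black factors.\<close>

lemma graph_bracket_eq:
  assumes "wf_bigraph \<gamma>"
  shows "hbar_over_i powi betti \<gamma> * fps_to_fls (graph_bracket S Y' \<gamma> a x) =
    hbar_over_i * (symmetry_factor (black \<gamma>) (edges \<gamma>) * contraction (black \<gamma>) (white \<gamma>) a (edge_list \<gamma>))"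
proof -
  let ?B = "black \<gamma>" and ?W = "white \<gamma>" and ?N = "size (edges \<gamma>)"
  let ?g = "\<lambda>l. (\<Prod>v\<in>?B. fps_to_fls (S (labels_at \<gamma> l v) x)) *
      (\<Prod>w\<in>?W. fps_to_fls (formal_eval (partials (labels_at \<gamma> l w) (\<lambda>y. Y' y $ a w)) c))"
  have es: "mset (edge_list \<gamma>) = edges \<gamma>" unfolding edge_list_def by (rule mset_SOME)
  then have len: "length (edge_list \<gamma>) = ?N" by (metis size_mset)
  have lw: "labelled_weight ?B ?W a (mset (zip (edge_list \<gamma>) l)) =
      i_over_hbar ^ nblack \<gamma> * i_over_hbar ^ nwhite \<gamma> * hbar_over_i ^ ?N * ?g l" if l: "length l = ?N" for l
  proof -
    have "length (labels_at \<gamma> l w) = size {#t \<in># mset (zip (edge_list \<gamma>) l). snd (fst t) = w#}" if "w \<in> ?W" for w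
      using arg_cong[OF mset_labels_at_white[OF assms that, of l], of size] by simp
    then have "(\<Sum>w\<in>?W. length (labels_at \<gamma> l w)) = (\<Sum>w\<in>?W. size {#t \<in># mset (zip (edge_list \<gamma>) l). snd (fst t) = w#})"
      by simp
    also have "\<dots> = size (mset (zip (edge_list \<gamma>) l))"
    proof (rule sum_size_filter)
      fix t assume "t \<in># mset (zip (edge_list \<gamma>) l)"
      then have "fst t \<in># edges \<gamma>" using es by (metis prod.collapse set_mset_mset set_zip_leftD)
      then show "snd (fst t) \<in> ?W" using assms by (auto simp: wf_bigraph_def)
    qed simp
    also have "\<dots> = ?N" using l len by simp
    finally have tot: "(\<Sum>w\<in>?W. length (labels_at \<gamma> l w)) = ?N" .
    have "(\<Prod>v\<in>?B. black_weight S x (image_mset snd {#t \<in># mset (zip (edge_list \<gamma>) l). fst (fst t) = v#})) =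
        i_over_hbar ^ nblack \<gamma> * (\<Prod>v\<in>?B. fps_to_fls (S (labels_at \<gamma> l v) x))"
      by (simp add: mset_labels_at_black[OF assms, symmetric] black_weight_mset prod.distrib)
         (simp add: black_def)
    moreover have "(\<Prod>w\<in>?W. white_weight Y' c (a w) (image_mset snd {#t \<in># mset (zip (edge_list \<gamma>) l). snd (fst t) = w#})) =
        i_over_hbar ^ nwhite \<gamma> * (hbar_over_i ^ ?N *
          (\<Prod>w\<in>?W. fps_to_fls (formal_eval (partials (labels_at \<gamma> l w) (\<lambda>y. Y' y $ a w)) c)))"
      by (simp add: mset_labels_at_white[OF assms, symmetric] white_weight_mset prod.distrib
          fourier_inversion_def power_sum[symmetric] tot)
         (simp add: white_def)
    ultimately show ?thesis unfolding labelled_weight_def by (simp only: mult_ac)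
  qed
  have powers: "hbar_over_i * (i_over_hbar ^ nblack \<gamma> * i_over_hbar ^ nwhite \<gamma> * hbar_over_i ^ ?N) = hbar_over_i powi betti \<gamma>"
  proof -
    have card: "card (vertices \<gamma>) = nblack \<gamma> + nwhite \<gamma>"
      using card_Un_disjoint[OF finite_black finite_white black_white_disjoint]
      by (simp add: vertices_def) (simp add: black_def white_def)
    have "betti \<gamma> = 1 + int ?N - int (nblack \<gamma>) - int (nwhite \<gamma>)" by (simp add: betti_def card)
    then show ?thesis
      using hbar_over_i_nonzero
      by (simp only: power_int_add power_int_diff power_int_of_nat power_int_1_right i_over_hbar_eq power_inverse
          simp_thms divide_inverse mult_ac)
  qed
  have "fps_to_fls (graph_bracket S Y' \<gamma> a x) = (\<Sum>l | length l = ?N. symmetry_factor ?B (edges \<gamma>) * ?g l)"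
    unfolding graph_bracket_def fps_to_fls_sum
  proof (rule sum.cong[OF refl])
    fix l :: "'d list"
    have "(\<Prod>v\<in>?B. fls_const (black_factor \<gamma> v)) = symmetry_factor ?B (edges \<gamma>)"
    proof -
      have "(\<Prod>v\<in>X. fls_const (black_factor \<gamma> v)) = fls_const (\<Prod>v\<in>X. black_factor \<gamma> v)" for X
        by (induction X rule: infinite_finite_induct) (simp_all add: fls_const_mult_const)
      then show ?thesis by (simp only: prod_black_factor[OF assms] fls_const_symmetry_factor)
    qed
    then show "fps_to_fls ((\<Prod>v\<in>?B. fps_const (black_factor \<gamma> v) * S (labels_at \<gamma> l v) x) *
        (\<Prod>w\<in>?W. formal_eval (partials (labels_at \<gamma> l w) (\<lambda>y. Y' y $ a w)) c)) = symmetry_factor ?B (edges \<gamma>) * ?g l"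
      by (simp add: fls_times_fps_to_fls fps_to_fls_prod prod.distrib)
  qed
  moreover have "contraction ?B ?W a (edge_list \<gamma>) =
      i_over_hbar ^ nblack \<gamma> * i_over_hbar ^ nwhite \<gamma> * hbar_over_i ^ ?N * (\<Sum>l | length l = ?N. ?g l)"
    unfolding contraction_def len sum_distrib_left by (rule sum.cong[OF refl]) (simp add: lw)
  ultimately show ?thesis
    unfolding powers[symmetric] sum_distrib_left[symmetric] by (simp only: mult_ac)
qed

text \<open>Without white vertices, black vertices of positive valency are impossible and only the
  empty graph is left. The logarithm requires this constant term; it relies on the exponential of
  \<open>S\<^sup>0\<close> being split off.\<close>

lemma total_series_empty: "total_series {#} = 1"
proof (rule fps_ext)
  fix N
  have lab: "labelings {} {#} = {\<lambda>_. undefined :: 'd}" by (auto simp: labelings_def)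
  have gw: "graph_weight {} {} {#} {#} = 1"
    by (simp add: graph_weight_alt[of "[]"] lab contraction_def labelled_weight_def symmetry_factor_def)
  have "edge_multisets (blacks n) {} N = (if n = 0 \<and> N = 0 then {{#}} else {})" for n
  proof -
    have e: "E = {#}" "N = 0" "n = 0" if "E \<in> edge_multisets (blacks n) {} N" for E
    proof -
      show "E = {#}" using that by (simp add: edge_multisets_def)
      then show "N = 0" using that by (simp add: edge_multisets_def)
      then show "n = 0" using that edge_multisets_empty[of N "blacks n" "{}"] by (cases "n = 0") auto
    qed
    show ?thesis
    proof (cases "n = 0 \<and> N = 0")
      case True
      then have "{#} \<in> edge_multisets (blacks n) {} N" by (simp add: edge_multisets_def)
      then show ?thesis using True e(1) by auto
    next
      case False
      then show ?thesis using e(2,3) by auto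
    qed
  qed
  then have "total_weight (blacks n) {} N {#} = (if n = 0 \<and> N = 0 then 1 else 0)" for n
    by (simp add: total_weight_def gw)
  then show "fps_nth (total_series {#}) N = fps_nth 1 N"
    by (simp add: total_series_def if_distrib[of "\<lambda>x. x / _"] cong: if_cong)
qed

lemma formal_log_thick_integral:
  assumes "M \<noteq> {#}"
  shows "formal_log (thick_integral S Y' x) M = connected_series M"
proof -
  \<comment> \<open>\<open>connected_series\<close> counts the empty graph at \<open>{#}\<close>,
    where a logarithm must vanish. Resetting that coefficient is invisible to
    \<open>euler\<close>.\<close>
  let ?C = "\<lambda>M. if M = {#} then 0 else connected_series M"
  have Z: "thick_integral S Y' x = total_series" by (rule ext) (rule thick_integral_eq)
  have "euler ?C = euler connected_series" by (auto simp: euler_def)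
  then have "formal_log total_series M = ?C M"
    by (intro formal_log_unique total_series_empty) (simp_all add: euler_total_series)
  then show ?thesis using assms Z by simp
qed

text \<open>Only the one-vertex black graph has no white vertex; its weight gives back the removed
  term \<open>S\<^sup>0\<close> after multiplication by \<open>\<hbar>/\<i>\<close>.\<close>

lemma sum_Gamma_circ_empty:
  "(\<Sum>\<gamma> \<in> {\<gamma> \<in> Gamma_circ. size (edges \<gamma>) = N}.
      graph_weight (black \<gamma>) (white \<gamma>) (edges \<gamma>) {#} / (fact (nblack \<gamma>) * fact (nwhite \<gamma>))) =
    (if N = 0 then i_over_hbar * fps_to_fls (S [] x) else 0)"
proof -
  let ?h = "\<lambda>\<gamma>. graph_weight (black \<gamma>) (white \<gamma>) (edges \<gamma>) {#} / (fact (nblack \<gamma>) * fact (nwhite \<gamma>))"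
  let ?p = "Bigraph 1 0 {#}"
  have "(\<Sum>\<gamma> \<in> {\<gamma> \<in> Gamma_circ. size (edges \<gamma>) = N}. ?h \<gamma>) = (\<Sum>\<gamma> \<in> {\<gamma> \<in> {?p}. N = 0}. ?h \<gamma>)"
  proof (rule sum.mono_neutral_right)
    show "finite {\<gamma> \<in> Gamma_circ. size (edges \<gamma>) = N}" by (rule finite_Gamma_circ_edges)
    show "{\<gamma> \<in> {?p}. N = 0} \<subseteq> {\<gamma> \<in> Gamma_circ. size (edges \<gamma>) = N}"
      by (auto simp: Gamma_circ_iff)
    have "graph_weight (black \<gamma>) (white \<gamma>) (edges \<gamma>) {#} = 0" if "nwhite \<gamma> \<noteq> 0" for \<gamma>
      using that by (intro graph_weight_eq_0) (simp add: white_def)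
    then show "\<forall>\<gamma> \<in> {\<gamma> \<in> Gamma_circ. size (edges \<gamma>) = N} - {\<gamma> \<in> {?p}. N = 0}. ?h \<gamma> = 0"
      by (auto simp: Gamma_circ_iff)
  qed
  moreover have "?h ?p = i_over_hbar * fps_to_fls (S [] x)"
  proof -
    have lab: "labelings {} {#} = {\<lambda>_. undefined :: 'd}" by (auto simp: labelings_def)
    have "graph_weight {1} {} {#} {#} = black_weight S x {#}"
      by (simp add: graph_weight_alt[of "[]"] lab contraction_def labelled_weight_def symmetry_factor_def degree_at_def)
    then show ?thesis using black_weight_mset[of "[]"] by (simp add: black_def white_def)
  qed
  ultimately show ?thesis by simp
qed

theorem transformed_gen_fun_eq:
  "transformed_gen_fun S Y' x M =
    Abs_fps (\<lambda>N. \<Sum>C \<in> {C \<in> Gamma_circ_classes. size (edges (class_rep C)) = N}.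
      let \<gamma> = class_rep C in
      \<Sum>a \<in> {a \<in> white_labelings \<gamma>. label_monomial \<gamma> a = M}.
        1 / of_nat (card (sym_group \<gamma>)) * hbar_over_i powi betti \<gamma> *
        fps_to_fls (graph_bracket S Y' \<gamma> a x))"
proof (rule fps_ext)
  fix N
  let ?gw = "\<lambda>\<gamma>. graph_weight (black \<gamma>) (white \<gamma>) (edges \<gamma>) M"
  have inv: "hbar_over_i * ?gw (relabel p \<gamma>) = hbar_over_i * ?gw \<gamma>"
    if "\<gamma> \<in> Gamma_circ" "p \<in> vertex_perms \<gamma>" for \<gamma> p
  proof -
    have st: "fst p permutes black \<gamma>" "snd p permutes white \<gamma>" using that(2) by (auto simp: vertex_perms_def)
    show ?thesis
      using graph_weight_relabel[OF permutes_bij[OF st(1)] permutes_bij[OF st(2)], of "black \<gamma>" "white \<gamma>" "edges \<gamma>" M]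
      by (simp add: permutes_image[OF st(1)] permutes_image[OF st(2)])
  qed
  have "(\<Sum>C \<in> {C \<in> Gamma_circ_classes. size (edges (class_rep C)) = N}.
      let \<gamma> = class_rep C in
      \<Sum>a \<in> {a \<in> white_labelings \<gamma>. label_monomial \<gamma> a = M}.
        1 / of_nat (card (sym_group \<gamma>)) * hbar_over_i powi betti \<gamma> *
        fps_to_fls (graph_bracket S Y' \<gamma> a x)) =
    (\<Sum>C \<in> {C \<in> Gamma_circ_classes. size (edges (class_rep C)) = N}.
      hbar_over_i * ?gw (class_rep C) / of_nat (card (sym_group (class_rep C))))"
  proof (rule sum.cong[OF refl])
    fix C assume "C \<in> {C \<in> Gamma_circ_classes. size (edges (class_rep C)) = N}"
    then have wf: "wf_bigraph (class_rep C)" by (auto intro: Gamma_circ_wf class_rep_in_Gamma_circ)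
    define \<gamma> where "\<gamma> = class_rep C"
    have "{a \<in> white_labelings \<gamma>. label_monomial \<gamma> a = M} = labelings (white \<gamma>) M"
      by (simp add: white_labelings_def label_monomial_def labelings_def)
    then have "(\<Sum>a \<in> {a \<in> white_labelings \<gamma>. label_monomial \<gamma> a = M}.
        1 / of_nat (card (sym_group \<gamma>)) * hbar_over_i powi betti \<gamma> * fps_to_fls (graph_bracket S Y' \<gamma> a x)) =
      (\<Sum>a \<in> labelings (white \<gamma>) M. 1 / of_nat (card (sym_group \<gamma>)) * (hbar_over_i *
        (symmetry_factor (black \<gamma>) (edges \<gamma>) * contraction (black \<gamma>) (white \<gamma>) a (edge_list \<gamma>))))"
      using graph_bracket_eq[of \<gamma>] wf by (simp only: mult.assoc \<gamma>_def)
    also have "\<dots> = hbar_over_i * ?gw \<gamma> / of_nat (card (sym_group \<gamma>))"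
      unfolding sum_distrib_left[symmetric] graph_weight_def edge_list_def by simp
    finally show "(let \<gamma> = class_rep C in \<Sum>a \<in> {a \<in> white_labelings \<gamma>. label_monomial \<gamma> a = M}.
        1 / of_nat (card (sym_group \<gamma>)) * hbar_over_i powi betti \<gamma> * fps_to_fls (graph_bracket S Y' \<gamma> a x)) =
      hbar_over_i * ?gw (class_rep C) / of_nat (card (sym_group (class_rep C)))" by (simp add: \<gamma>_def Let_def)
  qed
  also have "\<dots> = (\<Sum>\<gamma> \<in> {\<gamma> \<in> Gamma_circ. size (edges \<gamma>) = N}. hbar_over_i * ?gw \<gamma> / (fact (nblack \<gamma>) * fact (nwhite \<gamma>)))"
    by (rule sum_classes) (rule inv)
  also have "\<dots> = hbar_over_i * (\<Sum>\<gamma> \<in> {\<gamma> \<in> Gamma_circ. size (edges \<gamma>) = N}. ?gw \<gamma> / (fact (nblack \<gamma>) * fact (nwhite \<gamma>)))"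
    by (simp add: sum_distrib_left)
  also have "\<dots> = fps_nth (transformed_gen_fun S Y' x M) N"
  \<comment> \<open>In degree zero the logarithm is an empty sum and \<open>S\<^sup>0\<close> stands
    alone; in positive degree only the logarithm is left.\<close>
  proof (cases "M = {#}")
    case True
    then show ?thesis
      using sum_Gamma_circ_empty[of N] hbar_over_i_nonzero
      by (simp add: transformed_gen_fun_def series_one_def formal_log_def i_over_hbar_eq)
  next
    case False
    then show ?thesis
      by (simp add: sum_Gamma_circ transformed_gen_fun_def series_one_def formal_log_thick_integral)
  qed
  finally show "fps_nth (transformed_gen_fun S Y' x M) N = fps_nth (Abs_fps (\<lambda>N. \<Sum>C \<in> {C \<in> Gamma_circ_classes. size (edges (class_rep C)) = N}.
      let \<gamma> = class_rep C in
      \<Sum>a \<in> {a \<in> white_labelings \<gamma>. label_monomial \<gamma> a = M}.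
        1 / of_nat (card (sym_group \<gamma>)) * hbar_over_i powi betti \<gamma> *
        fps_to_fls (graph_bracket S Y' \<gamma> a x))) N" by simp
qed

end

theorem mainTheorem8:
  fixes U U' :: "(real ^ 'n::finite) set" and V V' :: "(real ^ 'd::finite) set"
    and S :: "('n, 'd) gen_fun"
    and X X' :: "real ^ 'n \<Rightarrow> real ^ 'n" and Y Y' :: "real ^ 'd \<Rightarrow> real ^ 'd"
    and x' :: "real ^ 'n" and M :: "'d multiset"
  assumes "quantum_generating_function U V S"
    and "coordinate_change U' U X X'"
    and "coordinate_change V' V Y Y'"
    and "x' \<in> U'"
  shows "transformed_gen_fun S Y' (X x') M =
    Abs_fps (\<lambda>N. \<Sum>C \<in> {C \<in> Gamma_circ_classes. size (edges (class_rep C)) = N}.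
      let \<gamma> = class_rep C in
      \<Sum>a \<in> {a \<in> white_labelings \<gamma>. label_monomial \<gamma> a = M}.
        1 / of_nat (card (sym_group \<gamma>)) * hbar_over_i powi betti \<gamma> *
        fps_to_fls (graph_bracket S Y' \<gamma> a (X x')))"
proof -
  have x: "X x' \<in> U" using assms(2,4) by (auto simp: coordinate_change_def)
  have "thick_morphism_at S (X x') Y' V"
  proof
    show "open V" "smooth_on V Y'" using assms(3) by (simp_all add: coordinate_change_def)
    have "\<exists>y\<in>V. \<forall>a. fps_nth (S [a] (X x')) 0 = of_real (y $ a)"
      using assms(1) x unfolding quantum_generating_function_def by blast
    then obtain y where "y \<in> V" "\<And>a. fps_nth (S [a] (X x')) 0 = of_real (y $ a)" by blast
    \<comment> \<open>The classical part of \<open>\<phi>\<^sub>\<hbar>\<close> is real by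
      assumption, so taking real parts loses nothing.\<close>
    moreover from this have "base_point (\<lambda>a. S [a] (X x')) = y" by (simp add: base_point_def vec_eq_iff)
    ultimately show "base_point (\<lambda>a. S [a] (X x')) \<in> V" by simp
    show "S as (X x') = S bs (X x')" if "mset as = mset bs" for as bs
      using assms(1) x that unfolding quantum_generating_function_def by blast
  qed
  then interpret thick_morphism_at S "X x'" Y' V .
  show ?thesis by (rule transformed_gen_fun_eq)
qed

end
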